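(* Let $L_0$, $L_1$ and $L_{-1}$ be three distinct rays in $\mathbb{C}$ emanating from the origin and let $\mathcal{F}$ be the family of all functions holomorphic in $\mathbb{D}$ for which all zeros lie on $L_0$ and all $1$-points lie on $L_1\cup L_{-1}$. Assume that neither $\angle(L_{-1},L_1)=\pi$ nor $\angle(L_0,L_1)=\angle(L_0,L_{-1})<\pi/2$. Then $\mathcal{F}$ is normal in $\mathbb{D}\setminus\{0\}$.
   Context: $\mathbb{D}=\{z\in\mathbb{C}\colon |z|<1\}$ is the open unit disk. A $1$-point of $f$ is a point $z$ in the domain of $f$ with $f(z)=1$. For rays $L,L'$ emanating from the origin, $\angle(L,L')\in[0,\pi]$ denotes the angle between them. A family of holomorphic functions is normal in a domain if every sequence in the family has a subsequence converging locally uniformly there with respect to the spherical metric (so the limit is holomorphic or identically $\infty$). *)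

theory Defs
  imports "HOL-Analysis.Analysis"
begin

text \<open>The unoriented angle in \<open>[0, pi]\<close> between two nonzero vectors
  (with value \<open>pi / 2\<close> if one of them is zero).\<close>

definition vangle :: "'a::real_inner \<Rightarrow> 'a \<Rightarrow> real" where
  "vangle u v = arccos (inner u v / (norm u * norm v))"


section \<open>Rays from the origin\<close>

text \<open>Rays are closed, that is, they contain their endpoint \<open>0\<close>.\<close>

definition ray :: "complex \<Rightarrow> complex set" where
  "ray u = {t *\<^sub>R u | t. 0 \<le> t}"

definition is_ray :: "complex set \<Rightarrow> bool" where
  "is_ray L \<longleftrightarrow> (\<exists>u. u \<noteq> 0 \<and> L = ray u)"

definition ray_direction :: "complex set \<Rightarrow> complex" where
  "ray_direction L = (THE u. u \<in> L \<and> norm u = 1)"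

definition ray_angle :: "complex set \<Rightarrow> complex set \<Rightarrow> real" where
  "ray_angle L L' = vangle (ray_direction L) (ray_direction L')"

lemma ray_direction_ray:
  assumes "u \<noteq> 0"
  shows "ray_direction (ray u) = sgn u"
  unfolding ray_direction_def
proof (rule the_equality)
  show "sgn u \<in> ray u \<and> norm (sgn u) = 1"
    using assms by (auto simp: ray_def sgn_div_norm intro!: exI[of _ "inverse (norm u)"])
next
  fix v assume "v \<in> ray u \<and> norm v = 1"
  then obtain t where t: "0 \<le> t" "v = t *\<^sub>R u" "norm v = 1"
    by (auto simp: ray_def)
  then have "t * norm u = 1" by simp
  then have "t = inverse (norm u)" using assms by (simp add: field_simps)
  then show "v = sgn u" using t by (simp add: sgn_div_norm)
qed

lemma ray_angle_ray:
  assumes "u \<noteq> 0" "v \<noteq> 0"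
  shows "ray_angle (ray u) (ray v) = vangle u v"
  using assms
  by (simp add: ray_angle_def ray_direction_ray vangle_def sgn_div_norm field_simps)


section \<open>The spherical metric on the extended complex plane\<close>

datatype ext_complex = Fin complex | Infty

text \<open>Inverse stereographic projection onto the unit sphere of \<open>\<complex> \<times> \<real>\<close>,
  with \<open>\<infinity>\<close> going to the north pole.\<close>

fun to_sphere :: "ext_complex \<Rightarrow> complex \<times> real" where
  "to_sphere (Fin z) =
     ((2 / ((norm z)\<^sup>2 + 1)) *\<^sub>R z, ((norm z)\<^sup>2 - 1) / ((norm z)\<^sup>2 + 1))"
| "to_sphere Infty = (0, 1)"

text \<open>Great-circle distance, i.e. the distance induced by the line element
  \<open>2 |dz| / (1 + |z|\<^sup>2)\<close>; the chordal distance is the Euclidean distance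
  of the images under \<open>to_sphere\<close>.\<close>

definition sph_dist :: "ext_complex \<Rightarrow> ext_complex \<Rightarrow> real" where
  "sph_dist p q = vangle (to_sphere p) (to_sphere q)"

lemma norm_to_sphere [simp]: "norm (to_sphere p) = 1"
proof (cases p)
  case (Fin z)
  define s where "s = (norm z)\<^sup>2"
  have s: "0 \<le> s" by (simp add: s_def)
  have "(norm ((2 / (s + 1)) *\<^sub>R z))\<^sup>2 = 4 * s / (s + 1)\<^sup>2"
    by (simp add: power_mult_distrib power_divide s_def)
  moreover have "4 * s / (s + 1)\<^sup>2 + ((s - 1) / (s + 1))\<^sup>2 = 1"
  proof -
    have "4 * s + (s - 1)\<^sup>2 = (s + 1)\<^sup>2" by (simp add: power2_eq_square algebra_simps)
    moreover have "(s + 1)\<^sup>2 \<noteq> 0" using s by simp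
    ultimately show ?thesis by (simp add: power_divide flip: add_divide_distrib)
  qed
  ultimately have "(norm ((2 / (s + 1)) *\<^sub>R z))\<^sup>2 + (norm ((s - 1) / (s + 1)))\<^sup>2 = 1"
    by (simp only: real_norm_def power2_abs)
  then show ?thesis
    unfolding Fin by (simp only: to_sphere.simps norm_Pair s_def real_sqrt_one)
qed (simp add: norm_Pair)

lemma cos_sph_dist:
  "cos (sph_dist p q) = 1 - (dist (to_sphere p) (to_sphere q))\<^sup>2 / 2"
proof -
  have "\<bar>inner (to_sphere p) (to_sphere q)\<bar> \<le> 1"
    using Cauchy_Schwarz_ineq2[of "to_sphere p" "to_sphere q"] by simp
  then have "cos (sph_dist p q) = inner (to_sphere p) (to_sphere q)"
    by (simp add: sph_dist_def vangle_def cos_arccos_abs)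
  moreover have "(dist (to_sphere p) (to_sphere q))\<^sup>2
      = 2 - 2 * inner (to_sphere p) (to_sphere q)"
    using dot_norm_neg[of "to_sphere p" "to_sphere q"] by (simp add: dist_norm)
  ultimately show ?thesis by (simp add: field_simps)
qed


section \<open>Normal families\<close>

definition sph_locally_uniform_limit ::
  "complex set \<Rightarrow> (nat \<Rightarrow> complex \<Rightarrow> ext_complex) \<Rightarrow> (complex \<Rightarrow> ext_complex) \<Rightarrow> bool" where
  "sph_locally_uniform_limit S f g \<longleftrightarrow>
     (\<forall>z\<in>S. \<exists>d>0. \<forall>e>0. \<forall>\<^sub>F n in sequentially.
        \<forall>w\<in>ball z d \<inter> S. sph_dist (f n w) (g w) < e)"

text \<open>For families of functions holomorphic on the domain \<open>S\<close>. As usual, no condition is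
  imposed on the limit \<open>g\<close>; that it is holomorphic or identically \<open>\<infinity>\<close> is a consequence.\<close>

definition normal_on :: "(complex \<Rightarrow> complex) set \<Rightarrow> complex set \<Rightarrow> bool" where
  "normal_on \<F> S \<longleftrightarrow>
     (\<forall>f :: nat \<Rightarrow> complex \<Rightarrow> complex. range f \<subseteq> \<F> \<longrightarrow>
        (\<exists>(r :: nat \<Rightarrow> nat) g. strict_mono r \<and>
           sph_locally_uniform_limit S (\<lambda>n z. Fin (f (r n) z)) g))"

end

theory Submission
  imports Defs "HOL-Complex_Analysis.Complex_Analysis"
begin

text \<open>
Why the theorem is true. After a rotation the zeros lie on the negative real axis and the
\<open>1\<close>-points on two rays at angles \<open>\<alpha>1 < \<alpha>2\<close> in \<open>(-\<pi>, \<pi>)\<close>. The three rays bound three sectors,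
\<open>T\<close> between the two rays of \<open>1\<close>-points and \<open>S1\<close>, \<open>S2\<close> on either side of the negative axis. On each
sector the functions omit \<open>0\<close> and \<open>1\<close>, so Montel's theorem gives a subsequence which converges on all
three, each limit being finite or \<open>\<infinity>\<close>.

Next one asks what happens on the rays. A sequence whose limits are finite on both sides of a ray,
and which omits \<open>0\<close> and \<open>1\<close> off the ray, also converges across it (\<open>line_convergence\<close>): iterating
Schottky's theorem bounds \<open>log |f|\<close> by a power of the reciprocal distance to the ray, and the maximum
principle on a thin rhombus with a suitable exponential multiplier removes the ray. Applied to
\<open>f\<close>, \<open>1 / f\<close> and \<open>1 / (1 - f)\<close> this shows that convergence can fail on a ray only if the limit is \<open>\<infinity>\<close>
on one side and, on the other, \<open>0\<close> (a ray of \<open>1\<close>-points) or \<open>1\<close> (the ray of zeros). Going round the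
origin, the only patterns with a failure are \<open>(0, \<infinity>, 0)\<close> and \<open>(\<infinity>, 0, \<infinity>)\<close> for \<open>(S1, T, S2)\<close>, and in both
cases the sequence converges across the ray of zeros.

These two patterns are excluded by the hypothesis on the angles (\<open>opposite_limits_force_angles\<close>).
Let \<open>g\<close> be \<open>f\<close> or \<open>1 / f\<close>, so that \<open>g\<close> tends to \<open>\<infinity>\<close> on \<open>T\<close> and to \<open>0\<close> on \<open>S1\<close> and \<open>S2\<close>. Along a subsequence, suitable
roots \<open>g\<^sub>k powr (1 / n\<^sub>k)\<close> converge on the slit disc to a zero-free function \<open>exp h\<close>, where \<open>u = Re h\<close> is positive
on \<open>T\<close>, zero on its two boundary rays and nonpositive on \<open>S1\<close> and \<open>S2\<close>. Reflection shows that
\<open>u z = Im (F (i * (z e\<^sup>-\<^sup>i\<^sup>\<mu>) powr \<rho>))\<close> with \<open>\<rho> = \<pi> / (\<alpha>2 - \<alpha>1)\<close>, \<open>\<mu> = (\<alpha>1 + \<alpha>2) / 2\<close> and a function \<open>F\<close> on the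
punctured disc which preserves both half-planes. By Picard's theorem such an \<open>F\<close> has at worst a
simple pole (\<open>half_plane_map_isolated_singularity\<close>), so to leading order at the origin \<open>u\<close> is a positive multiple of
\<open>r powr (m \<rho>) * cos (\<rho> (\<theta> - \<mu>))\<close> with \<open>m = 1\<close> or \<open>m = -1\<close>. The sign of \<open>u\<close> gives
\<open>\<rho> (\<pi> + \<bar>\<mu>\<bar>) \<le> 3 \<pi> / 2\<close>. Finally, the zeros lie on the negative axis and count positively, hence the jump of
\<open>h'\<close> across that axis lies on a half-line (\<open>log_derivative_jump\<close>); in leading order this says that
\<open>sin (\<rho> \<pi>) e\<^sup>i\<^sup>\<rho>\<^sup>\<mu>\<close> is real and nonnegative. With the bounds on \<open>\<rho>\<close> and \<open>\<mu>\<close> this leaves only \<open>\<alpha>2 - \<alpha>1 = \<pi>\<close>, or \<open>\<mu> = 0\<close> and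
\<open>\<alpha>2 - \<alpha>1 > \<pi>\<close>, which are the two excluded configurations.
\<close>

section \<open>Growth of functions omitting zero and one\<close>

text \<open>A Harnack inequality for \<open>log |f|\<close>. Schottky's bound is doubly exponential in \<open>|f a|\<close>, but
with \<open>f\<close> every branch of a root of \<open>f\<close> omits \<open>0\<close> and \<open>1\<close> too; applying Schottky to the root of order about \<open>A\<close>,
which is bounded by \<open>e\<close> at the centre, makes the bound for \<open>log |f|\<close> linear in \<open>A\<close>.\<close>

lemma Schottky_log_bound:
  "\<exists>N::nat. \<forall>f a r A. 0 < r \<longrightarrow> f holomorphic_on ball a r \<longrightarrow> (\<forall>z\<in>ball a r. f z \<noteq> 0 \<and> f z \<noteq> 1) \<longrightarrow>
     1 \<le> A \<longrightarrow> norm (f a) \<le> exp A \<longrightarrow> (\<forall>z\<in>cball a (r/2). norm (f z) \<le> exp (2^N * A))"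
proof -
  define S where "S = pi * exp (pi * (2 + 2 * 3 + 12 * (2/3) / (1 - 2/3)))"
  have S0: "S > 0" by (simp add: S_def)
  obtain N :: nat where N: "2 * S < 2^N" using real_arch_pow[of 2 "2*S"] by auto
  show ?thesis
  proof (intro exI[of _ N] allI impI ballI)
    fix f :: "complex \<Rightarrow> complex" and a r A z
    assume r: "0 < r" and hol: "f holomorphic_on ball a r"
      and om: "\<forall>z\<in>ball a r. f z \<noteq> 0 \<and> f z \<noteq> 1" and A: "1 \<le> A" and fa: "norm (f a) \<le> exp A"
      and z: "z \<in> cball a (r/2)"
    obtain L where L: "L holomorphic_on ball a r" "\<And>z. z \<in> ball a r \<Longrightarrow> f z = exp (L z)"
      using contractible_imp_holomorphic_log[OF hol] om
      by (metis convex_imp_contractible convex_ball)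
    define n where "n = nat \<lceil>A\<rceil>"
    have n: "A \<le> real n" "real n \<le> 2 * A" "n > 0"
      unfolding n_def using A by linarith+
    define g where "g = (\<lambda>w. exp (L w / of_nat n))"
    have ghol: "g holomorphic_on ball a r"
      unfolding g_def using n by (intro holomorphic_intros L) auto
    have gn: "g w ^ n = f w" if "w \<in> ball a r" for w
      using that n by (simp add: g_def L flip: exp_of_nat_mult)
    \<comment> \<open>The function is known on the open disc only; Schottky's theorem is applied to the closed disc of radius
      \<open>3 r / 4\<close>, in which the half radius corresponds to \<open>2/3\<close>.\<close>
    define u where "u = (\<lambda>w. g (a + of_real (3/4*r) * w))"
    have sub: "a + of_real (3/4*r) * w \<in> ball a r" if "w \<in> cball 0 1" for w
    proof -
      have "norm (of_real (3/4*r) * w) = 3/4 * r * norm w"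
        using r by (simp only: norm_mult norm_of_real)
      also have "\<dots> \<le> 3/4 * r * 1" using that r by (intro mult_left_mono) auto
      also have "\<dots> < r" using r by simp
      finally have "norm (of_real (3/4*r) * w) < r" .
      then show ?thesis by (simp add: dist_norm del: of_real_mult of_real_divide)
    qed
    have uhol: "u holomorphic_on cball 0 1"
      unfolding u_def
      by (rule holomorphic_on_compose_gen[OF _ ghol, unfolded o_def])
         (use sub in \<open>auto intro!: holomorphic_intros\<close>)
    have u0: "norm (u 0) \<le> 3"
    proof -
      have "norm (u 0) ^ n \<le> exp A"
        using gn[of a] r fa by (simp add: u_def flip: norm_power)
      also have "\<dots> \<le> exp 1 ^ n" using n by (simp flip: exp_of_nat_mult)
      finally have "norm (u 0) \<le> exp 1" using n power_le_imp_le_base[of _ "n-1"] by auto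
      also have "\<dots> \<le> (3::real)" using e_less_272 by simp
      finally show ?thesis .
    qed
    have u01: "\<not> (u w = 0 \<or> u w = 1)" if "w \<in> cball 0 1" for w
      using sub[OF that] gn[OF sub[OF that]] om by (auto simp: u_def g_def)
    define w where "w = (z - a) / of_real (3/4*r)"
    have w: "norm w \<le> 2/3"
    proof -
      have "norm (z - a) \<le> r/2" using z by (simp add: dist_norm norm_minus_commute)
      moreover have "norm w = norm (z - a) / (3/4*r)"
        unfolding w_def norm_divide norm_of_real using r by simp
      moreover have "norm (z - a) / (3/4*r) \<le> (r/2) / (3/4*r)"
        using r \<open>norm (z - a) \<le> r/2\<close> by (intro divide_right_mono) auto
      ultimately show ?thesis using r by simp
    qed
    have zw: "z = a + of_real (3/4*r) * w"
    proof -
      have "of_real (3/4*r) \<noteq> (0::complex)" unfolding of_real_eq_0_iff using r by simp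
      then show ?thesis by (simp add: w_def del: of_real_mult of_real_divide)
    qed
    have "norm (u w) \<le> exp S"
      unfolding S_def by (rule Schottky[OF uhol u0 u01 _ _ w]) auto
    moreover have "z \<in> ball a r" using z r by auto
    ultimately have "norm (f z) \<le> exp S ^ n"
      using gn[of z] by (metis norm_ge_zero norm_power power_mono u_def zw)
    also have "\<dots> = exp (real n * S)" by (simp flip: exp_of_nat_mult)
    also have "\<dots> \<le> exp (2^N * A)"
    proof -
      have "real n * S \<le> 2 * A * S" using n S0 by (intro mult_right_mono) auto
      also have "\<dots> \<le> 2^N * A" using N A by (simp add: mult.commute mult_left_mono)
      finally show ?thesis by simp
    qed
    finally show "norm (f z) \<le> exp (2^N * A)" .
  qed
qed

text \<open>Halving the distance to the diameter multiplies the bound for \<open>log |f|\<close> by \<open>2\<^sup>N\<close>, so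
that the bound grows only like a power of the reciprocal distance.\<close>

lemma half_disc_growth:
  "\<exists>N::nat. \<forall>f A. f holomorphic_on (ball 0 1 \<inter> {z. 0 < Im z}) \<longrightarrow>
     (\<forall>z\<in>ball 0 1 \<inter> {z. 0 < Im z}. f z \<noteq> 0 \<and> f z \<noteq> 1) \<longrightarrow> 1 \<le> A \<longrightarrow>
     (\<forall>z. \<bar>Re z\<bar> \<le> 1/2 \<longrightarrow> Im z = 1/4 \<longrightarrow> norm (f z) \<le> exp A) \<longrightarrow>
     (\<forall>z. \<bar>Re z\<bar> \<le> 1/2 \<longrightarrow> 0 < Im z \<longrightarrow> Im z \<le> 1/4 \<longrightarrow> norm (f z) \<le> exp (A / Im z ^ N))"
proof -
  obtain N :: nat where N: "\<And>f a r A z. \<lbrakk>0 < r; f holomorphic_on ball a r; \<And>z. z\<in>ball a r \<Longrightarrow> f z \<noteq> 0 \<and> f z \<noteq> 1;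
     1 \<le> A; norm (f a) \<le> exp A; z\<in>cball a (r/2)\<rbrakk> \<Longrightarrow> norm (f z) \<le> exp (2^N * A)"
    using Schottky_log_bound by blast
  show ?thesis
  proof (intro exI[of _ N] allI impI)
    fix f :: "complex \<Rightarrow> complex" and A z
    assume hol: "f holomorphic_on (ball 0 1 \<inter> {z. 0 < Im z})"
      and om: "\<forall>z\<in>ball 0 1 \<inter> {z. 0 < Im z}. f z \<noteq> 0 \<and> f z \<noteq> 1" and A: "1 \<le> A"
      and base: "\<forall>z. \<bar>Re z\<bar> \<le> 1/2 \<longrightarrow> Im z = 1/4 \<longrightarrow> norm (f z) \<le> exp A"
      and z: "\<bar>Re z\<bar> \<le> 1/2" "0 < Im z" "Im z \<le> 1/4"
    have ind: "norm (f z) \<le> exp ((2^N)^j * A)"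
      if "\<bar>Re z\<bar> \<le> 1/2" "(1/2)^j/4 \<le> Im z" "Im z \<le> 1/4" for j z
      using that
    proof (induction j arbitrary: z)
      case 0
      then show ?case using base by auto
    next
      case (Suc j)
      show ?case
      proof (cases "(1/2)^j/4 \<le> Im z")
        case True
        then have "norm (f z) \<le> exp ((2^N)^j * A)" using Suc by auto
        also have "\<dots> \<le> exp ((2^N)^Suc j * A)" using A by (simp add: mult_le_cancel_right)
        finally show ?thesis .
      next
        case False
        define t :: real where "t = (1/2)^j/4"
        have t: "0 < t" "t \<le> 1/4" by (auto simp: t_def power_le_one)
        define a where "a = Complex (Re z) t"
        have sub: "ball a t \<subseteq> ball 0 1 \<inter> {z. 0 < Im z}"
        proof
          fix w assume "w \<in> ball a t"
          then have w: "norm (w - a) < t" by (simp add: dist_norm norm_minus_commute)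
          have "\<bar>Im (w - a)\<bar> < t" using abs_Im_le_cmod[of "w - a"] w by linarith
          then have "0 < Im w" by (simp add: a_def)
          moreover have "norm w \<le> norm (w - a) + norm a" by (metis add.commute norm_triangle_sub)
          moreover have "norm a \<le> \<bar>Re a\<bar> + \<bar>Im a\<bar>" by (rule cmod_le)
          ultimately show "w \<in> ball 0 1 \<inter> {z. 0 < Im z}"
            using w t Suc.prems(1) by (simp add: a_def)
        qed
        have fa: "norm (f a) \<le> exp ((2^N)^j * A)"
          by (rule Suc.IH) (use Suc.prems(1) t in \<open>auto simp: a_def t_def\<close>)
        have "1 \<le> (2^N)^j * A" using A mult_mono[of 1 "(2^N)^j" 1 A] by simp
        moreover have "z \<in> cball a (t/2)"
        proof -
          have "a - z = Complex 0 (t - Im z)" by (simp add: a_def complex_eq_iff)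
          then have "norm (a - z) = \<bar>t - Im z\<bar>" by (simp add: cmod_def)
          then show ?thesis using False Suc.prems by (simp add: dist_norm t_def)
        qed
        ultimately have "norm (f z) \<le> exp (2^N * ((2^N)^j * A))"
          using N[OF t(1) holomorphic_on_subset[OF hol sub]] om sub fa by blast
        then show ?thesis by (simp add: mult.assoc)
      qed
    qed
    \<comment> \<open>the least \<open>j\<close> with \<open>2\<^sup>-\<^sup>j / 4\<close> not above the height of \<open>z\<close>\<close>
    define j where "j = (LEAST j. 1/(4*Im z) \<le> 2^j)"
    have "\<exists>j. 1/(4*Im z) \<le> 2^j" using real_arch_pow[of 2 "1/(4*Im z)"] by (auto intro: less_imp_le)
    then have j1: "1/(4*Im z) \<le> 2^j" unfolding j_def by (rule LeastI_ex)
    have j2: "2^j \<le> 1/Im z"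
    proof (cases j)
      case 0
      then show ?thesis using z by simp
    next
      case (Suc i)
      then have "\<not> 1/(4*Im z) \<le> 2^i" using not_less_Least[of i "\<lambda>j. 1/(4*Im z) \<le> 2^j"] by (simp add: j_def)
      then show ?thesis using z Suc by (simp add: field_simps)
    qed
    have "norm (f z) \<le> exp ((2^N)^j * A)"
      by (rule ind) (use z j1 in \<open>auto simp: field_simps power_divide\<close>)
    also have "(2^N)^j * A \<le> A / Im z ^ N"
    proof -
      have "(2^N)^j = ((2::real)^j)^N" by (simp add: mult.commute flip: power_mult)
      also have "\<dots> \<le> (1/Im z)^N" using j2 by (intro power_mono) auto
      finally show ?thesis using A by (simp add: field_simps power_divide mult_right_mono)
         (metis A less_eq_real_def mult_left_mono order_trans zero_le_one mult.commute times_divide_eq_right mult.right_neutral)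
    qed
    finally show "norm (f z) \<le> exp (A / Im z ^ N)" by simp
  qed
qed

section \<open>Removing a line\<close>

text \<open>The maximum principle on a rhombus with small angles at its vertices \<open>\<plusminus> 1/2\<close>. The bound for \<open>F\<close>
is useless near these two vertices, which lie on the real line; there it is beaten by the multiplier
\<open>exp (- M ((1/2 - z)\<^sup>-\<^sup>N + (1/2 + z)\<^sup>-\<^sup>N))\<close>, which decays at the vertices because the rhombus is so thin that the
real part of the exponent is comparable to its modulus.\<close>

lemma diamond_bound:
  fixes N :: nat
  assumes N: "N > 0"
  shows "\<exists>K r. 0 < r \<and> r \<le> 1/4 \<and> (\<forall>F C. 1 \<le> C \<longrightarrow> F holomorphic_on ball 0 1 \<longrightarrow>
     (\<forall>z. \<bar>Re z\<bar> \<le> 1/2 \<longrightarrow> 0 < \<bar>Im z\<bar> \<longrightarrow> \<bar>Im z\<bar> \<le> 1/4 \<longrightarrow> norm (F z) \<le> exp (C / \<bar>Im z\<bar> ^ N)) \<longrightarrow>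
     (\<forall>z\<in>ball 0 r. norm (F z) \<le> exp (K * C)))"
proof -
  have "((\<lambda>t. Re (inverse (1 - \<i> * of_real t) ^ N)) \<longlongrightarrow> Re (inverse (1 - \<i> * of_real 0) ^ N)) (at (0::real))"
    by (intro tendsto_intros) auto
  then have "\<forall>\<^sub>F t in at (0::real). 1/2 < Re (inverse (1 - \<i> * of_real t) ^ N)"
    by (intro order_tendstoD(1)) auto
  then obtain d where d: "d > 0" "\<And>t. t \<noteq> 0 \<Longrightarrow> \<bar>t\<bar> < d \<Longrightarrow> 1/2 < Re (inverse (1 - \<i> * of_real t) ^ N)"
    by (auto simp: eventually_at)
  \<comment> \<open>The slope \<open>\<kappa>\<close> of the rhombus is so small that powers of order \<open>N\<close> still stay in a sector around the positive axis.\<close>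
  define \<kappa> where "\<kappa> = min (d/2) (1/2)"
  have \<kappa>: "0 < \<kappa>" "\<kappa> \<le> 1/2" using d by (auto simp: \<kappa>_def)
  have re: "1/2 \<le> Re (inverse (1 - \<i> * of_real t) ^ N)" if "\<bar>t\<bar> \<le> \<kappa>" for t
    using d that by (cases "t = 0") (auto simp: \<kappa>_def less_imp_le)
  have re2: "1/2 * (1/p)^N \<le> Re (inverse w ^ N)" if "Re w = p" "0 < p" "\<bar>Im w\<bar> \<le> \<kappa> * p" for w p
  proof -
    define t where "t = - Im w / p"
    have w: "w = of_real p * (1 - \<i> * of_real t)" using that by (simp add: complex_eq_iff t_def)
    have t: "\<bar>t\<bar> \<le> \<kappa>" using that by (simp add: t_def field_simps)
    have "inverse w ^ N = of_real ((1/p)^N) * inverse (1 - \<i> * of_real t) ^ N"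
      unfolding w inverse_mult_distrib power_mult_distrib by (simp add: inverse_eq_divide)
    then have "Re (inverse w ^ N) = (1/p)^N * Re (inverse (1 - \<i> * of_real t) ^ N)"
      by (simp only: Re_complex_of_real Im_complex_of_real times_complex.sel)
    moreover have "(1/p)^N * Re (inverse (1 - \<i> * of_real t) ^ N) \<ge> (1/p)^N * (1/2)"
      using that by (intro mult_left_mono re t) auto
    ultimately show ?thesis by simp
  qed
  define K where "K = 4 * 4^N / \<kappa>^N"
  define r where "r = \<kappa>/4"
  show ?thesis
  proof (rule exI[of _ K], rule exI[of _ r], intro conjI allI impI ballI)
    show "0 < r" "r \<le> 1/4" using \<kappa> by (auto simp: r_def)
    fix F :: "complex \<Rightarrow> complex" and C :: real and z :: complex
    assume C: "1 \<le> C" and hol: "F holomorphic_on ball 0 1"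
      and bd: "\<forall>z. \<bar>Re z\<bar> \<le> 1/2 \<longrightarrow> 0 < \<bar>Im z\<bar> \<longrightarrow> \<bar>Im z\<bar> \<le> 1/4 \<longrightarrow> norm (F z) \<le> exp (C / \<bar>Im z\<bar> ^ N)"
      and z: "z \<in> ball 0 r"
    define M where "M = 2 * C / \<kappa>^N"
    have M: "M > 0" using C \<kappa> by (simp add: M_def)
    have "cball 0 (3/4) \<subseteq> ball (0::complex) 1" by auto
    then have "continuous_on (cball 0 (3/4)) F" 
      using holomorphic_on_imp_continuous_on[OF hol] continuous_on_subset by blast
    then have "bounded (F ` cball 0 (3/4))"
      by (intro compact_imp_bounded compact_continuous_image) auto
    then obtain B where B: "B > 0" "\<And>w. w \<in> cball 0 (3/4) \<Longrightarrow> norm (F w) \<le> B"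
      by (auto simp: bounded_pos)
    have "((\<lambda>e. B * exp (- M * (1/2 * (1/e)^N))) \<longlongrightarrow> 0) (at_right (0::real))"
    proof -
      have "filterlim (\<lambda>e::real. 1/e) at_top (at_right 0)"
        by (simp add: filterlim_inverse_at_top_right flip: inverse_eq_divide)
      then have "filterlim (\<lambda>e::real. (1/e)^N) at_top (at_right 0)"
        using N by (intro filterlim_pow_at_top) auto
      then have "filterlim (\<lambda>e::real. M * (1/2) * (1/e)^N) at_top (at_right 0)"
        using M by (intro filterlim_tendsto_pos_mult_at_top[OF tendsto_const]) auto
      then have "((\<lambda>e. exp (- (M * (1/2) * (1/e)^N))) \<longlongrightarrow> 0) (at_right (0::real))"
        by (intro filterlim_compose[OF exp_at_bot] filterlim_compose[OF filterlim_uminus_at_bot_at_top])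
      then have "((\<lambda>e. B * exp (- (M * (1/2) * (1/e)^N))) \<longlongrightarrow> B * 0) (at_right (0::real))"
        by (intro tendsto_intros)
      then show ?thesis by (simp add: mult.assoc)
    qed
    then have "\<forall>\<^sub>F e in at_right (0::real). B * exp (- M * (1/2 * (1/e)^N)) < 1"
      by (intro order_tendstoD(2)) auto
    moreover have "\<forall>\<^sub>F e in at_right (0::real). e \<in> {0<..<1/4}"
      by (intro eventually_at_right_real) auto
    ultimately have "\<forall>\<^sub>F e in at_right (0::real). B * exp (- M * (1/2 * (1/e)^N)) < 1 \<and> e \<in> {0<..<1/4}"
      by eventually_elim auto
    then obtain e where e: "0 < e" "e < 1/4" "B * exp (- M * (1/2 * (1/e)^N)) < 1"
      using eventually_happens'[OF trivial_limit_at_right_real] by (metis (no_types, lifting) greaterThanLessThan_iff)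
    \<comment> \<open>The multiplier is singular at the vertices, so they are cut off at distance \<open>e\<close>; there the a priori bound \<open>B\<close> of
      the single function \<open>F\<close> suffices. The final bound does not depend on \<open>e\<close>.\<close>
    define S where "S = {z. \<bar>Im z\<bar> \<le> \<kappa> * (1/2 - \<bar>Re z\<bar>) \<and> \<bar>Re z\<bar> \<le> 1/2 - e}"
    define E where "E = (\<lambda>z. inverse (1/2 - z)^N + inverse (1/2 + z)^N :: complex)"
    define G where "G = (\<lambda>z. F z * exp (- of_real M * E z))"
    have Ssub: "norm w \<le> 3/4" "\<bar>Re w\<bar> \<le> 1/2" "\<bar>Im w\<bar> \<le> 1/4" if "w \<in> S" for w
    proof -
      have a: "\<bar>Im w\<bar> \<le> \<kappa> * (1/2 - \<bar>Re w\<bar>)" "\<bar>Re w\<bar> \<le> 1/2 - e" using that by (auto simp: S_def)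
      have "\<kappa> * (1/2 - \<bar>Re w\<bar>) \<le> 1/2 * (1/2 - \<bar>Re w\<bar>)"
        using a e \<kappa> by (intro mult_right_mono) auto
      from order_trans[OF a(1) this] have "\<bar>Im w\<bar> \<le> 1/4 - \<bar>Re w\<bar>/2" by (simp add: algebra_simps)
      then have "\<bar>Im w\<bar> \<le> 1/4" "\<bar>Re w\<bar> \<le> 1/2" using a(2) e abs_ge_zero[of "Re w"] by auto
      then show "norm w \<le> 3/4" "\<bar>Re w\<bar> \<le> 1/2" "\<bar>Im w\<bar> \<le> 1/4" using cmod_le[of w] by auto
    qed
    have clS: "closed S"
    proof -
      have "S = {z. \<bar>Im z\<bar> \<le> \<kappa> * (1/2 - \<bar>Re z\<bar>)} \<inter> {z. \<bar>Re z\<bar> \<le> 1/2 - e}" by (auto simp: S_def)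
      then show ?thesis
        by (simp only:) (intro closed_Int closed_Collect_le continuous_intros)
    qed
    have bS: "bounded S" unfolding bounded_iff using Ssub(1) by blast
    have Gnz: "1/2 - w \<noteq> 0" "1/2 + w \<noteq> 0" if "w \<in> S" for w
    proof -
      have "\<bar>Re w\<bar> < 1/2" using that e by (auto simp: S_def)
      then have "Re (1/2 - w) \<noteq> 0" "Re (1/2 + w) \<noteq> 0" by auto
      then show "1/2 - w \<noteq> 0" "1/2 + w \<noteq> 0" by force+
    qed
    have Ghol: "G holomorphic_on S"
      unfolding G_def E_def using Gnz Ssub(1)
      by (intro holomorphic_intros holomorphic_on_subset[OF hol]) force+
    have Ere: "1/2 * (1/(1/2 - \<bar>Re w\<bar>))^N \<le> Re (E w)" if "w \<in> S" for w
    proof -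
      have a: "\<bar>Re w\<bar> < 1/2" using that e by (auto simp: S_def)
      have "1/2 * (1/(1/2 - Re w))^N \<le> Re (inverse (1/2 - w)^N)"
      proof (rule re2)
        have "\<kappa> * (1/2 - \<bar>Re w\<bar>) \<le> \<kappa> * (1/2 - Re w)" using \<kappa> by (intro mult_left_mono) auto
        then show "\<bar>Im (1/2 - w)\<bar> \<le> \<kappa> * (1/2 - Re w)" using that by (auto simp: S_def)
      qed (use a in auto)
      moreover have "1/2 * (1/(1/2 + Re w))^N \<le> Re (inverse (1/2 + w)^N)"
      proof (rule re2)
        have "\<kappa> * (1/2 - \<bar>Re w\<bar>) \<le> \<kappa> * (1/2 + Re w)" using \<kappa> by (intro mult_left_mono) auto
        then show "\<bar>Im (1/2 + w)\<bar> \<le> \<kappa> * (1/2 + Re w)" using that by (auto simp: S_def)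
      qed (use a in auto)
      moreover have "0 \<le> 1/2 * (1/(1/2 - Re w))^N" "0 \<le> 1/2 * (1/(1/2 + Re w))^N" using a by auto
      ultimately have "1/2 * (1/(1/2 - Re w))^N \<le> Re (E w)" "1/2 * (1/(1/2 + Re w))^N \<le> Re (E w)"
        unfolding E_def plus_complex.sel by linarith+
      then show ?thesis by (cases "Re w \<ge> 0") simp_all
    qed
    have nG: "norm (G w) = norm (F w) * exp (- M * Re (E w))" for w
      by (simp add: G_def norm_mult)
    have "norm (G w) \<le> 1" if "w \<in> frontier S" for w
    proof -
      have wS: "w \<in> S" using that clS by (simp add: frontier_def)
      define t where "t = 1/2 - \<bar>Re w\<bar>"
      have t: "t > 0" using wS e by (auto simp: S_def t_def)
      have "\<bar>Im w\<bar> = \<kappa> * (1/2 - \<bar>Re w\<bar>) \<or> \<bar>Re w\<bar> = 1/2 - e"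
      proof (rule ccontr)
        assume "\<not> ?thesis"
        then have "w \<in> {z. \<bar>Im z\<bar> < \<kappa> * (1/2 - \<bar>Re z\<bar>)} \<inter> {z. \<bar>Re z\<bar> < 1/2 - e}"
          using wS by (auto simp: S_def)
        moreover have "open ({z. \<bar>Im z\<bar> < \<kappa> * (1/2 - \<bar>Re z\<bar>)} \<inter> {z. \<bar>Re z\<bar> < 1/2 - e})"
          by (intro open_Int open_Collect_less continuous_intros)
        moreover have "{z. \<bar>Im z\<bar> < \<kappa> * (1/2 - \<bar>Re z\<bar>)} \<inter> {z. \<bar>Re z\<bar> < 1/2 - e} \<subseteq> S"
          by (auto simp: S_def)
        ultimately have "w \<in> interior S" by (meson interiorI)
        then show False using that by (simp add: frontier_def)
      qed
      then show ?thesis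
      proof
        assume eq: "\<bar>Im w\<bar> = \<kappa> * (1/2 - \<bar>Re w\<bar>)"
        have "norm (F w) \<le> exp (C / \<bar>Im w\<bar>^N)"
        proof -
          have "0 < \<bar>Im w\<bar>" unfolding eq t_def[symmetric] using t \<kappa> by simp
          then show ?thesis using bd Ssub[OF wS] by blast
        qed
        also have "C / \<bar>Im w\<bar>^N = M * (1/2 * (1/t)^N)"
          using t \<kappa> unfolding eq M_def t_def[symmetric] by (simp add: field_simps power_mult_distrib power_divide)
        also have "\<dots> \<le> M * Re (E w)" using M Ere[OF wS] by (intro mult_left_mono) (auto simp: t_def)
        finally have "norm (F w) \<le> exp (M * Re (E w))" by simp
        then have "norm (F w) * exp (- M * Re (E w)) \<le> exp (M * Re (E w)) * exp (- M * Re (E w))"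
          by (intro mult_right_mono) auto
        then show ?thesis by (simp add: nG flip: exp_add)
      next
        assume eq: "\<bar>Re w\<bar> = 1/2 - e"
        then have te: "t = e" by (simp add: t_def)
        have "norm (F w) \<le> B" using B Ssub[OF wS] by auto
        moreover have "exp (- M * Re (E w)) \<le> exp (- M * (1/2 * (1/e)^N))"
          using M Ere[OF wS] te by (simp add: t_def)
        ultimately have "norm (G w) \<le> B * exp (- M * (1/2 * (1/e)^N))"
          unfolding nG using B(1) by (intro mult_mono) auto
        then show ?thesis using e by linarith
      qed
    qed
    moreover have zS: "z \<in> S"
    proof -
      have "\<bar>Re z\<bar> \<le> norm z" "\<bar>Im z\<bar> \<le> norm z" by (auto simp: abs_Re_le_cmod abs_Im_le_cmod)
      then have a: "\<bar>Re z\<bar> < r" "\<bar>Im z\<bar> < r" using z by auto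
      then have "\<bar>Re z\<bar> \<le> 1/4" using \<kappa> by (auto simp: r_def)
      then have "\<kappa> * (1/4) \<le> \<kappa> * (1/2 - \<bar>Re z\<bar>)" using \<kappa> by (intro mult_left_mono) auto
      moreover have "\<bar>Im z\<bar> \<le> \<kappa> * (1/4)" using a by (simp add: r_def)
      ultimately have "\<bar>Im z\<bar> \<le> \<kappa> * (1/2 - \<bar>Re z\<bar>)" by (rule order_trans[rotated])
      moreover have "\<bar>Re z\<bar> \<le> 1/2 - e" using \<open>\<bar>Re z\<bar> \<le> 1/4\<close> e by linarith
      ultimately show ?thesis by (simp add: S_def)
    qed
    ultimately have "norm (G z) \<le> 1"
      using maximum_modulus_frontier[of G S 1 z] Ghol clS bS interior_subset[of S]
        holomorphic_on_imp_continuous_on holomorphic_on_subset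
      by (metis closure_closed)
    then have "norm (F z) \<le> exp (M * Re (E z))"
      by (simp add: nG exp_minus field_simps)
    also have "M * Re (E z) \<le> M * (4^N + 4^N)"
    proof (intro mult_left_mono)
      have nz: "norm z \<le> 1/4" using z \<kappa> by (auto simp: r_def)
      have "1/4 \<le> norm (1/2 - z)" "1/4 \<le> norm (1/2 + z)"
        using nz norm_triangle_ineq2[of "1/2" z] norm_triangle_ineq2[of "1/2" "-z"] by auto
      then have "inverse (norm (1/2 - z)) \<le> 4" "inverse (norm (1/2 + z)) \<le> 4"
        using le_imp_inverse_le[of "1/4" "norm (1/2 - z)"] le_imp_inverse_le[of "1/4" "norm (1/2 + z)"] by auto
      then have "norm (inverse (1/2 - z)^N) \<le> 4^N" "norm (inverse (1/2 + z)^N) \<le> 4^N"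
        by (auto simp: norm_power norm_inverse intro!: power_mono)
      then show "Re (E z) \<le> 4^N + 4^N"
        unfolding E_def using complex_Re_le_cmod[of "inverse (1/2 - z)^N"] complex_Re_le_cmod[of "inverse (1/2 + z)^N"]
        by simp
    qed (use M in auto)
    also have "\<dots> = K * C" by (simp add: M_def K_def)
    finally show "norm (F z) \<le> exp (K * C)" by simp
  qed
qed

text \<open>The two preceding estimates combined: a function omitting \<open>0\<close> and \<open>1\<close> off the real line is
bounded near the origin in terms of its size on one segment on each side.\<close>

lemma line_removal_bound:
  "\<exists>r>0. r \<le> 1/4 \<and> (\<forall>A\<ge>1. \<exists>B. \<forall>F. F holomorphic_on ball 0 1 \<longrightarrow>
     (\<forall>z\<in>ball 0 1. Im z \<noteq> 0 \<longrightarrow> F z \<noteq> 0 \<and> F z \<noteq> 1) \<longrightarrow>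
     (\<forall>z. \<bar>Re z\<bar> \<le> 1/2 \<longrightarrow> \<bar>Im z\<bar> = 1/4 \<longrightarrow> norm (F z) \<le> exp A) \<longrightarrow>
     (\<forall>z\<in>ball 0 r. norm (F z) \<le> B))"
proof -
  obtain N :: nat where N: "\<And>f A z. \<lbrakk>f holomorphic_on (ball 0 1 \<inter> {z. 0 < Im z});
     \<And>z. z\<in>ball 0 1 \<inter> {z. 0 < Im z} \<Longrightarrow> f z \<noteq> 0 \<and> f z \<noteq> 1; 1 \<le> A;
     \<And>z. \<bar>Re z\<bar> \<le> 1/2 \<Longrightarrow> Im z = 1/4 \<Longrightarrow> norm (f z) \<le> exp A;
     \<bar>Re z\<bar> \<le> 1/2; 0 < Im z; Im z \<le> 1/4\<rbrakk> \<Longrightarrow> norm (f z) \<le> exp (A / Im z ^ N)"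
    using half_disc_growth by blast
  obtain K r where r: "0 < r" "r \<le> 1/4" and K: "\<And>F C z. \<lbrakk>1 \<le> C; F holomorphic_on ball 0 1;
     \<And>z. \<bar>Re z\<bar> \<le> 1/2 \<Longrightarrow> 0 < \<bar>Im z\<bar> \<Longrightarrow> \<bar>Im z\<bar> \<le> 1/4 \<Longrightarrow> norm (F z) \<le> exp (C / \<bar>Im z\<bar> ^ Suc N);
     z\<in>ball 0 r\<rbrakk> \<Longrightarrow> norm (F z) \<le> exp (K * C)"
    using diamond_bound[of "Suc N"] by (metis zero_less_Suc)
  show ?thesis
  proof (rule exI[of _ r], intro conjI r allI impI)
    fix A :: real assume A: "1 \<le> A"
    show "\<exists>B. \<forall>F. F holomorphic_on ball 0 1 \<longrightarrow>
     (\<forall>z\<in>ball 0 1. Im z \<noteq> 0 \<longrightarrow> F z \<noteq> 0 \<and> F z \<noteq> 1) \<longrightarrow>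
     (\<forall>z. \<bar>Re z\<bar> \<le> 1/2 \<longrightarrow> \<bar>Im z\<bar> = 1/4 \<longrightarrow> norm (F z) \<le> exp A) \<longrightarrow>
     (\<forall>z\<in>ball 0 r. norm (F z) \<le> B)"
    proof (intro exI[of _ "exp (K * A)"] allI impI ballI)
      fix F :: "complex \<Rightarrow> complex" and z :: complex
      assume hol: "F holomorphic_on ball 0 1"
        and om: "\<forall>z\<in>ball 0 1. Im z \<noteq> 0 \<longrightarrow> F z \<noteq> 0 \<and> F z \<noteq> 1"
        and bd: "\<forall>z. \<bar>Re z\<bar> \<le> 1/2 \<longrightarrow> \<bar>Im z\<bar> = 1/4 \<longrightarrow> norm (F z) \<le> exp A"
        and z: "z \<in> ball 0 r"
      show "norm (F z) \<le> exp (K * A)"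
      proof (rule K[OF A hol _ z])
        fix w assume w: "\<bar>Re w\<bar> \<le> 1/2" "0 < \<bar>Im w\<bar>" "\<bar>Im w\<bar> \<le> 1/4"
        have "norm (F w) \<le> exp (A / \<bar>Im w\<bar> ^ N)"
        proof (cases "Im w > 0")
          case True
          then show ?thesis
            using N[of F A w] holomorphic_on_subset[OF hol] om bd w A by auto
        next
          case False
          have "(\<lambda>z. F (- z)) holomorphic_on (ball 0 1 \<inter> {z. 0 < Im z})"
            by (rule holomorphic_on_compose_gen[OF _ hol, unfolded o_def]) (auto intro!: holomorphic_intros)
          then show ?thesis
            using N[of "\<lambda>z. F (-z)" A "-w"] om bd w A False by auto
        qed
        also have "\<dots> \<le> exp (A / \<bar>Im w\<bar> ^ Suc N)"
        proof -
          have "\<bar>Im w\<bar> ^ Suc N \<le> \<bar>Im w\<bar> ^ N" using w by (intro power_decreasing) auto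
          then show ?thesis using A w by (auto intro!: divide_left_mono)
        qed
        finally show "norm (F w) \<le> exp (A / \<bar>Im w\<bar> ^ Suc N)" .
      qed
    qed
  qed
qed

section \<open>Locally uniform convergence\<close>

definition loc_unif_limit :: "complex set \<Rightarrow> (nat \<Rightarrow> complex \<Rightarrow> complex) \<Rightarrow> (complex \<Rightarrow> complex) \<Rightarrow> bool" where
  "loc_unif_limit S f g \<longleftrightarrow> (\<forall>K. compact K \<longrightarrow> K \<subseteq> S \<longrightarrow> uniform_limit K f g sequentially)"

lemma loc_unif_limitD: "loc_unif_limit S f g \<Longrightarrow> compact K \<Longrightarrow> K \<subseteq> S \<Longrightarrow> uniform_limit K f g sequentially"
  by (auto simp: loc_unif_limit_def)

lemma loc_unif_limit_tendsto: "loc_unif_limit S f g \<Longrightarrow> z \<in> S \<Longrightarrow> (\<lambda>k. f k z) \<longlonglongrightarrow> g z"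
  using loc_unif_limitD[of S f g "{z}"] by (auto intro: tendsto_uniform_limitI)

lemma loc_unif_limit_eventually_bounded:
  assumes "loc_unif_limit S f g" "compact K" "K \<subseteq> S" "\<And>k. continuous_on S (f k)"
  shows "\<exists>B>0. \<forall>\<^sub>F k in sequentially. \<forall>z\<in>K. norm (f k z) \<le> B"
proof -
  have "\<forall>\<^sub>F k in sequentially. \<forall>z\<in>K. dist (f k z) (g z) < 1"
    using loc_unif_limitD[OF assms(1-3)] by (rule uniform_limitD) auto
  then obtain k0 where k0: "\<And>k z. k \<ge> k0 \<Longrightarrow> z \<in> K \<Longrightarrow> dist (f k z) (g z) < 1"
    by (auto simp: eventually_sequentially)
  have "bounded (f k0 ` K)"
    using assms by (meson compact_continuous_image compact_imp_bounded continuous_on_subset)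
  then obtain B where B: "B > 0" "\<And>z. z \<in> K \<Longrightarrow> norm (f k0 z) \<le> B" by (auto simp: bounded_pos)
  show ?thesis
  proof (intro exI[of _ "B+2"] conjI)
    show "\<forall>\<^sub>F k in sequentially. \<forall>z\<in>K. norm (f k z) \<le> B + 2"
      using eventually_ge_at_top[of k0]
    proof eventually_elim
      case (elim k)
      show ?case
      proof
        fix z assume z: "z \<in> K"
        have "dist (f k z) (f k0 z) \<le> dist (f k z) (g z) + dist (f k0 z) (g z)"
          by (rule dist_triangle2)
        then have "dist (f k z) (f k0 z) \<le> 2" using k0[OF elim z] k0[OF order_refl z] by linarith
        moreover have "norm (f k z) \<le> norm (f k z - f k0 z) + norm (f k0 z)"
          by (metis add.commute norm_triangle_sub)
        ultimately show "norm (f k z) \<le> B + 2" using B(2)[OF z] by (simp add: dist_norm)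
      qed
    qed
  qed (use B in auto)
qed

lemma uniform_limit_holomorphic:
  assumes "uniform_limit (ball a r) f l sequentially" "\<And>k. f k holomorphic_on ball a r"
  shows "l holomorphic_on ball a r"
proof (rule holomorphic_uniform_sequence[where f=f])
  fix x assume "x \<in> ball a r"
  then obtain d where "d > 0" "cball x d \<subseteq> ball a r" using open_contains_cball open_ball by blast
  then show "\<exists>d>0. cball x d \<subseteq> ball a r \<and> uniform_limit (cball x d) f l sequentially"
    using assms(1) uniform_limit_on_subset by blast
qed (use assms in auto)

lemma loc_unif_limit_subset: "loc_unif_limit S f g \<Longrightarrow> T \<subseteq> S \<Longrightarrow> loc_unif_limit T f g"
  unfolding loc_unif_limit_def by blast

lemma loc_unif_limit_cong:
  assumes "loc_unif_limit S f g" "\<And>k z. z \<in> S \<Longrightarrow> f k z = f' k z" "\<And>z. z \<in> S \<Longrightarrow> g z = g' z"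
  shows "loc_unif_limit S f' g'"
  unfolding loc_unif_limit_def
proof (intro allI impI)
  fix K assume K: "compact K" "K \<subseteq> S"
  have "uniform_limit K f g sequentially" using assms(1) K by (rule loc_unif_limitD)
  then show "uniform_limit K f' g' sequentially"
    using uniform_limit_cong'[of K f f' g g' sequentially] assms(2,3) K(2) by (simp add: subset_iff)
qed

lemma loc_unif_limit_compose:
  assumes "loc_unif_limit S f g" "continuous_on T \<alpha>" "\<And>z. z \<in> T \<Longrightarrow> \<alpha> z \<in> S"
  shows "loc_unif_limit T (\<lambda>k z. f k (\<alpha> z)) (\<lambda>z. g (\<alpha> z))"
  unfolding loc_unif_limit_def
proof (intro allI impI)
  fix K assume K: "compact K" "K \<subseteq> T"
  have "compact (\<alpha> ` K)" using K assms(2) compact_continuous_image continuous_on_subset by blast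
  then have "uniform_limit (\<alpha> ` K) f g sequentially" using K assms by (intro loc_unif_limitD[OF assms(1)]) auto
  then show "uniform_limit K (\<lambda>k z. f k (\<alpha> z)) (\<lambda>z. g (\<alpha> z)) sequentially"
    by (auto simp: uniform_limit_iff)
qed

lemma loc_unif_limit_holomorphic:
  assumes "open S" "\<And>k. f k holomorphic_on S" "loc_unif_limit S f g"
  shows "g holomorphic_on S"
proof (rule holomorphic_uniform_sequence[where f=f])
  fix x assume "x \<in> S"
  then obtain d where "d > 0" "cball x d \<subseteq> S" using assms(1) open_contains_cball by blast
  then show "\<exists>d>0. cball x d \<subseteq> S \<and> uniform_limit (cball x d) f g sequentially"
    using loc_unif_limitD[OF assms(3) compact_cball] by blast
qed (use assms in auto)

lemma loc_unif_limit_inverse: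
  assumes "loc_unif_limit S f g" "continuous_on S g" "\<And>z. z \<in> S \<Longrightarrow> g z \<noteq> 0"
  shows "loc_unif_limit S (\<lambda>k z. inverse (f k z)) (\<lambda>z. inverse (g z))"
  unfolding loc_unif_limit_def
proof (intro allI impI)
  fix K assume K: "compact K" "K \<subseteq> S"
  show "uniform_limit K (\<lambda>k z. inverse (f k z)) (\<lambda>z. inverse (g z)) sequentially"
  proof (cases "K = {}")
    case False
    have "continuous_on K (\<lambda>z. norm (g z))"
      using assms(2) K by (intro continuous_intros) (auto intro: continuous_on_subset)
    then obtain z0 where z0: "z0 \<in> K" "\<And>z. z \<in> K \<Longrightarrow> norm (g z0) \<le> norm (g z)"
      using continuous_attains_inf[OF K(1) False] by blast
    show ?thesis
    proof (rule uniform_lim_inverse[where b = "norm (g z0)", unfolded o_def])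
      show "uniform_limit K f g sequentially" using assms(1) K by (rule loc_unif_limitD)
    qed (use z0 assms K in auto)
  qed (simp add: uniform_limit_iff)
qed

lemma loc_unif_limit_subseq:
  assumes "loc_unif_limit S f g" "strict_mono r"
  shows "loc_unif_limit S (\<lambda>k. f (r k)) g"
  unfolding loc_unif_limit_def
proof (intro allI impI)
  fix K assume K: "compact K" "K \<subseteq> S"
  have "uniform_limit K f g sequentially" using assms(1) K by (rule loc_unif_limitD)
  then show "uniform_limit K (\<lambda>k. f (r k)) g sequentially"
    unfolding uniform_limit_iff
    using eventually_subseq[OF assms(2), of "\<lambda>n. \<forall>x\<in>K. dist (f n x) (g x) < e" for e] by simp
qed

lemma loc_unif_limit_of_local:
  assumes "\<And>z. z \<in> S \<Longrightarrow> \<exists>d>0. uniform_limit (ball z d) f g sequentially"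
  shows "loc_unif_limit S f g"
  unfolding loc_unif_limit_def
proof (intro allI impI)
  fix K assume K: "compact K" "K \<subseteq> S"
  obtain d where d: "\<And>z. z \<in> S \<Longrightarrow> d z > 0 \<and> uniform_limit (ball z (d z)) f g sequentially"
    using assms by metis
  have "\<And>z. z \<in> K \<Longrightarrow> open (ball z (d z))" by auto
  moreover have "K \<subseteq> (\<Union>z\<in>K. ball z (d z))"
  proof
    fix z assume "z \<in> K"
    then show "z \<in> (\<Union>z\<in>K. ball z (d z))" using d K by (intro UN_I[of z]) auto
  qed
  ultimately obtain C where C: "C \<subseteq> K" "finite C" "K \<subseteq> (\<Union>z\<in>C. ball z (d z))"
    by (rule compactE_image[OF K(1), of K "\<lambda>z. ball z (d z)"])
  have "uniform_limit (\<Union>z\<in>C. ball z (d z)) f g sequentially"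
    unfolding uniform_limit_iff
  proof (intro allI impI)
    fix e :: real assume "e > 0"
    have "\<forall>\<^sub>F k in sequentially. \<forall>w\<in>ball z (d z). dist (f k w) (g w) < e" if "z \<in> C" for z
    proof -
      have "z \<in> S" using that C K by auto
      then have "uniform_limit (ball z (d z)) f g sequentially" using d by simp
      then show ?thesis using \<open>e > 0\<close> by (rule uniform_limitD)
    qed
    then have "\<forall>z\<in>C. \<forall>\<^sub>F k in sequentially. \<forall>w\<in>ball z (d z). dist (f k w) (g w) < e" by simp
    then have "\<forall>\<^sub>F k in sequentially. \<forall>z\<in>C. \<forall>w\<in>ball z (d z). dist (f k w) (g w) < e"
      using C(2) by (simp add: eventually_ball_finite)
    then show "\<forall>\<^sub>F k in sequentially. \<forall>w\<in>\<Union>z\<in>C. ball z (d z). dist (f k w) (g w) < e"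
      by (rule eventually_mono) simp
  qed
  then show "uniform_limit K f g sequentially" using C(3) by (rule uniform_limit_on_subset)
qed

lemma loc_unif_limit_local:
  assumes "loc_unif_limit S f g" "open S" "z \<in> S"
  shows "\<exists>d>0. uniform_limit (ball z d) f g sequentially"
proof -
  obtain d where d: "d > 0" "cball z d \<subseteq> S" using assms open_contains_cball by blast
  have "uniform_limit (cball z d) f g sequentially" by (rule loc_unif_limitD[OF assms(1) compact_cball d(2)])
  then show ?thesis using d(1) uniform_limit_on_subset[OF _ ball_subset_cball] by blast
qed

lemma loc_unif_limit_of_local_limits:
  assumes "\<And>z. z \<in> S \<Longrightarrow> \<exists>d l. 0 < d \<and> uniform_limit (ball z d) f l sequentially"
  shows "loc_unif_limit S f (\<lambda>z. lim (\<lambda>k. f k z))"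
proof (rule loc_unif_limit_of_local)
  fix z assume "z \<in> S"
  then obtain d l where d: "d > 0" and l: "uniform_limit (ball z d) f l sequentially" using assms by blast
  have "l w = lim (\<lambda>k. f k w)" if "w \<in> ball z d" for w
    using limI[OF tendsto_uniform_limitI[OF l that]] by simp
  then have "uniform_limit (ball z d) f (\<lambda>z. lim (\<lambda>k. f k z)) sequentially"
    using l uniform_limit_cong'[of "ball z d" f f l "\<lambda>z. lim (\<lambda>k. f k z)" sequentially] by simp
  then show "\<exists>d>0. uniform_limit (ball z d) f (\<lambda>z. lim (\<lambda>k. f k z)) sequentially" using d by blast
qed

lemma loc_unif_limit_unique:
  assumes "loc_unif_limit S f g" "loc_unif_limit S f h" "z \<in> S" shows "g z = h z"
  using loc_unif_limit_tendsto[OF assms(1,3)] loc_unif_limit_tendsto[OF assms(2,3)] by (rule LIMSEQ_unique)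

lemma loc_unif_limit_one_minus:
  assumes "loc_unif_limit S f g" shows "loc_unif_limit S (\<lambda>k z. 1 - f k z) (\<lambda>z. 1 - g z)"
  using assms unfolding loc_unif_limit_def uniform_limit_iff dist_norm
  by (simp add: norm_minus_commute)

lemma loc_unif_limit_deriv_tendsto:
  assumes S: "open S" and hol: "\<And>k. f k holomorphic_on S" and l: "loc_unif_limit S f g" and z: "z \<in> S"
  shows "(\<lambda>k. deriv (f k) z) \<longlonglongrightarrow> deriv g z"
proof -
  obtain d where d: "d > 0" "cball z d \<subseteq> S" using S z open_contains_cball by blast
  have ul: "uniform_limit (cball z d) f g sequentially" by (rule loc_unif_limitD[OF l compact_cball d(2)])
  have ul': "uniform_limit (ball z d) f g sequentially" using ul ball_subset_cball by (rule uniform_limit_on_subset)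
  have sub: "ball z d \<subseteq> S" using d by auto
  show ?thesis
    by (rule deriv_complex_uniform_limit[OF ul' always_eventually])
       (use d holomorphic_on_subset[OF hol sub] in auto)
qed

text \<open>Hurwitz's theorem, including the case of a constant limit.\<close>

lemma loc_unif_limit_nonvanishing_limit:
  assumes "open S" "connected S" "\<And>k. f k holomorphic_on S" "loc_unif_limit S f g"
    and "\<And>k z. z \<in> S \<Longrightarrow> f k z \<noteq> 0"
  shows "(\<forall>z\<in>S. g z \<noteq> 0) \<or> (\<forall>z\<in>S. g z = 0)"
proof (cases "g constant_on S")
  case True
  then show ?thesis by (metis constant_on_def)
next
  case False
  have "g z \<noteq> 0" if "z \<in> S" for z
    by (rule Hurwitz_no_zeros[OF assms(1-3) loc_unif_limit_holomorphic[OF assms(1,3,4)] loc_unif_limitD[OF assms(4)]]) (use that False assms(5) in simp_all)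
  then show ?thesis by blast
qed

text \<open>Convergence to \<open>\<infinity>\<close> is not expressed through \<open>inverse\<close>, since a zero of \<open>f\<close> would count as a small
value of \<open>inverse (f k z)\<close>.\<close>

definition loc_unif_infty :: "complex set \<Rightarrow> (nat \<Rightarrow> complex \<Rightarrow> complex) \<Rightarrow> bool" where
  "loc_unif_infty S f \<longleftrightarrow> (\<forall>K M. compact K \<longrightarrow> K \<subseteq> S \<longrightarrow> (\<forall>\<^sub>F k in sequentially. \<forall>z\<in>K. M \<le> norm (f k z)))"

lemma loc_unif_inftyD: "loc_unif_infty S f \<Longrightarrow> compact K \<Longrightarrow> K \<subseteq> S \<Longrightarrow> \<forall>\<^sub>F k in sequentially. \<forall>z\<in>K. M \<le> norm (f k z)"
  unfolding loc_unif_infty_def by simp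

lemma uniform_limit_inverse_zero_iff:
  assumes "\<And>k z. z \<in> K \<Longrightarrow> f k z \<noteq> 0"
  shows "uniform_limit K (\<lambda>k z. inverse (f k z)) (\<lambda>z. 0::complex) sequentially \<longleftrightarrow>
    (\<forall>M. \<forall>\<^sub>F k in sequentially. \<forall>z\<in>K. M \<le> norm (f k z))"
proof
  assume l: "uniform_limit K (\<lambda>k z. inverse (f k z)) (\<lambda>z. 0) sequentially"
  show "\<forall>M. \<forall>\<^sub>F k in sequentially. \<forall>z\<in>K. M \<le> norm (f k z)"
  proof
    fix M :: real
    define C where "C = max M 1"
    have C: "C > 0" "M \<le> C" by (auto simp: C_def)
    have "\<forall>\<^sub>F k in sequentially. \<forall>z\<in>K. dist (inverse (f k z)) 0 < inverse C"
      using l by (rule uniform_limitD) (use C in simp)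
    then show "\<forall>\<^sub>F k in sequentially. \<forall>z\<in>K. M \<le> norm (f k z)"
    proof eventually_elim
      case (elim k)
      show ?case
      proof
        fix z assume z: "z \<in> K"
        have "inverse (norm (f k z)) < inverse C" using elim z by (simp add: norm_inverse)
        moreover have "0 < norm (f k z)" using assms[OF z] by simp
        ultimately have "C < norm (f k z)" by (rule inverse_less_imp_less)
        then show "M \<le> norm (f k z)" using C by simp
      qed
    qed
  qed
next
  assume l: "\<forall>M. \<forall>\<^sub>F k in sequentially. \<forall>z\<in>K. M \<le> norm (f k z)"
  show "uniform_limit K (\<lambda>k z. inverse (f k z)) (\<lambda>z. 0) sequentially"
  proof (rule uniform_limitI)
    fix e :: real assume e: "0 < e"
    have "\<forall>\<^sub>F k in sequentially. \<forall>z\<in>K. 2 / e \<le> norm (f k z)" using l by blast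
    then show "\<forall>\<^sub>F k in sequentially. \<forall>z\<in>K. dist (inverse (f k z)) 0 < e"
    proof eventually_elim
      case (elim k)
      show ?case
      proof
        fix z assume "z \<in> K"
        then have "2 / e \<le> norm (f k z)" using elim by blast
        then have "inverse (norm (f k z)) \<le> inverse (2 / e)" using e by (intro le_imp_inverse_le) auto
        also have "\<dots> < e" using e by (simp add: field_simps)
        finally show "dist (inverse (f k z)) 0 < e" by (simp add: norm_inverse)
      qed
    qed
  qed
qed

lemma loc_unif_infty_iff_inverse:
  assumes "\<And>k z. z \<in> S \<Longrightarrow> f k z \<noteq> 0"
  shows "loc_unif_infty S f \<longleftrightarrow> loc_unif_limit S (\<lambda>k z. inverse (f k z)) (\<lambda>z. 0)"
proof -
  have "uniform_limit K (\<lambda>k z. inverse (f k z)) (\<lambda>z. 0) sequentially \<longleftrightarrow>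
    (\<forall>M. \<forall>\<^sub>F k in sequentially. \<forall>z\<in>K. M \<le> norm (f k z))" if "K \<subseteq> S" for K
    by (rule uniform_limit_inverse_zero_iff) (use assms that in blast)
  then show ?thesis unfolding loc_unif_infty_def loc_unif_limit_def by blast
qed

lemma loc_unif_infty_subset: "loc_unif_infty S f \<Longrightarrow> T \<subseteq> S \<Longrightarrow> loc_unif_infty T f"
  unfolding loc_unif_infty_def by (meson order_trans)

lemma loc_unif_infty_subseq:
  assumes "loc_unif_infty S f" "strict_mono r" shows "loc_unif_infty S (\<lambda>k. f (r k))"
  unfolding loc_unif_infty_def
proof (intro allI impI)
  fix K M assume "compact K" "K \<subseteq> S"
  from loc_unif_inftyD[OF assms(1) this] have "\<forall>\<^sub>F k in sequentially. \<forall>z\<in>K. M \<le> norm (f k z)" .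
  then show "\<forall>\<^sub>F k in sequentially. \<forall>z\<in>K. M \<le> norm (f (r k) z)" by (rule eventually_subseq[OF assms(2)])
qed

lemma loc_unif_infty_one_minus:
  assumes "loc_unif_infty S f" shows "loc_unif_infty S (\<lambda>k z. 1 - f k z)"
  unfolding loc_unif_infty_def
proof (intro allI impI)
  fix K M assume "compact K" "K \<subseteq> S"
  from loc_unif_inftyD[OF assms this] have "\<forall>\<^sub>F k in sequentially. \<forall>z\<in>K. M + 1 \<le> norm (f k z)" .
  then show "\<forall>\<^sub>F k in sequentially. \<forall>z\<in>K. M \<le> norm (1 - f k z)"
  proof eventually_elim
    case (elim k)
    show ?case
    proof
      fix z assume "z \<in> K"
      then have "M + 1 \<le> norm (f k z)" using elim by blast
      then show "M \<le> norm (1 - f k z)" using norm_triangle_ineq2[of "f k z" 1] by (simp add: norm_minus_commute)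
    qed
  qed
qed

lemma loc_unif_limit_infty_contradiction:
  assumes "loc_unif_limit S f g" "loc_unif_infty S f" "S \<noteq> {}"
  shows False
proof -
  obtain z where z: "z \<in> S" using assms by blast
  have "(\<lambda>k. norm (f k z)) \<longlonglongrightarrow> norm (g z)" using loc_unif_limit_tendsto[OF assms(1) z] by (rule tendsto_norm)
  then have "\<forall>\<^sub>F k in sequentially. norm (f k z) < norm (g z) + 1" by (rule order_tendstoD(2)) simp
  moreover have "\<forall>\<^sub>F k in sequentially. \<forall>w\<in>{z}. norm (g z) + 1 \<le> norm (f k w)"
    by (rule loc_unif_inftyD[OF assms(2)]) (use z in auto)
  ultimately have "\<forall>\<^sub>F k in sequentially. False" by eventually_elim auto
  then show False by simp
qed

text \<open>Convergence near \<open>z\<close> in the extended plane, in the two forms in which it occurs for sequences of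
holomorphic functions. The radius \<open>d\<close> does not depend on the accuracy, as in the definition of a spherically
locally uniform limit.\<close>

definition locally_convergent_at :: "(nat \<Rightarrow> complex \<Rightarrow> complex) \<Rightarrow> complex \<Rightarrow> bool" where
  "locally_convergent_at f z \<longleftrightarrow> (\<exists>d>0. (\<exists>l. uniform_limit (ball z d) f l sequentially) \<or>
     (\<forall>M. \<forall>\<^sub>F k in sequentially. \<forall>w\<in>ball z d. M \<le> norm (f k w)))"

lemma loc_unif_limit_imp_locally_convergent_at: "loc_unif_limit S f g \<Longrightarrow> open S \<Longrightarrow> z \<in> S \<Longrightarrow> locally_convergent_at f z"
  using loc_unif_limit_local unfolding locally_convergent_at_def by metis

lemma loc_unif_infty_imp_locally_convergent_at:
  assumes "loc_unif_infty S f" "open S" "z \<in> S" shows "locally_convergent_at f z"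
proof -
  obtain d where d: "d > 0" "cball z d \<subseteq> S" using assms open_contains_cball by blast
  have "\<forall>\<^sub>F k in sequentially. \<forall>w\<in>ball z d. M \<le> norm (f k w)" for M
    using loc_unif_inftyD[OF assms(1) compact_cball d(2)] by (rule eventually_mono) auto
  then show ?thesis unfolding locally_convergent_at_def using d(1) by blast
qed

lemma locally_convergent_at_one_minus:
  assumes "locally_convergent_at (\<lambda>k z. 1 - f k z) z"
  shows "locally_convergent_at f z"
proof -
  obtain d where d: "d > 0" and alt: "(\<exists>l. uniform_limit (ball z d) (\<lambda>k z. 1 - f k z) l sequentially) \<or>
     (\<forall>M. \<forall>\<^sub>F k in sequentially. \<forall>w\<in>ball z d. M \<le> norm (1 - f k w))"
    using assms unfolding locally_convergent_at_def by blast
  from alt show ?thesis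
  proof (elim disjE exE)
    fix l assume "uniform_limit (ball z d) (\<lambda>k z. 1 - f k z) l sequentially"
    then have "uniform_limit (ball z d) f (\<lambda>z. 1 - l z) sequentially"
      unfolding uniform_limit_iff dist_norm by (simp add: algebra_simps norm_minus_commute)
    then show ?thesis unfolding locally_convergent_at_def using d by blast
  next
    assume inf: "\<forall>M. \<forall>\<^sub>F k in sequentially. \<forall>w\<in>ball z d. M \<le> norm (1 - f k w)"
    have "\<forall>\<^sub>F k in sequentially. \<forall>w\<in>ball z d. M \<le> norm (f k w)" for M
    proof -
      have "\<forall>\<^sub>F k in sequentially. \<forall>w\<in>ball z d. M + 1 \<le> norm (1 - f k w)" using inf by blast
      then show ?thesis
      proof (rule eventually_mono, intro ballI)
        fix k w assume "\<forall>w\<in>ball z d. M + 1 \<le> norm (1 - f k w)" "w \<in> ball z d"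
        then have "M + 1 \<le> norm (1 - f k w)" by blast
        then show "M \<le> norm (f k w)" using norm_triangle_ineq4[of 1 "f k w"] by simp
      qed
    qed
    then show ?thesis unfolding locally_convergent_at_def using d by blast
  qed
qed

lemma locally_convergent_at_rotate:
  assumes "locally_convergent_at (\<lambda>k z. f k (u * z)) z" "norm u = 1"
  shows "locally_convergent_at f (u * z)"
proof -
  obtain d where d: "d > 0" and alt: "(\<exists>l. uniform_limit (ball z d) (\<lambda>k z. f k (u * z)) l sequentially) \<or>
     (\<forall>M. \<forall>\<^sub>F k in sequentially. \<forall>w\<in>ball z d. M \<le> norm (f k (u * w)))"
    using assms(1) unfolding locally_convergent_at_def by blast
  have u0: "u \<noteq> 0" using assms(2) by auto
  have b: "w / u \<in> ball z d" "u * (w / u) = w" if "w \<in> ball (u * z) d" for w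
  proof -
    show "u * (w / u) = w" using u0 by simp
    have "u * z - w = u * (z - w / u)" using u0 by (simp add: field_simps)
    then have "norm (u * z - w) = norm (z - w / u)" using assms(2) by (simp add: norm_mult)
    then show "w / u \<in> ball z d" using that by (simp add: dist_norm)
  qed
  from alt show ?thesis
  proof (elim disjE exE)
    fix l assume l: "uniform_limit (ball z d) (\<lambda>k z. f k (u * z)) l sequentially"
    have "uniform_limit (ball (u * z) d) f (\<lambda>w. l (w / u)) sequentially"
    proof (rule uniform_limitI)
      fix e :: real assume "e > 0"
      with l have "\<forall>\<^sub>F k in sequentially. \<forall>w\<in>ball z d. dist (f k (u * w)) (l w) < e" by (rule uniform_limitD)
      then show "\<forall>\<^sub>F k in sequentially. \<forall>w\<in>ball (u * z) d. dist (f k w) (l (w / u)) < e"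
        by (rule eventually_mono) (metis b)
    qed
    then show ?thesis unfolding locally_convergent_at_def using d by blast
  next
    assume inf: "\<forall>M. \<forall>\<^sub>F k in sequentially. \<forall>w\<in>ball z d. M \<le> norm (f k (u * w))"
    have "\<forall>\<^sub>F k in sequentially. \<forall>w\<in>ball (u * z) d. M \<le> norm (f k w)" for M
      using spec[OF inf, of M]
    proof (rule eventually_mono, intro ballI)
      fix k w assume k: "\<forall>w\<in>ball z d. M \<le> norm (f k (u * w))" and w: "w \<in> ball (u * z) d"
      show "M \<le> norm (f k w)" using bspec[OF k b(1)[OF w]] unfolding b(2)[OF w] .
    qed
    then show ?thesis unfolding locally_convergent_at_def using d by blast
  qed
qed

lemma alternatives_subseq:
  assumes "(\<exists>g. loc_unif_limit S f g) \<or> loc_unif_infty S f" "strict_mono r"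
  shows "(\<exists>g. loc_unif_limit S (\<lambda>k. f (r k)) g) \<or> loc_unif_infty S (\<lambda>k. f (r k))"
  using assms(1)
proof (elim disjE exE)
  fix g assume "loc_unif_limit S f g"
  from loc_unif_limit_subseq[OF this assms(2)] show ?thesis by (intro disjI1 exI)
next
  assume "loc_unif_infty S f"
  from loc_unif_infty_subseq[OF this assms(2)] show ?thesis by (intro disjI2)
qed

lemma bool_subseq:
  fixes P :: "nat \<Rightarrow> bool"
  shows "\<exists>r :: nat \<Rightarrow> nat. strict_mono r \<and> ((\<forall>k. P (r k)) \<or> (\<forall>k. \<not> P (r k)))"
proof (cases "infinite {k. P k}")
  case True
  then obtain r :: "nat \<Rightarrow> nat" where "strict_mono r" "\<forall>n. r n \<in> {k. P k}" using infinite_enumerate by metis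
  then show ?thesis by (intro exI[of _ r]) simp
next
  case False
  have "UNIV = {k. P k} \<union> {k. \<not> P k}" by blast
  then have "infinite {k. \<not> P k}" using False by (metis finite_Un infinite_UNIV_nat)
  then obtain r :: "nat \<Rightarrow> nat" where "strict_mono r" "\<forall>n. r n \<in> {k. \<not> P k}" using infinite_enumerate by metis
  then show ?thesis by (intro exI[of _ r]) simp
qed

lemma Montel_omitting_bounded:
  assumes S: "open S" "connected S" "p \<in> S" and hol: "\<And>k::nat. f k holomorphic_on S"
    and om: "\<And>k z. z \<in> S \<Longrightarrow> f k z \<noteq> 0 \<and> f k z \<noteq> 1" and b: "\<And>k. norm (f k p) \<le> 1"
  shows "\<exists>r g. strict_mono r \<and> g holomorphic_on S \<and> loc_unif_limit S (\<lambda>k. f (r k)) g"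
proof -
  obtain g r where "g holomorphic_on S" "strict_mono (r :: nat \<Rightarrow> nat)"
          "\<And>x. x \<in> S \<Longrightarrow> ((\<lambda>n. f (r n) x) \<longlongrightarrow> g x) sequentially"
          "\<And>K. \<lbrakk>compact K; K \<subseteq> S\<rbrakk> \<Longrightarrow> uniform_limit K (f \<circ> r) g sequentially"
  proof (rule Montel[OF S(1), of "range f" f])
    fix K assume K: "compact K" "K \<subseteq> S"
    obtain B where "\<And>h z. \<lbrakk>h \<in> range f; z \<in> K\<rbrakk> \<Longrightarrow> norm(h z) \<le> B"
      by (rule GPicard3[of S p "range f" "range f" K]) (use S hol om b K in auto)
    then show "\<exists>B. \<forall>h\<in>range f. \<forall>z\<in>K. norm (h z) \<le> B" by meson
  qed (use hol in blast)+
  then show ?thesis unfolding loc_unif_limit_def o_def by (intro exI[of _ r] exI[of _ g]) simp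
qed

text \<open>Montel's theorem for functions omitting \<open>0\<close> and \<open>1\<close>. If the values at some point exceed \<open>1\<close> in modulus along a subsequence, it is
applied to \<open>1 / f\<close>, whose limit has no zeros (then \<open>f\<close> converges) or vanishes identically.\<close>

lemma Montel_omitting:
  assumes S: "open S" "connected S" "S \<noteq> {}" and hol: "\<And>k::nat. f k holomorphic_on S"
    and om: "\<And>k z. z \<in> S \<Longrightarrow> f k z \<noteq> 0 \<and> f k z \<noteq> 1"
  shows "\<exists>r. strict_mono r \<and> ((\<exists>g. loc_unif_limit S (\<lambda>k. f (r k)) g) \<or> loc_unif_limit S (\<lambda>k z. inverse (f (r k) z)) (\<lambda>z. 0))"
proof -
  obtain p where p: "p \<in> S" using S by auto
  obtain r1 :: "nat \<Rightarrow> nat" where r1: "strict_mono r1" 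
      "(\<forall>k. norm (f (r1 k) p) \<le> 1) \<or> (\<forall>k. \<not> norm (f (r1 k) p) \<le> 1)"
    using bool_subseq[of "\<lambda>k. norm (f k p) \<le> 1"] by blast
  from r1(2) show ?thesis
  proof
    assume b: "\<forall>k. norm (f (r1 k) p) \<le> 1"
    obtain r g where r: "strict_mono r" "loc_unif_limit S (\<lambda>k. f (r1 (r k))) g"
    proof -
      have "\<exists>r g. strict_mono r \<and> g holomorphic_on S \<and> loc_unif_limit S (\<lambda>k. f (r1 (r k))) g"
        by (rule Montel_omitting_bounded[OF S(1,2) p]) (simp_all add: hol om b)
      then show ?thesis using that by metis
    qed
    then show ?thesis using strict_mono_o[OF r1(1) r(1)] by (intro exI[of _ "r1 \<circ> r"]) auto
  next
    assume b: "\<forall>k. \<not> norm (f (r1 k) p) \<le> 1"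
    obtain r g where r: "strict_mono r" "g holomorphic_on S" "loc_unif_limit S (\<lambda>k z. inverse (f (r1 (r k)) z)) g"
    proof -
      have "\<exists>r g. strict_mono r \<and> g holomorphic_on S \<and> loc_unif_limit S (\<lambda>k z. inverse (f (r1 (r k)) z)) g"
      proof (rule Montel_omitting_bounded[OF S(1,2) p])
        show "(\<lambda>z. inverse (f (r1 k) z)) holomorphic_on S" for k
          using hol om by (auto intro!: holomorphic_intros)
        show "inverse (f (r1 k) z) \<noteq> 0 \<and> inverse (f (r1 k) z) \<noteq> 1" if "z \<in> S" for k z
          using om[OF that] by (metis inverse_1 inverse_inverse_eq inverse_zero)
        show "norm (inverse (f (r1 k) p)) \<le> 1" for k
        proof -
          have "1 < norm (f (r1 k) p)" using b by (simp add: not_le)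
          then show ?thesis by (simp add: norm_inverse inverse_le_1_iff)
        qed
      qed
      then show ?thesis using that by metis
    qed
    note sm = strict_mono_o[OF r1(1) r(1)]
    have "(\<forall>z\<in>S. g z \<noteq> 0) \<or> (\<forall>z\<in>S. g z = 0)"
      by (rule loc_unif_limit_nonvanishing_limit[OF S(1,2) _ r(3)])
         (use hol om in \<open>auto intro!: holomorphic_intros\<close>)
    then show ?thesis
    proof
      assume "\<forall>z\<in>S. g z \<noteq> 0"
      then have "loc_unif_limit S (\<lambda>k z. inverse (inverse (f (r1 (r k)) z))) (\<lambda>z. inverse (g z))"
        using r holomorphic_on_imp_continuous_on by (intro loc_unif_limit_inverse) auto
      then show ?thesis using sm by (intro exI[of _ "r1 \<circ> r"]) auto
    next
      assume "\<forall>z\<in>S. g z = 0"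
      then have "loc_unif_limit S (\<lambda>k z. inverse (f (r1 (r k)) z)) (\<lambda>z. 0)"
        using loc_unif_limit_cong[OF r(3)] by simp
      then show ?thesis using sm by (intro exI[of _ "r1 \<circ> r"]) auto
    qed
  qed
qed

lemma Montel_omitting_finite:
  assumes S: "open S" "connected S" "p \<in> S" and hol: "\<And>k::nat. f k holomorphic_on S"
    and om: "\<And>k z. z \<in> S \<Longrightarrow> f k z \<noteq> 0 \<and> f k z \<noteq> 1"
    and b: "\<forall>\<^sub>F k in sequentially. norm (f k p) \<le> B"
  shows "\<exists>r g. strict_mono r \<and> loc_unif_limit S (\<lambda>k. f (r k)) g"
proof -
  have "S \<noteq> {}" using S by auto
  then have "\<exists>r. strict_mono r \<and> ((\<exists>g. loc_unif_limit S (\<lambda>k. f (r k)) g) \<or> loc_unif_limit S (\<lambda>k z. inverse (f (r k) z)) (\<lambda>z. 0))"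
    by (intro Montel_omitting[OF S(1,2) _ hol om])
  then obtain r :: "nat \<Rightarrow> nat" where r: "strict_mono r"
    and alt: "(\<exists>g. loc_unif_limit S (\<lambda>k. f (r k)) g) \<or> loc_unif_limit S (\<lambda>k z. inverse (f (r k) z)) (\<lambda>z. 0)" by (elim exE conjE)
  have "\<not> loc_unif_limit S (\<lambda>k z. inverse (f (r k) z)) (\<lambda>z. 0)"
  proof
    assume "loc_unif_limit S (\<lambda>k z. inverse (f (r k) z)) (\<lambda>z. 0)"
    from loc_unif_limit_tendsto[OF this S(3)] have "(\<lambda>k. norm (inverse (f (r k) p))) \<longlonglongrightarrow> norm (0::complex)" by (rule tendsto_norm)
    then have l: "(\<lambda>k. norm (inverse (f (r k) p))) \<longlonglongrightarrow> 0" by simp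
    define C where "C = max B 1"
    have "\<forall>\<^sub>F k in sequentially. norm (inverse (f (r k) p)) < inverse C"
      using l by (rule order_tendstoD(2)) (simp add: C_def)
    moreover have "\<forall>\<^sub>F k in sequentially. norm (f (r k) p) \<le> B" using eventually_subseq[OF r b] .
    ultimately have "\<forall>\<^sub>F k in sequentially. False"
    proof eventually_elim
      case (elim k)
      have "norm (f (r k) p) > 0" using om[OF S(3)] by simp
      moreover have "norm (f (r k) p) \<le> C" using elim by (simp add: C_def)
      ultimately have "inverse C \<le> inverse (norm (f (r k) p))" by (intro le_imp_inverse_le) auto
      then show False using elim by (simp add: norm_inverse)
    qed
    then show False by simp
  qed
  then show ?thesis using alt r by blast
qed

text \<open>Since the sequence is bounded near the line, it suffices to show that it is a Cauchy sequence. On a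
circle \<open>|z| = a\<close> the differences are small away from the real line, and there \<open>|z\<^sup>2 - a\<^sup>2| = 2 a |Im z|\<close>, so the factor
\<open>z\<^sup>2 - a\<^sup>2\<close> makes them small near the line as well; the maximum principle does the rest.\<close>

lemma line_convergence:
  assumes hol: "\<And>k::nat. \<phi> k holomorphic_on ball 0 1"
    and om: "\<And>k z. z \<in> ball 0 1 \<Longrightarrow> Im z \<noteq> 0 \<Longrightarrow> \<phi> k z \<noteq> 0 \<and> \<phi> k z \<noteq> 1"
    and up: "loc_unif_limit (ball 0 1 \<inter> {z. 0 < Im z}) \<phi> g"
    and lo: "loc_unif_limit (ball 0 1 \<inter> {z. Im z < 0}) \<phi> h"
  shows "\<exists>r l. 0 < r \<and> r \<le> 1 \<and> l holomorphic_on ball 0 r \<and> uniform_limit (ball 0 r) \<phi> l sequentially \<and>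
     (\<forall>z\<in>ball 0 r. (0 < Im z \<longrightarrow> l z = g z) \<and> (Im z < 0 \<longrightarrow> l z = h z))"
proof -
  obtain r0 where r0: "0 < r0" "r0 \<le> 1/4" and r0B: "\<And>A. A \<ge> 1 \<Longrightarrow> \<exists>B. \<forall>F. F holomorphic_on ball 0 1 \<longrightarrow>
     (\<forall>z\<in>ball 0 1. Im z \<noteq> 0 \<longrightarrow> F z \<noteq> 0 \<and> F z \<noteq> 1) \<longrightarrow>
     (\<forall>z. \<bar>Re z\<bar> \<le> 1/2 \<longrightarrow> \<bar>Im z\<bar> = 1/4 \<longrightarrow> norm (F z) \<le> exp A) \<longrightarrow>
     (\<forall>z\<in>ball 0 r0. norm (F z) \<le> B)"
    using line_removal_bound by blast
  define Q where "Q s = {z. \<bar>Re z\<bar> \<le> 1/2 \<and> Im z = s}" for s :: real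
  have Qn: "norm z \<le> 3/4" if "z \<in> Q s" "\<bar>s\<bar> = 1/4" for z s
    using that cmod_le[of z] by (auto simp: Q_def)
  have Qc: "compact (Q s)" if "\<bar>s\<bar> = 1/4" for s
  proof -
    have "Q s = {z. \<bar>Re z\<bar> \<le> 1/2} \<inter> {z. Im z = s}" by (auto simp: Q_def)
    then have "closed (Q s)"
      by (simp only:) (intro closed_Int closed_Collect_le closed_Collect_eq continuous_intros)
    moreover have "bounded (Q s)" using Qn that unfolding bounded_iff by blast
    ultimately show ?thesis by (simp add: compact_eq_bounded_closed)
  qed
  have cont: "continuous_on (ball 0 1) (\<phi> k)" for k
    using hol holomorphic_on_imp_continuous_on by blast
  have "Q (1/4) \<subseteq> ball 0 1 \<inter> {z. 0 < Im z}" "Q (-1/4) \<subseteq> ball 0 1 \<inter> {z. Im z < 0}"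
    using Qn[of _ "1/4"] Qn[of _ "-1/4"] by (force simp: Q_def)+
  note Qs = this
  obtain B1 where B1: "B1 > 0" "\<forall>\<^sub>F k in sequentially. \<forall>z\<in>Q (1/4). norm (\<phi> k z) \<le> B1"
    using loc_unif_limit_eventually_bounded[OF up Qc[of "1/4"] Qs(1)] continuous_on_subset[OF cont] by auto
  obtain B2 where B2: "B2 > 0" "\<forall>\<^sub>F k in sequentially. \<forall>z\<in>Q (-1/4). norm (\<phi> k z) \<le> B2"
    using loc_unif_limit_eventually_bounded[OF lo Qc[of "-1/4"] Qs(2)] continuous_on_subset[OF cont] by auto
  note B = B1 B2
  \<comment> \<open>The segments \<open>Q (1/4)\<close> and \<open>Q (-1/4)\<close> control the sequence on both sides of the line.\<close>
  define A where "A = max 1 (ln (max B1 B2))"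
  have A: "1 \<le> A" "max B1 B2 \<le> exp A"
  proof -
    have "max B1 B2 = exp (ln (max B1 B2))" using B by (simp add: exp_ln)
    also have "\<dots> \<le> exp A" by (simp add: A_def)
    finally show "max B1 B2 \<le> exp A" .
  qed (simp add: A_def)
  obtain B0 where B0: "\<And>F. F holomorphic_on ball 0 1 \<Longrightarrow>
     (\<And>z. z\<in>ball 0 1 \<Longrightarrow> Im z \<noteq> 0 \<Longrightarrow> F z \<noteq> 0 \<and> F z \<noteq> 1) \<Longrightarrow>
     (\<And>z. \<bar>Re z\<bar> \<le> 1/2 \<Longrightarrow> \<bar>Im z\<bar> = 1/4 \<Longrightarrow> norm (F z) \<le> exp A) \<Longrightarrow>
     (\<forall>z\<in>ball 0 r0. norm (F z) \<le> B0)"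
    using r0B[OF A(1)] by meson
  have "\<forall>\<^sub>F k in sequentially. \<forall>z\<in>ball 0 r0. norm (\<phi> k z) \<le> B0"
    using B(2) B(4)
  proof eventually_elim
    case (elim k)
    show ?case
    proof (rule B0[OF hol om])
      fix z assume z: "\<bar>Re z\<bar> \<le> 1/2" "\<bar>Im z\<bar> = 1/4"
      then have "z \<in> Q (1/4) \<or> z \<in> Q (-1/4)" by (auto simp: Q_def abs_if split: if_splits)
      then have "norm (\<phi> k z) \<le> max B1 B2" using elim by auto
      then show "norm (\<phi> k z) \<le> exp A" using A by linarith
    qed auto
  qed
  then obtain k1 where k1: "\<And>k z. k \<ge> k1 \<Longrightarrow> z \<in> ball 0 r0 \<Longrightarrow> norm (\<phi> k z) \<le> B0"
    unfolding eventually_sequentially by blast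
  have B00: "B0 \<ge> 0" using k1[of k1 0] r0 norm_ge_zero order_trans by (metis centre_in_ball order_refl)
  define a where "a = r0/2"
  have a: "0 < a" "a < r0" "a < 1" using r0 by (auto simp: a_def)
  have "uniformly_Cauchy_on (ball 0 (a/2)) \<phi>"
  proof (rule uniformly_Cauchy_onI)
    fix e :: real assume e: "e > 0"
    define \<epsilon> where "\<epsilon> = e * a^2 / 4"
    define \<eta> where "\<eta> = \<epsilon> / (4 * a * (B0 + 1))"
    have \<epsilon>: "\<epsilon> > 0" and \<eta>: "\<eta> > 0" using e a B00 by (auto simp: \<epsilon>_def \<eta>_def)
    have c1: "compact (sphere 0 a \<inter> {z. \<eta> \<le> Im z})" "compact (sphere 0 a \<inter> {z. Im z \<le> -\<eta>})"
      by (intro compact_Int_closed closed_Collect_le continuous_intros compact_sphere)+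
    have c2: "sphere 0 a \<inter> {z. \<eta> \<le> Im z} \<subseteq> ball 0 1 \<inter> {z. 0 < Im z}"
      "sphere 0 a \<inter> {z. Im z \<le> -\<eta>} \<subseteq> ball 0 1 \<inter> {z. Im z < 0}" using \<eta> a by auto
    define \<delta> where "\<delta> = \<epsilon> / (4 * a^2)"
    have \<delta>: "\<delta> > 0" using \<epsilon> a by (auto simp: \<delta>_def)
    have "\<forall>\<^sub>F k in sequentially. \<forall>z\<in>sphere 0 a \<inter> {z. \<eta> \<le> Im z}. dist (\<phi> k z) (g z) < \<delta>"
      using loc_unif_limitD[OF up c1(1) c2(1)] \<delta> by (rule uniform_limitD)
    moreover have "\<forall>\<^sub>F k in sequentially. \<forall>z\<in>sphere 0 a \<inter> {z. Im z \<le> -\<eta>}. dist (\<phi> k z) (h z) < \<delta>"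
      using loc_unif_limitD[OF lo c1(2) c2(2)] \<delta> by (rule uniform_limitD)
    ultimately have "\<forall>\<^sub>F k in sequentially. (\<forall>z\<in>sphere 0 a \<inter> {z. \<eta> \<le> Im z}. dist (\<phi> k z) (g z) < \<delta>) \<and>
        (\<forall>z\<in>sphere 0 a \<inter> {z. Im z \<le> -\<eta>}. dist (\<phi> k z) (h z) < \<delta>)"
      by (rule eventually_conj)
    then obtain k2 where k2': "\<forall>k\<ge>k2. (\<forall>z\<in>sphere 0 a \<inter> {z. \<eta> \<le> Im z}. dist (\<phi> k z) (g z) < \<delta>) \<and>
        (\<forall>z\<in>sphere 0 a \<inter> {z. Im z \<le> -\<eta>}. dist (\<phi> k z) (h z) < \<delta>)"
      unfolding eventually_sequentially by blast
    have k2: "\<And>k z. k \<ge> k2 \<Longrightarrow> norm z = a \<Longrightarrow> \<eta> \<le> Im z \<Longrightarrow> dist (\<phi> k z) (g z) < \<delta>"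
      "\<And>k z. k \<ge> k2 \<Longrightarrow> norm z = a \<Longrightarrow> Im z \<le> -\<eta> \<Longrightarrow> dist (\<phi> k z) (h z) < \<delta>"
      using k2' by simp_all
    show "\<exists>M. \<forall>z\<in>ball 0 (a/2). \<forall>m\<ge>M. \<forall>n\<ge>M. dist (\<phi> m z) (\<phi> n z) < e"
    proof (intro exI[of _ "max k1 k2"] ballI allI impI)
      fix z :: complex and m n :: nat assume z: "z \<in> ball 0 (a/2)" and m: "m \<ge> max k1 k2" and n: "n \<ge> max k1 k2"
      define G where "G = (\<lambda>z. (\<phi> m z - \<phi> n z) * (z^2 - of_real (a^2)))"
      have sub: "cball 0 a \<subseteq> ball (0::complex) 1" using a by auto
      have hG: "G holomorphic_on cball 0 a" unfolding G_def
        by (intro holomorphic_intros holomorphic_on_subset[OF hol sub])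
      have "norm (G z) \<le> \<epsilon>"
      proof (rule maximum_modulus_frontier[of G "cball 0 a"])
        show "G holomorphic_on interior (cball 0 a)"
          using hG holomorphic_on_subset interior_subset by blast
        show "continuous_on (closure (cball 0 a)) G"
          using hG holomorphic_on_imp_continuous_on by auto
        fix w :: complex assume "w \<in> frontier (cball 0 a)"
        then have w: "norm w = a" by simp
        have "of_real (a^2) = w * cnj w" using complex_norm_square[of w] by (simp only: w)
        then have "w^2 - of_real (a^2) = w * (w - cnj w)" by (simp add: power2_eq_square algebra_simps)
        also have "\<dots> = w * (of_real (2 * Im w) * \<i>)" by (simp add: complex_diff_cnj)
        finally have nw: "norm (w^2 - of_real (a^2)) = 2 * a * \<bar>Im w\<bar>"
          by (simp add: norm_mult w)
        have nG: "norm (G w) = norm (\<phi> m w - \<phi> n w) * (2 * a * \<bar>Im w\<bar>)"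
          by (simp only: G_def norm_mult nw)
        show "norm (G w) \<le> \<epsilon>"
        proof (cases "\<bar>Im w\<bar> < \<eta>")
          case True
          have "norm (\<phi> m w - \<phi> n w) \<le> norm (\<phi> m w) + norm (\<phi> n w)" by (rule norm_triangle_ineq4)
          also have "\<dots> \<le> 2 * (B0 + 1)" using k1[of m w] k1[of n w] m n w a by auto
          finally have "norm (G w) \<le> 2 * (B0 + 1) * (2 * a * \<eta>)"
            unfolding nG using True a B00 by (intro mult_mono) auto
          also have "\<dots> = \<epsilon>"
          proof -
            have "4 * B0 + 4 \<noteq> 0" using B00 by linarith
            then show ?thesis using a by (simp add: \<eta>_def) (simp add: field_simps)
          qed
          finally show ?thesis .
        next
          case False
          then have "\<eta> \<le> Im w \<or> Im w \<le> -\<eta>" by linarith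
          then have "dist (\<phi> m w) (\<phi> n w) \<le> 2 * \<delta>"
          proof
            assume "\<eta> \<le> Im w"
            then show ?thesis using k2(1)[of m w] k2(1)[of n w] m n w dist_triangle2[of "\<phi> m w" "\<phi> n w" "g w"] by auto
          next
            assume "Im w \<le> -\<eta>"
            then show ?thesis using k2(2)[of m w] k2(2)[of n w] m n w dist_triangle2[of "\<phi> m w" "\<phi> n w" "h w"] by auto
          qed
          moreover have "\<bar>Im w\<bar> \<le> a" using abs_Im_le_cmod[of w] w by simp
          ultimately have "norm (G w) \<le> 2 * \<delta> * (2 * a * a)"
            unfolding nG using a \<delta> by (intro mult_mono) (auto simp: dist_norm)
          also have "\<dots> = \<epsilon>" using a by (simp add: \<delta>_def power2_eq_square)
          finally show ?thesis .
        qed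
      qed (use z a in auto)
      moreover have "a^2 / 2 \<le> norm (z^2 - of_real (a^2))"
      proof -
        have "norm z ^ 2 \<le> (a/2)^2" using z by (intro power_mono) auto
        then have "norm (z^2) \<le> a^2/4" by (simp add: norm_power power_divide)
        moreover have "norm (of_real (a^2) :: complex) = a^2" by (simp only: norm_of_real) simp
        moreover have "norm (of_real (a^2) :: complex) - norm (z^2) \<le> norm (z^2 - of_real (a^2))"
          by (metis norm_minus_commute norm_triangle_ineq2)
        ultimately show ?thesis using zero_le_power2[of a] by linarith
      qed
      ultimately have "norm (\<phi> m z - \<phi> n z) * (a^2 / 2) \<le> \<epsilon>"
        unfolding G_def norm_mult by (meson mult_left_mono norm_ge_zero order_trans)
      then have "norm (\<phi> m z - \<phi> n z) \<le> \<epsilon> / (a^2/2)" using a by (simp add: field_simps)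
      also have "\<dots> = e / 2" using a by (simp add: \<epsilon>_def field_simps)
      finally show "dist (\<phi> m z) (\<phi> n z) < e" using e by (simp add: dist_norm)
    qed
  qed
  then obtain l where l: "uniform_limit (ball 0 (a/2)) \<phi> l sequentially"
    using Cauchy_uniformly_convergent by (auto simp: uniformly_convergent_on_def)
  have sub: "ball 0 (a/2) \<subseteq> ball (0::complex) 1" using a by auto
  have "l holomorphic_on ball 0 (a/2)"
    by (rule uniform_limit_holomorphic[OF l]) (rule holomorphic_on_subset[OF hol sub])
  moreover have "(0 < Im z \<longrightarrow> l z = g z) \<and> (Im z < 0 \<longrightarrow> l z = h z)" if "z \<in> ball 0 (a/2)" for z
  proof -
    have "z \<in> ball 0 1" using that sub by blast
    then show ?thesis
      using LIMSEQ_unique[OF tendsto_uniform_limitI[OF l that]] loc_unif_limit_tendsto[OF up, of z] loc_unif_limit_tendsto[OF lo, of z]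
      by blast
  qed
  ultimately show ?thesis using l a by (intro exI[of _ "a/2"] exI[of _ l]) auto
qed

section \<open>Sectors and the slit disc\<close>

text \<open>The angles are arbitrary reals, so that a sector may cross the negative axis.\<close>

definition sector :: "real \<Rightarrow> real \<Rightarrow> complex set" where
  "sector a b = exp ` {w. Re w < 0 \<and> a < Im w \<and> Im w < b}"

lemma open_strip: "open {w. Re w < 0 \<and> a < Im w \<and> Im w < b}"
  by (intro open_Collect_conj open_Collect_less continuous_intros)

lemma open_sector: "open (sector a b)"
  unfolding sector_def
proof (rule open_mapping_thm[of exp UNIV])
  show "\<not> exp constant_on (UNIV :: complex set)"
  proof
    assume "exp constant_on (UNIV :: complex set)"
    then obtain c where "\<And>z::complex. exp z = c" by (auto simp: constant_on_def)
    then have "exp (0::complex) = exp (\<i> * pi)" by metis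
    then show False by (simp add: exp_pi_i')
  qed
qed (auto intro: open_strip holomorphic_intros)

lemma connected_sector: "connected (sector a b)"
proof -
  have "{w. Re w < 0 \<and> a < Im w \<and> Im w < b} = {w. Re w < 0} \<inter> {w. a < Im w} \<inter> {w. Im w < b}" by auto
  then have "convex {w. Re w < 0 \<and> a < Im w \<and> Im w < b}"
    by (simp add: convex_Int convex_halfspace_Im_gt convex_halfspace_Im_lt convex_halfspace_Re_lt)
  then show ?thesis unfolding sector_def
    by (intro connected_continuous_image convex_connected continuous_intros)
qed

lemma sector_subset: "sector a b \<subseteq> ball 0 1 - {0}"
  by (auto simp: sector_def norm_exp_eq_Re)

lemma sector_mono: "a' \<le> a \<Longrightarrow> b \<le> b' \<Longrightarrow> sector a b \<subseteq> sector a' b'"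
  unfolding sector_def by (intro image_mono) auto

lemma sector_I: "z = exp w \<Longrightarrow> Re w < 0 \<Longrightarrow> a < Im w \<Longrightarrow> Im w < b \<Longrightarrow> z \<in> sector a b"
  by (auto simp: sector_def)

lemma sector_shift: "sector (a + 2*pi) (b + 2*pi) = sector a b"
proof -
  have *: "sector (a + 2 * pi * s) (b + 2 * pi * s) \<subseteq> sector a b" if "s = 1 \<or> s = - 1" for a b s
  proof
    fix z assume "z \<in> sector (a + 2 * pi * s) (b + 2 * pi * s)"
    then obtain w where w: "z = exp w" "Re w < 0" "a + 2 * pi * s < Im w" "Im w < b + 2 * pi * s" by (auto simp: sector_def)
    have "exp (w - \<i> * of_real (2 * pi * s)) = z"
    proof -
      have "exp (\<i> * (2 * complex_of_real pi)) = 1" using exp_two_pi_i by (simp add: mult_ac)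
      then show ?thesis using that by (auto simp: exp_diff w exp_minus)
    qed
    then show "z \<in> sector a b"
      by (intro sector_I[of z "w - \<i> * of_real (2 * pi * s)"]) (use w in simp_all)
  qed
  show ?thesis using *[of 1 a b] *[of "-1" "a+2*pi" "b+2*pi"] by auto
qed

lemma sector_nonempty: "a < b \<Longrightarrow> sector a b \<noteq> {}"
proof -
  assume "a < b"
  then have "exp (Complex (-1) ((a+b)/2)) \<in> sector a b" by (intro sector_I) auto
  then show ?thesis by auto
qed

lemma sector_avoids_ray:
  assumes "(\<alpha> \<le> a \<and> b \<le> \<alpha> + 2 * pi) \<or> (\<alpha> - 2 * pi \<le> a \<and> b \<le> \<alpha>)"
  shows "exp (Complex x \<alpha>) \<notin> sector a b"
proof
  assume "exp (Complex x \<alpha>) \<in> sector a b"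
  then obtain w where w: "exp (Complex x \<alpha>) = exp w" "a < Im w" "Im w < b" by (auto simp: sector_def)
  then obtain n :: int where "Complex x \<alpha> = w + complex_of_real (of_int (2 * n) * pi) * \<i>"
    unfolding exp_eq by blast
  then have "Im (Complex x \<alpha>) = Im (w + complex_of_real (of_int (2 * n) * pi) * \<i>)" by (simp only:)
  then have n: "\<alpha> = Im w + of_int (2 * n) * pi" by simp
  from assms show False
  proof (elim disjE conjE)
    assume a: "\<alpha> \<le> a" "b \<le> \<alpha> + 2 * pi"
    then have "of_int (2 * n) * pi < 0" using n w(2) by linarith
    then have "n \<le> -1" by (simp add: mult_less_0_iff)
    then have "of_int (2 * n) * pi \<le> - 2 * pi" by (intro mult_right_mono) auto
    then show False using n w(3) a(2) by linarith
  next
    assume a: "\<alpha> - 2 * pi \<le> a" "b \<le> \<alpha>"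
    then have "0 < of_int (2 * n) * pi" using n w(3) by linarith
    then have "1 \<le> n" by (simp add: zero_less_mult_iff)
    then have "2 * pi \<le> of_int (2 * n) * pi" by (intro mult_right_mono) auto
    then show False using n w(2) a(1) by linarith
  qed
qed

lemma Montel_sector:
  fixes f :: "nat \<Rightarrow> complex \<Rightarrow> complex"
  assumes "a < b" "\<And>k. f k holomorphic_on sector a b"
    and "\<And>k z. z \<in> sector a b \<Longrightarrow> f k z \<noteq> 0 \<and> f k z \<noteq> 1"
  shows "\<exists>r. strict_mono r \<and> ((\<exists>g. loc_unif_limit (sector a b) (\<lambda>k. f (r k)) g) \<or> loc_unif_infty (sector a b) (\<lambda>k. f (r k)))"
proof -
  have "\<exists>r. strict_mono r \<and> ((\<exists>g. loc_unif_limit (sector a b) (\<lambda>k. f (r k)) g) \<or> loc_unif_limit (sector a b) (\<lambda>k z. inverse (f (r k) z)) (\<lambda>z. 0))"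
    by (rule Montel_omitting[OF open_sector connected_sector sector_nonempty[OF assms(1)] assms(2,3)])
  then obtain r where r: "strict_mono r" "(\<exists>g. loc_unif_limit (sector a b) (\<lambda>k. f (r k)) g) \<or> loc_unif_limit (sector a b) (\<lambda>k z. inverse (f (r k) z)) (\<lambda>z. 0)"
    by (elim exE conjE)
  have "loc_unif_infty (sector a b) (\<lambda>k. f (r k)) \<longleftrightarrow> loc_unif_limit (sector a b) (\<lambda>k z. inverse (f (r k) z)) (\<lambda>z. 0)"
    by (rule loc_unif_infty_iff_inverse) (use assms(3) in blast)
  then show ?thesis using r by (intro exI[of _ r]) simp
qed

lemma exp_strip_in_slit_disc:
  assumes "Re w < 0" "\<bar>Im w\<bar> < pi"
  shows "exp w \<in> ball 0 1 - \<real>\<^sub>\<le>\<^sub>0"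
proof -
  have "exp w \<notin> \<real>\<^sub>\<le>\<^sub>0"
  proof
    assume "exp w \<in> \<real>\<^sub>\<le>\<^sub>0"
    then have a: "Re (exp w) \<le> 0" "Im (exp w) = 0" by (auto simp: complex_nonpos_Reals_iff)
    then have "sin (Im w) = 0" by (simp add: Im_exp)
    then have "Im w = 0" using assms(2) sin_eq_0_pi by (simp add: abs_less_iff)
    then show False using a by (simp add: Re_exp)
  qed
  then show ?thesis using assms by (simp add: norm_exp_eq_Re)
qed

lemma sector_subset_slit_disc: "- pi \<le> a \<Longrightarrow> b \<le> pi \<Longrightarrow> sector a b \<subseteq> ball 0 1 - \<real>\<^sub>\<le>\<^sub>0"
  unfolding sector_def using exp_strip_in_slit_disc by (auto simp: abs_less_iff simp del: mem_ball_0)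

lemma starlike_slit_disc: "starlike (ball 0 1 - \<real>\<^sub>\<le>\<^sub>0 :: complex set)"
  unfolding starlike_def
proof (intro bexI[of _ "1/2"] ballI)
  fix z :: complex assume z: "z \<in> ball 0 1 - \<real>\<^sub>\<le>\<^sub>0"
  show "closed_segment (1/2) z \<subseteq> ball 0 1 - \<real>\<^sub>\<le>\<^sub>0"
  proof
    fix u assume u: "u \<in> closed_segment (1/2) z"
    have "closed_segment (1/2) z \<subseteq> ball 0 1" by (rule closed_segment_subset) (use z in auto)
    moreover have "u \<notin> \<real>\<^sub>\<le>\<^sub>0"
    proof
      assume un: "u \<in> \<real>\<^sub>\<le>\<^sub>0"
      obtain t where t: "0 \<le> t" "t \<le> 1" "u = (1 - t) *\<^sub>R (1/2) + t *\<^sub>R z"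
        using u by (auto simp: closed_segment_def)
      have re: "(1 - t) / 2 + t * Re z \<le> 0" and im: "t * Im z = 0"
        using un t(3) by (auto simp: complex_nonpos_Reals_iff)
      show False
      proof (cases "t = 0")
        case False
        then have "Im z = 0" using im by simp
        then have "Re z > 0" using z by (auto simp: complex_nonpos_Reals_iff)
        then have "t * Re z > 0" using False t by simp
        moreover have "0 \<le> (1 - t) / 2" using t(2) by simp
        ultimately show False using re by linarith
      qed (use re in simp)
    qed
    ultimately show "u \<in> ball 0 1 - \<real>\<^sub>\<le>\<^sub>0" using u by blast
  qed
qed (auto simp: complex_nonpos_Reals_iff)

lemma open_slit_disc: "open (ball 0 1 - \<real>\<^sub>\<le>\<^sub>0 :: complex set)"
  by (intro open_Diff open_ball closed_nonpos_Reals_complex)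

lemma slit_disc_polar:
  assumes "z \<in> ball 0 1 - \<real>\<^sub>\<le>\<^sub>0"
  obtains x \<theta> where "x < 0" "- pi < \<theta>" "\<theta> < pi" "z = exp (Complex x \<theta>)"
proof -
  have z: "z \<noteq> 0" "norm z < 1" "z \<notin> \<real>\<^sub>\<le>\<^sub>0" using assms by auto
  have "Re (Ln z) < 0" using z by simp
  moreover have "- pi < Im (Ln z)" using z mpi_less_Im_Ln by simp
  moreover have "Im (Ln z) < pi"
  proof -
    have "Im (Ln z) \<noteq> pi" using z Im_Ln_eq_pi[of z] by (auto simp: complex_nonpos_Reals_iff)
    then show ?thesis using Im_Ln_le_pi[of z] z by simp
  qed
  moreover have "z = exp (Complex (Re (Ln z)) (Im (Ln z)))" by (metis complex.collapse exp_Ln z(1))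
  ultimately show ?thesis using that by blast
qed

section \<open>Crossing a ray\<close>

lemma exp_rotate_tendsto:
  "((\<lambda>t. exp (Complex x (\<alpha> + t))) \<longlongrightarrow> exp (Complex x \<alpha>)) (at_right 0)"
  "((\<lambda>t. exp (Complex x (\<alpha> - t))) \<longlongrightarrow> exp (Complex x \<alpha>)) (at_right 0)"
proof -
  have "((\<lambda>t. exp (Complex x (\<alpha> + t))) \<longlongrightarrow> exp (Complex x (\<alpha> + 0))) (at_right 0)"
    unfolding Complex_eq by (intro tendsto_intros)
  then show "((\<lambda>t. exp (Complex x (\<alpha> + t))) \<longlongrightarrow> exp (Complex x \<alpha>)) (at_right 0)" by simp
  have "((\<lambda>t. exp (Complex x (\<alpha> - t))) \<longlongrightarrow> exp (Complex x (\<alpha> - 0))) (at_right 0)"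
    unfolding Complex_eq by (intro tendsto_intros)
  then show "((\<lambda>t. exp (Complex x (\<alpha> - t))) \<longlongrightarrow> exp (Complex x \<alpha>)) (at_right 0)" by simp
qed

lemma ray_ball_meets_sector:
  assumes x: "x < 0" and \<eta>: "0 < \<eta>" and c: "c = exp (Complex x \<alpha>)" and d: "0 < d"
  shows "ball c d \<inter> sector \<alpha> (\<alpha> + \<eta>) \<noteq> {}" "ball c d \<inter> sector (\<alpha> - \<eta>) \<alpha> \<noteq> {}"
proof -
  have ev: "\<forall>\<^sub>F t in at_right (0::real). t \<in> {0<..<\<eta>}" by (rule eventually_at_right_real[OF \<eta>])
  have "\<forall>\<^sub>F t in at_right 0. dist (exp (Complex x (\<alpha> + t))) c < d"
    using tendstoD[OF exp_rotate_tendsto(1) d] by (simp add: c)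
  then have "\<forall>\<^sub>F t in at_right 0. exp (Complex x (\<alpha> + t)) \<in> ball c d \<inter> sector \<alpha> (\<alpha> + \<eta>)"
    using ev by eventually_elim (use x in \<open>auto simp: dist_commute intro!: sector_I\<close>)
  then show "ball c d \<inter> sector \<alpha> (\<alpha> + \<eta>) \<noteq> {}"
    using eventually_happens'[OF trivial_limit_at_right_real] by blast
  have "\<forall>\<^sub>F t in at_right 0. dist (exp (Complex x (\<alpha> - t))) c < d"
    using tendstoD[OF exp_rotate_tendsto(2) d] by (simp add: c)
  then have "\<forall>\<^sub>F t in at_right 0. exp (Complex x (\<alpha> - t)) \<in> ball c d \<inter> sector (\<alpha> - \<eta>) \<alpha>"
    using ev by eventually_elim (use x in \<open>auto simp: dist_commute intro!: sector_I\<close>)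
  then show "ball c d \<inter> sector (\<alpha> - \<eta>) \<alpha> \<noteq> {}"
    using eventually_happens'[OF trivial_limit_at_right_real] by blast
qed

text \<open>An affine chart at a point of a ray carries the real diameter of the unit disc into the ray and the two
half-discs into the adjacent sectors.\<close>

lemma ray_chart:
  assumes x: "x < 0" and \<eta>: "0 < \<eta>" and c: "c = exp (Complex x \<alpha>)"
  obtains d where "0 < d" "\<And>\<omega>. \<omega> \<in> ball 0 1 \<Longrightarrow> c * (1 + of_real d * \<omega>) \<in> sector (\<alpha> - \<eta>) (\<alpha> + \<eta>)"
    "\<And>\<omega>. \<omega> \<in> ball 0 1 \<Longrightarrow> 0 < Im \<omega> \<Longrightarrow> c * (1 + of_real d * \<omega>) \<in> sector \<alpha> (\<alpha> + \<eta>)"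
    "\<And>\<omega>. \<omega> \<in> ball 0 1 \<Longrightarrow> Im \<omega> < 0 \<Longrightarrow> c * (1 + of_real d * \<omega>) \<in> sector (\<alpha> - \<eta>) \<alpha>"
proof -
  define m where "m = min \<eta> (-x)"
  have m: "m > 0" using x \<eta> by (auto simp: m_def)
  have "isCont Ln 1" by (intro continuous_at_Ln) auto
  then have "\<exists>d>0. \<forall>z. dist z 1 < d \<longrightarrow> dist (Ln z) (Ln 1) < m"
    using m unfolding continuous_at_eps_delta by blast
  then obtain d where d: "d > 0" "\<And>z. norm (z - 1) < d \<Longrightarrow> norm (Ln z) < m" by (auto simp: dist_norm)
  define d' where "d' = min d (1/2)"
  have d': "0 < d'" "d' \<le> 1/2" "d' \<le> d" using d by (auto simp: d'_def)
  have *: "norm (of_real d' * \<omega>) < d'" if "\<omega> \<in> ball 0 1" for \<omega> :: complex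
    using that d' by (simp add: norm_mult)
  have n: "norm (Ln (1 + of_real d' * \<omega>)) < m" if "\<omega> \<in> ball 0 1" for \<omega>
    using *[OF that] d' by (intro d(2)) auto
  have nz: "1 + of_real d' * \<omega> \<noteq> 0" if "\<omega> \<in> ball 0 1" for \<omega> :: complex
  proof
    assume "1 + of_real d' * \<omega> = 0"
    then have "of_real d' * \<omega> = -1" by (simp add: add_eq_0_iff)
    then show False using *[OF that] d' by simp
  qed
  have ex: "c * (1 + of_real d' * \<omega>) = exp (Complex x \<alpha> + Ln (1 + of_real d' * \<omega>))" if "\<omega> \<in> ball 0 1" for \<omega>
    using nz[OF that] by (simp add: exp_add c)
  have bd: "Re (Ln (1 + of_real d' * \<omega>)) < -x" "\<bar>Im (Ln (1 + of_real d' * \<omega>))\<bar> < \<eta>" if "\<omega> \<in> ball 0 1" for \<omega>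
    using n[OF that] abs_Im_le_cmod[of "Ln (1 + of_real d' * \<omega>)"] complex_Re_le_cmod[of "Ln (1 + of_real d' * \<omega>)"]
    by (auto simp: m_def)
  show ?thesis
  proof (rule that[OF d'(1)])
    fix \<omega> :: complex assume w: "\<omega> \<in> ball 0 1"
    show "c * (1 + of_real d' * \<omega>) \<in> sector (\<alpha> - \<eta>) (\<alpha> + \<eta>)"
      by (rule sector_I[OF ex[OF w]]) (use bd[OF w] in auto)
    show "c * (1 + of_real d' * \<omega>) \<in> sector \<alpha> (\<alpha> + \<eta>)" if "0 < Im \<omega>"
    proof (rule sector_I[OF ex[OF w]])
      have "0 < Im (1 + of_real d' * \<omega>)" using that d' by simp
      then have "0 < Im (Ln (1 + of_real d' * \<omega>))" using Im_Ln_pos_lt[OF nz[OF w]] by blast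
      then show "\<alpha> < Im (Complex x \<alpha> + Ln (1 + of_real d' * \<omega>))" by simp
    qed (use bd[OF w] in auto)
    show "c * (1 + of_real d' * \<omega>) \<in> sector (\<alpha> - \<eta>) \<alpha>" if "Im \<omega> < 0"
    proof (rule sector_I[OF ex[OF w]])
      have "\<not> 0 \<le> Im (1 + of_real d' * \<omega>)"
      proof -
        have "d' * Im \<omega> < 0" using that d' by (intro mult_pos_neg) auto
        then show ?thesis by simp
      qed
      moreover have "Im (Ln (1 + of_real d' * \<omega>)) \<le> pi" using nz[OF w] by (simp add: Im_Ln_le_pi)
      ultimately have "Im (Ln (1 + of_real d' * \<omega>)) < 0" using Im_Ln_pos_le[OF nz[OF w]] by auto
      then show "Im (Complex x \<alpha> + Ln (1 + of_real d' * \<omega>)) < \<alpha>" by simp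
    qed (use bd[OF w] in auto)
  qed
qed

lemma ray_crossing:
  assumes x: "x < 0" and \<eta>: "0 < \<eta>" and c: "c = exp (Complex x \<alpha>)"
    and hol: "\<And>k::nat. f k holomorphic_on sector (\<alpha> - \<eta>) (\<alpha> + \<eta>)"
    and om: "\<And>k z. z \<in> sector (\<alpha> - \<eta>) \<alpha> \<union> sector \<alpha> (\<alpha> + \<eta>) \<Longrightarrow> f k z \<noteq> 0 \<and> f k z \<noteq> 1"
    and up: "loc_unif_limit (sector \<alpha> (\<alpha> + \<eta>)) f g" and lo: "loc_unif_limit (sector (\<alpha> - \<eta>) \<alpha>) f h"
  shows "\<exists>d l. 0 < d \<and> ball c d \<subseteq> sector (\<alpha> - \<eta>) (\<alpha> + \<eta>) \<and> l holomorphic_on ball c d \<and>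
     uniform_limit (ball c d) f l sequentially"
proof -
  obtain d where d: "0 < d" "\<And>\<omega>. \<omega> \<in> ball 0 1 \<Longrightarrow> c * (1 + of_real d * \<omega>) \<in> sector (\<alpha> - \<eta>) (\<alpha> + \<eta>)"
    "\<And>\<omega>. \<omega> \<in> ball 0 1 \<Longrightarrow> 0 < Im \<omega> \<Longrightarrow> c * (1 + of_real d * \<omega>) \<in> sector \<alpha> (\<alpha> + \<eta>)"
    "\<And>\<omega>. \<omega> \<in> ball 0 1 \<Longrightarrow> Im \<omega> < 0 \<Longrightarrow> c * (1 + of_real d * \<omega>) \<in> sector (\<alpha> - \<eta>) \<alpha>"
    using ray_chart[OF x \<eta> c] by blast
  define ch where "ch = (\<lambda>\<omega>. c * (1 + of_real d * \<omega>))"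
  have hchi: "ch holomorphic_on T" for T unfolding ch_def by (intro holomorphic_intros)
  then have cchi: "continuous_on T ch" for T by (rule holomorphic_on_imp_continuous_on)
  have "\<exists>r l. 0 < r \<and> r \<le> 1 \<and> l holomorphic_on ball 0 r \<and> uniform_limit (ball 0 r) (\<lambda>k \<omega>. f k (ch \<omega>)) l sequentially \<and>
     (\<forall>z\<in>ball 0 r. (0 < Im z \<longrightarrow> l z = g (ch z)) \<and> (Im z < 0 \<longrightarrow> l z = h (ch z)))"
  proof (rule line_convergence)
    show "(\<lambda>\<omega>. f k (ch \<omega>)) holomorphic_on ball 0 1" for k
      by (rule holomorphic_on_compose_gen[OF hchi hol, unfolded o_def]) (use d in \<open>auto simp: ch_def\<close>)
    show "f k (ch z) \<noteq> 0 \<and> f k (ch z) \<noteq> 1" if "z \<in> ball 0 1" "Im z \<noteq> 0" for k z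
      using om[of "ch z" k] d(3,4)[OF that(1)] that(2) unfolding ch_def by (cases "Im z > 0") auto
    show "loc_unif_limit (ball 0 1 \<inter> {z. 0 < Im z}) (\<lambda>k \<omega>. f k (ch \<omega>)) (\<lambda>z. g (ch z))"
      by (rule loc_unif_limit_compose[OF up cchi]) (use d in \<open>auto simp: ch_def\<close>)
    show "loc_unif_limit (ball 0 1 \<inter> {z. Im z < 0}) (\<lambda>k \<omega>. f k (ch \<omega>)) (\<lambda>z. h (ch z))"
      by (rule loc_unif_limit_compose[OF lo cchi]) (use d in \<open>auto simp: ch_def\<close>)
  qed
  then obtain r l where r: "0 < r" "r \<le> 1" "l holomorphic_on ball 0 r" 
      "uniform_limit (ball 0 r) (\<lambda>k \<omega>. f k (ch \<omega>)) l sequentially" by blast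
  define \<psi> where "\<psi> = (\<lambda>z. (z / c - 1) / of_real d)"
  have c0: "c \<noteq> 0" by (simp add: c)
  have chipsi: "ch (\<psi> z) = z" for z using d c0 by (simp add: ch_def \<psi>_def)
  define D where "D = norm c * d * r"
  have D: "D > 0" using c0 d r by (simp add: D_def)
  have psi: "\<psi> z \<in> ball 0 r" if "z \<in> ball c D" for z
  proof -
    have "z / c - 1 = (z - c) / c" using c0 by (simp add: field_simps)
    then have "norm (\<psi> z) = norm (z - c) / (norm c * d)" using d c0 by (simp add: \<psi>_def norm_divide norm_mult)
    moreover have "norm (z - c) < norm c * d * r" using that by (simp add: D_def dist_norm norm_minus_commute)
    ultimately show ?thesis using d c0 by (simp add: divide_less_eq mult.commute)
  qed
  show ?thesis
  proof (rule exI[of _ D], rule exI[of _ "\<lambda>z. l (\<psi> z)"], intro conjI D)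
    show "ball c D \<subseteq> sector (\<alpha> - \<eta>) (\<alpha> + \<eta>)"
    proof
      fix z assume z: "z \<in> ball c D"
      show "z \<in> sector (\<alpha> - \<eta>) (\<alpha> + \<eta>)"
        using d(2)[of "\<psi> z"] psi[OF z] r(2) chipsi[of z] by (auto simp: ch_def)
    qed
    show "(\<lambda>z. l (\<psi> z)) holomorphic_on ball c D"
      by (rule holomorphic_on_compose_gen[OF _ r(3), unfolded o_def])
         (use psi d c0 in \<open>auto simp: \<psi>_def intro!: holomorphic_intros\<close>)
    have "uniform_limit (ball c D) (\<lambda>k z. f k (ch (\<psi> z))) (\<lambda>z. l (\<psi> z)) sequentially"
      using r(4) psi by (fastforce simp: uniform_limit_iff elim!: eventually_mono)
    then show "uniform_limit (ball c D) f (\<lambda>z. l (\<psi> z)) sequentially" by (simp add: chipsi)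
  qed
qed

text \<open>The two one-sided limits are restrictions of a single holomorphic function, so they are constant together.\<close>

lemma ray_crossing_unique:
  assumes x: "x < 0" and \<eta>: "0 < \<eta>" and c: "c = exp (Complex x \<alpha>)"
    and hol: "\<And>k::nat. f k holomorphic_on sector (\<alpha> - \<eta>) (\<alpha> + \<eta>)"
    and om: "\<And>k z. z \<in> sector (\<alpha> - \<eta>) \<alpha> \<union> sector \<alpha> (\<alpha> + \<eta>) \<Longrightarrow> f k z \<noteq> 0 \<and> f k z \<noteq> 1"
    and up: "loc_unif_limit (sector \<alpha> (\<alpha> + \<eta>)) f g" and lo: "loc_unif_limit (sector (\<alpha> - \<eta>) \<alpha>) f h"
  shows "(\<forall>z\<in>sector \<alpha> (\<alpha> + \<eta>). g z = C) \<longleftrightarrow> (\<forall>z\<in>sector (\<alpha> - \<eta>) \<alpha>. h z = C)"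
proof -
  obtain d l where d: "0 < d" "ball c d \<subseteq> sector (\<alpha> - \<eta>) (\<alpha> + \<eta>)" "l holomorphic_on ball c d"
     "uniform_limit (ball c d) f l sequentially"
    using ray_crossing[OF assms] by blast
  have gh: "g holomorphic_on sector \<alpha> (\<alpha> + \<eta>)" "h holomorphic_on sector (\<alpha> - \<eta>) \<alpha>"
    using loc_unif_limit_holomorphic[OF open_sector _ up] loc_unif_limit_holomorphic[OF open_sector _ lo] \<eta>
      holomorphic_on_subset[OF hol] sector_mono[of "\<alpha>-\<eta>" \<alpha> "\<alpha>+\<eta>" "\<alpha>+\<eta>"] sector_mono[of "\<alpha>-\<eta>" "\<alpha>-\<eta>" \<alpha> "\<alpha>+\<eta>"]
    by auto
  have lg: "l z = g z" if "z \<in> ball c d" "z \<in> sector \<alpha> (\<alpha> + \<eta>)" for z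
    using tendsto_uniform_limitI[OF d(4) that(1)] loc_unif_limit_tendsto[OF up that(2)] by (rule LIMSEQ_unique)
  have lh: "l z = h z" if "z \<in> ball c d" "z \<in> sector (\<alpha> - \<eta>) \<alpha>" for z
    using tendsto_uniform_limitI[OF d(4) that(1)] loc_unif_limit_tendsto[OF lo that(2)] by (rule LIMSEQ_unique)
  have n1: "ball c d \<inter> sector \<alpha> (\<alpha> + \<eta>) \<noteq> {}" and n2: "ball c d \<inter> sector (\<alpha> - \<eta>) \<alpha> \<noteq> {}"
    by (rule ray_ball_meets_sector[OF x \<eta> c d(1)])+
  have key: "\<forall>z\<in>T. k z = C" if S: "open S" "S \<inter> ball c d \<noteq> {}" and T: "open T" "connected T" "T \<inter> ball c d \<noteq> {}"
    and lj: "\<And>z. z \<in> S \<inter> ball c d \<Longrightarrow> l z = j z" and lk: "\<And>z. z \<in> T \<inter> ball c d \<Longrightarrow> l z = k z"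
    and kh: "k holomorphic_on T" and jC: "\<forall>z\<in>S. j z = C" for S T j k
  proof -
    have lC0: "l z = C" if "z \<in> S \<inter> ball c d" for z
      using lj[OF that] jC that by simp
    have lC: "l z = C" if "z \<in> ball c d" for z
      by (rule analytic_continuation_open[of "S \<inter> ball c d" "ball c d" l "\<lambda>_. C"])
         (use S d lC0 that in \<open>simp_all add: open_Int\<close>)
    have kC: "k z = C" if "z \<in> T \<inter> ball c d" for z using lk[OF that] lC[of z] that by simp
    show ?thesis
    proof
      fix z assume z: "z \<in> T"
      show "k z = C"
        by (rule analytic_continuation_open[of "T \<inter> ball c d" T k "\<lambda>_. C"])
           (simp_all add: T kh kC z open_Int)
    qed
  qed
  show ?thesis
  proof
    assume "\<forall>z\<in>sector \<alpha> (\<alpha> + \<eta>). g z = C"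
    from key[OF open_sector _ open_sector connected_sector _ _ _ gh(2) this]
    show "\<forall>z\<in>sector (\<alpha> - \<eta>) \<alpha>. h z = C"
      using n1 n2 lg lh by (simp add: Int_commute)
  next
    assume "\<forall>z\<in>sector (\<alpha> - \<eta>) \<alpha>. h z = C"
    from key[OF open_sector _ open_sector connected_sector _ _ _ gh(1) this]
    show "\<forall>z\<in>sector \<alpha> (\<alpha> + \<eta>). g z = C"
      using n1 n2 lg lh by (simp add: Int_commute)
  qed
qed

lemma ray_crossing_const:
  assumes x: "x < 0" and \<eta>: "0 < \<eta>" and c: "c = exp (Complex x \<alpha>)"
    and hol: "\<And>k::nat. f k holomorphic_on sector (\<alpha> - \<eta>) (\<alpha> + \<eta>)"
    and om: "\<And>k z. z \<in> sector (\<alpha> - \<eta>) \<alpha> \<union> sector \<alpha> (\<alpha> + \<eta>) \<Longrightarrow> f k z \<noteq> 0 \<and> f k z \<noteq> 1"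
    and up: "loc_unif_limit (sector \<alpha> (\<alpha> + \<eta>)) f (\<lambda>z. C)" and lo: "loc_unif_limit (sector (\<alpha> - \<eta>) \<alpha>) f (\<lambda>z. C)"
  shows "\<exists>d>0. ball c d \<subseteq> sector (\<alpha> - \<eta>) (\<alpha> + \<eta>) \<and> uniform_limit (ball c d) f (\<lambda>z. C) sequentially"
proof -
  obtain d l where d: "0 < d" "ball c d \<subseteq> sector (\<alpha> - \<eta>) (\<alpha> + \<eta>)" "l holomorphic_on ball c d"
     "uniform_limit (ball c d) f l sequentially"
    using ray_crossing[OF assms] by blast
  let ?U = "ball c d \<inter> sector \<alpha> (\<alpha> + \<eta>)"
  have lC0: "l z = C" if "z \<in> ?U" for z
    using LIMSEQ_unique[OF tendsto_uniform_limitI[OF d(4)] loc_unif_limit_tendsto[OF up]] that by blast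
  have U: "open ?U" "?U \<noteq> {}" using ray_ball_meets_sector(1)[OF x \<eta> c d(1)] by (auto simp: open_sector)
  have "l z = C" if "z \<in> ball c d" for z
    by (rule analytic_continuation_open[OF U(1) open_ball U(2) connected_ball Int_lower1 d(3) _ lC0 that])
       (intro holomorphic_intros)
  then have "uniform_limit (ball c d) f (\<lambda>z. C) sequentially"
    using d(4) uniform_limit_cong'[of "ball c d" f f l "\<lambda>z. C" sequentially] by simp
  then show ?thesis using d by blast
qed

lemma ray_crossing_infinite:
  assumes x: "x < 0" and \<eta>: "0 < \<eta>" and c: "c = exp (Complex x \<alpha>)"
    and hol: "\<And>k::nat. f k holomorphic_on sector (\<alpha> - \<eta>) (\<alpha> + \<eta>)"
    and nz: "\<And>k z. z \<in> sector (\<alpha> - \<eta>) (\<alpha> + \<eta>) \<Longrightarrow> f k z \<noteq> 0"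
    and om: "\<And>k z. z \<in> sector (\<alpha> - \<eta>) \<alpha> \<union> sector \<alpha> (\<alpha> + \<eta>) \<Longrightarrow> f k z \<noteq> 1"
    and up: "loc_unif_infty (sector \<alpha> (\<alpha> + \<eta>)) f" and lo: "loc_unif_infty (sector (\<alpha> - \<eta>) \<alpha>) f"
  shows "\<exists>d>0. ball c d \<subseteq> sector (\<alpha> - \<eta>) (\<alpha> + \<eta>) \<and> (\<forall>M. \<forall>\<^sub>F k in sequentially. \<forall>z\<in>ball c d. M \<le> norm (f k z))"
proof -
  have sub: "sector \<alpha> (\<alpha> + \<eta>) \<subseteq> sector (\<alpha> - \<eta>) (\<alpha> + \<eta>)" "sector (\<alpha> - \<eta>) \<alpha> \<subseteq> sector (\<alpha> - \<eta>) (\<alpha> + \<eta>)"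
    using \<eta> by (intro sector_mono; simp)+
  have "\<exists>d>0. ball c d \<subseteq> sector (\<alpha> - \<eta>) (\<alpha> + \<eta>) \<and> uniform_limit (ball c d) (\<lambda>k z. inverse (f k z)) (\<lambda>z. 0) sequentially"
  proof (rule ray_crossing_const[OF x \<eta> c])
    show "(\<lambda>z. inverse (f k z)) holomorphic_on sector (\<alpha> - \<eta>) (\<alpha> + \<eta>)" for k
      by (intro holomorphic_intros hol nz)
    show "inverse (f k z) \<noteq> 0 \<and> inverse (f k z) \<noteq> 1" if "z \<in> sector (\<alpha> - \<eta>) \<alpha> \<union> sector \<alpha> (\<alpha> + \<eta>)" for k z
      using nz[of z k] om[OF that, of k] that sub by (auto simp: inverse_eq_1_iff)
    show "loc_unif_limit (sector \<alpha> (\<alpha> + \<eta>)) (\<lambda>k z. inverse (f k z)) (\<lambda>z. 0)"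
      using up loc_unif_infty_iff_inverse[of "sector \<alpha> (\<alpha> + \<eta>)" f] nz sub by blast
    show "loc_unif_limit (sector (\<alpha> - \<eta>) \<alpha>) (\<lambda>k z. inverse (f k z)) (\<lambda>z. 0)"
      using lo loc_unif_infty_iff_inverse[of "sector (\<alpha> - \<eta>) \<alpha>" f] nz sub by blast
  qed
  then obtain d where d: "0 < d" "ball c d \<subseteq> sector (\<alpha> - \<eta>) (\<alpha> + \<eta>)" 
    "uniform_limit (ball c d) (\<lambda>k z. inverse (f k z)) (\<lambda>z. 0) sequentially" by blast
  moreover have "\<And>k z. z \<in> ball c d \<Longrightarrow> f k z \<noteq> 0" using nz d(2) by blast
  ultimately show ?thesis using uniform_limit_inverse_zero_iff[of "ball c d" f] by blast
qed

text \<open>If \<open>g\<close> had no zeros, \<open>1 / f\<close> would have the finite limits \<open>1 / g\<close> and \<open>0\<close> on the two sides of the ray,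
although these limits continue each other. By Hurwitz's theorem \<open>g\<close> vanishes identically otherwise.\<close>

lemma ray_crossing_mixed:
  assumes \<eta>: "0 < \<eta>"
    and hol: "\<And>k::nat. f k holomorphic_on sector (\<alpha> - \<eta>) (\<alpha> + \<eta>)"
    and nz: "\<And>k z. z \<in> sector (\<alpha> - \<eta>) (\<alpha> + \<eta>) \<Longrightarrow> f k z \<noteq> 0"
    and om: "\<And>k z. z \<in> sector (\<alpha> - \<eta>) \<alpha> \<union> sector \<alpha> (\<alpha> + \<eta>) \<Longrightarrow> f k z \<noteq> 1"
    and UV: "(U = sector \<alpha> (\<alpha> + \<eta>) \<and> V = sector (\<alpha> - \<eta>) \<alpha>) \<or> (V = sector \<alpha> (\<alpha> + \<eta>) \<and> U = sector (\<alpha> - \<eta>) \<alpha>)"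
    and U: "loc_unif_limit U f g" and V: "loc_unif_infty V f"
  shows "\<forall>z\<in>U. g z = 0"
proof (rule ccontr)
  assume nonzero: "\<not> (\<forall>z\<in>U. g z = 0)"
  have sub: "U \<subseteq> sector (\<alpha> - \<eta>) (\<alpha> + \<eta>)" "V \<subseteq> sector (\<alpha> - \<eta>) (\<alpha> + \<eta>)"
    using UV \<eta> sector_mono[of "\<alpha> - \<eta>" \<alpha> "\<alpha> + \<eta>" "\<alpha> + \<eta>"] sector_mono[of "\<alpha> - \<eta>" "\<alpha> - \<eta>" \<alpha> "\<alpha> + \<eta>"] by auto
  have Uo: "open U" "connected U" "U \<noteq> {}" 
    using UV \<eta> sector_nonempty[of \<alpha> "\<alpha> + \<eta>"] sector_nonempty[of "\<alpha> - \<eta>" \<alpha>]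
    by (elim disjE conjE; simp add: open_sector connected_sector)+
  have fU: "f k holomorphic_on U" for k using hol sub(1) by (rule holomorphic_on_subset)
  have "(\<forall>z\<in>U. g z \<noteq> 0) \<or> (\<forall>z\<in>U. g z = 0)"
    by (rule loc_unif_limit_nonvanishing_limit[OF Uo(1,2) fU U]) (use nz sub in blast)
  then have gnz: "\<And>z. z \<in> U \<Longrightarrow> g z \<noteq> 0" using nonzero by blast
  have gc: "continuous_on U g" using loc_unif_limit_holomorphic[OF Uo(1) fU U] by (rule holomorphic_on_imp_continuous_on)
  have iU: "loc_unif_limit U (\<lambda>k z. inverse (f k z)) (\<lambda>z. inverse (g z))" using U gc gnz by (rule loc_unif_limit_inverse)
  have iV: "loc_unif_limit V (\<lambda>k z. inverse (f k z)) (\<lambda>z. 0)" using V loc_unif_infty_iff_inverse[of V f] nz sub by blast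
  have ihol: "(\<lambda>z. inverse (f k z)) holomorphic_on sector (\<alpha> - \<eta>) (\<alpha> + \<eta>)" for k
    by (intro holomorphic_intros hol nz)
  have iom: "inverse (f k z) \<noteq> 0 \<and> inverse (f k z) \<noteq> 1" if "z \<in> sector (\<alpha> - \<eta>) \<alpha> \<union> sector \<alpha> (\<alpha> + \<eta>)" for k z
    using nz[of z k] om[OF that, of k] that sub UV by (auto simp: inverse_eq_1_iff)
  have m: "(-1::real) < 0" by simp
  have "\<forall>z\<in>U. inverse (g z) = 0"
    using UV
  proof (elim disjE conjE)
    assume eq: "U = sector \<alpha> (\<alpha> + \<eta>)" "V = sector (\<alpha> - \<eta>) \<alpha>"
    show ?thesis unfolding eq(1)
      using ray_crossing_unique[OF m \<eta> refl ihol iom iU[unfolded eq(1)] iV[unfolded eq(2)], of 0] by simp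
  next
    assume eq: "V = sector \<alpha> (\<alpha> + \<eta>)" "U = sector (\<alpha> - \<eta>) \<alpha>"
    show ?thesis unfolding eq(2)
      using ray_crossing_unique[OF m \<eta> refl ihol iom iV[unfolded eq(1)] iU[unfolded eq(2)], of 0] by simp
  qed
  then show False using gnz Uo(3) by fastforce
qed

text \<open>All that can happen at a ray near which the functions have no zeros. For a ray without \<open>1\<close>-points the
statement is applied to \<open>1 - f\<close>.\<close>

lemma zero_free_ray_alternatives:
  assumes ab: "a < \<alpha>" "\<alpha> < b"
    and hol: "\<And>k::nat. f k holomorphic_on sector a b"
    and nz: "\<And>k z. z \<in> sector a b \<Longrightarrow> f k z \<noteq> 0"
    and om: "\<And>k z. z \<in> sector a \<alpha> \<union> sector \<alpha> b \<Longrightarrow> f k z \<noteq> 1"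
    and B: "(\<exists>g. loc_unif_limit (sector a \<alpha>) f g) \<or> loc_unif_infty (sector a \<alpha>) f"
    and C: "(\<exists>g. loc_unif_limit (sector \<alpha> b) f g) \<or> loc_unif_infty (sector \<alpha> b) f"
  shows "((\<exists>g. loc_unif_limit (sector a \<alpha>) f g) \<and> (\<exists>g. loc_unif_limit (sector \<alpha> b) f g) \<and>
           (loc_unif_limit (sector a \<alpha>) f (\<lambda>z. 0) \<longleftrightarrow> loc_unif_limit (sector \<alpha> b) f (\<lambda>z. 0)) \<and>
           (\<forall>x<0. locally_convergent_at f (exp (Complex x \<alpha>)))) \<or>
         (loc_unif_infty (sector a \<alpha>) f \<and> loc_unif_infty (sector \<alpha> b) f \<and>
           (\<forall>x<0. \<exists>d>0. ball (exp (Complex x \<alpha>)) d \<subseteq> sector a b \<and>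
               (\<forall>M. \<forall>\<^sub>F k in sequentially. \<forall>z\<in>ball (exp (Complex x \<alpha>)) d. M \<le> norm (f k z)))) \<or>
         (loc_unif_limit (sector a \<alpha>) f (\<lambda>z. 0) \<and> loc_unif_infty (sector \<alpha> b) f) \<or>
         (loc_unif_infty (sector a \<alpha>) f \<and> loc_unif_limit (sector \<alpha> b) f (\<lambda>z. 0))"
proof -
  define \<eta> where "\<eta> = min (\<alpha> - a) (b - \<alpha>)"
  have \<eta>: "0 < \<eta>" using ab by (simp add: \<eta>_def)
  have s1: "sector \<alpha> (\<alpha> + \<eta>) \<subseteq> sector \<alpha> b" and s2: "sector (\<alpha> - \<eta>) \<alpha> \<subseteq> sector a \<alpha>"
    and s3: "sector (\<alpha> - \<eta>) (\<alpha> + \<eta>) \<subseteq> sector a b"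
    by (rule sector_mono; simp add: \<eta>_def min_def)+
  have s4: "sector a \<alpha> \<subseteq> sector a b" "sector \<alpha> b \<subseteq> sector a b" using ab by (intro sector_mono; simp)+
  have hol': "f k holomorphic_on sector (\<alpha> - \<eta>) (\<alpha> + \<eta>)" for k using hol s3 by (rule holomorphic_on_subset)
  have nz': "f k z \<noteq> 0" if "z \<in> sector (\<alpha> - \<eta>) (\<alpha> + \<eta>)" for k z using nz that s3 by blast
  have om': "f k z \<noteq> 1" if "z \<in> sector (\<alpha> - \<eta>) \<alpha> \<union> sector \<alpha> (\<alpha> + \<eta>)" for k z using om that s1 s2 by blast
  have omm: "f k z \<noteq> 0 \<and> f k z \<noteq> 1" if "z \<in> sector (\<alpha> - \<eta>) \<alpha> \<union> sector \<alpha> (\<alpha> + \<eta>)" for k z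
    using om'[OF that] nz[of z k] that s1 s2 s4 by blast
  have ext: "loc_unif_limit (sector c e) f (\<lambda>z. 0)"
    if e1: "loc_unif_limit (sector c e) f g" and e2: "\<forall>z\<in>sector c' e'. g z = 0" and e3: "sector c' e' \<subseteq> sector c e"
      and e4: "c' < e'" and e5: "sector c e \<subseteq> sector a b" for c e c' e' g
  proof -
    have gh: "g holomorphic_on sector c e"
      by (rule loc_unif_limit_holomorphic[OF open_sector _ e1]) (rule holomorphic_on_subset[OF hol e5])
    have "g z = 0" if z: "z \<in> sector c e" for z
      by (rule analytic_continuation_open[OF open_sector open_sector sector_nonempty[OF e4] connected_sector e3 gh _ _ z])
         (use e2 in \<open>auto intro!: holomorphic_intros\<close>)
    then show ?thesis using loc_unif_limit_cong[OF e1] by simp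
  qed
  show ?thesis
  proof (cases "loc_unif_infty (sector a \<alpha>) f")
    case infB: True
    show ?thesis
    proof (cases "loc_unif_infty (sector \<alpha> b) f")
      case infC: True
      have "\<exists>d>0. ball (exp (Complex x \<alpha>)) d \<subseteq> sector a b \<and>
               (\<forall>M. \<forall>\<^sub>F k in sequentially. \<forall>z\<in>ball (exp (Complex x \<alpha>)) d. M \<le> norm (f k z))" if x: "x < 0" for x
        using ray_crossing_infinite[OF x \<eta> refl hol' nz' om' loc_unif_infty_subset[OF infC s1] loc_unif_infty_subset[OF infB s2]] s3 by blast
      then show ?thesis using infB infC by blast
    next
      case False
      then obtain g where g: "loc_unif_limit (sector \<alpha> b) f g" using C by blast
      have "\<forall>z\<in>sector \<alpha> (\<alpha> + \<eta>). g z = 0"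
        by (rule ray_crossing_mixed[OF \<eta> hol' nz' om' _ loc_unif_limit_subset[OF g s1] loc_unif_infty_subset[OF infB s2]]) simp_all
      then have "loc_unif_limit (sector \<alpha> b) f (\<lambda>z. 0)" by (rule ext[OF g _ s1 _ s4(2)]) (use \<eta> in simp)
      then show ?thesis using infB by blast
    qed
  next
    case False
    then obtain g where g: "loc_unif_limit (sector a \<alpha>) f g" using B by blast
    show ?thesis
    proof (cases "loc_unif_infty (sector \<alpha> b) f")
      case infC: True
      have "\<forall>z\<in>sector (\<alpha> - \<eta>) \<alpha>. g z = 0"
        by (rule ray_crossing_mixed[OF \<eta> hol' nz' om' _ loc_unif_limit_subset[OF g s2] loc_unif_infty_subset[OF infC s1]]) simp_all
      then have "loc_unif_limit (sector a \<alpha>) f (\<lambda>z. 0)" by (rule ext[OF g _ s2 _ s4(1)]) (use \<eta> in simp)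
      then show ?thesis using infC by blast
    next
      case False
      then obtain g' where g': "loc_unif_limit (sector \<alpha> b) f g'" using C by blast
      note lu = loc_unif_limit_subset[OF g' s1] and ll = loc_unif_limit_subset[OF g s2]
      have "locally_convergent_at f (exp (Complex x \<alpha>))" if x: "x < 0" for x
        using ray_crossing[OF x \<eta> refl hol' omm lu ll] unfolding locally_convergent_at_def by blast
      moreover have "loc_unif_limit (sector a \<alpha>) f (\<lambda>z. 0) \<longleftrightarrow> loc_unif_limit (sector \<alpha> b) f (\<lambda>z. 0)"
      proof -
        have m: "(-1::real) < 0" by simp
        have iff: "(\<forall>z\<in>sector \<alpha> (\<alpha> + \<eta>). g' z = 0) \<longleftrightarrow> (\<forall>z\<in>sector (\<alpha> - \<eta>) \<alpha>. g z = 0)"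
          by (rule ray_crossing_unique[OF m \<eta> refl hol' omm lu ll])
        show ?thesis
        proof
          assume "loc_unif_limit (sector a \<alpha>) f (\<lambda>z. 0)"
          then have "\<forall>z\<in>sector (\<alpha> - \<eta>) \<alpha>. g z = 0" using loc_unif_limit_unique[OF g] s2 by blast
          then show "loc_unif_limit (sector \<alpha> b) f (\<lambda>z. 0)" using iff ext[OF g' _ s1 _ s4(2)] \<eta> by simp
        next
          assume "loc_unif_limit (sector \<alpha> b) f (\<lambda>z. 0)"
          then have "\<forall>z\<in>sector \<alpha> (\<alpha> + \<eta>). g' z = 0" using loc_unif_limit_unique[OF g'] s1 by blast
          then show "loc_unif_limit (sector a \<alpha>) f (\<lambda>z. 0)" using iff ext[OF g _ s2 _ s4(1)] \<eta> by simp
        qed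
      qed
      ultimately show ?thesis using g g' by blast
    qed
  qed
qed

section \<open>Functions preserving the half-planes near an isolated singularity\<close>

text \<open>If the order of \<open>f - f x\<close> at \<open>x\<close> were \<open>n \<ge> 2\<close>, then \<open>Im f\<close> would change its sign within the upper half-disc.\<close>

lemma simple_zero_of_half_plane_map:
  assumes r: "0 < r" and x: "Im x = 0" and hol: "f holomorphic_on ball x r" and fx: "Im (f x) = 0"
    and up: "\<And>z. z \<in> ball x r \<Longrightarrow> 0 < Im z \<Longrightarrow> 0 < Im (f z)"
    and lo: "\<And>z. z \<in> ball x r \<Longrightarrow> Im z < 0 \<Longrightarrow> Im (f z) < 0"
  shows "\<exists>a>0. deriv f x = of_real a"
proof -
  have nc: "\<not> (\<lambda>z. f z - f x) constant_on ball x r"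
  proof
    assume "(\<lambda>z. f z - f x) constant_on ball x r"
    then obtain C where C: "\<And>z. z \<in> ball x r \<Longrightarrow> f z - f x = C" by (auto simp: constant_on_def)
    have "x + \<i> * of_real (r/2) \<in> ball x r" using r by (simp add: dist_norm norm_mult)
    moreover have "x \<in> ball x r" using r by simp
    ultimately have "f (x + \<i> * of_real (r/2)) = f x" using C[of x] C[of "x + \<i> * of_real (r/2)"] by simp
    then show False using up[of "x + \<i> * of_real (r/2)"] \<open>x + \<i> * of_real (r/2) \<in> ball x r\<close> x r fx by simp
  qed
  have "(\<lambda>z. f z - f x) holomorphic_on ball x r" using hol by (intro holomorphic_intros)
  moreover have "x \<in> ball x r" "f x - f x = 0" using r by auto
  ultimately obtain g s n where n: "0 < n" and s: "0 < s" "ball x s \<subseteq> ball x r" and g: "g holomorphic_on ball x s"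
     and fac: "\<And>w. w \<in> ball x s \<Longrightarrow> f w - f x = (w - x)^n * g w" and gnz: "\<And>w. w \<in> ball x s \<Longrightarrow> g w \<noteq> 0"
    by (rule holomorphic_factor_zero_nonconstant[OF _ open_ball connected_ball _ _ nc]) (rule that)
  have gcont: "isCont g x"
    using holomorphic_on_imp_continuous_on[OF g] s by (simp add: continuous_on_eq_continuous_at)
  have dir: "(0 < Im u \<longrightarrow> 0 \<le> Im (u^n * g x)) \<and> (Im u < 0 \<longrightarrow> Im (u^n * g x) \<le> 0)" if u: "norm u = 1" for u
  proof -
    have "((\<lambda>t. x + of_real t * u) \<longlongrightarrow> x + of_real 0 * u) (at_right 0)" by (intro tendsto_intros)
    then have "((\<lambda>t. x + of_real t * u) \<longlongrightarrow> x) (at_right 0)" by simp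
    then have "((\<lambda>t. g (x + of_real t * u)) \<longlongrightarrow> g x) (at_right 0)"
      by (rule isCont_tendsto_compose[OF gcont])
    then have lim: "((\<lambda>t. Im (u^n * g (x + of_real t * u))) \<longlongrightarrow> Im (u^n * g x)) (at_right 0)"
      by (intro tendsto_intros)
    have ev: "\<forall>\<^sub>F t in at_right (0::real). t \<in> {0<..<s}" by (rule eventually_at_right_real[OF s(1)])
    have eq: "Im (u^n * g (x + of_real t * u)) = Im (f (x + of_real t * u)) / t^n \<and> x + of_real t * u \<in> ball x r" if "t \<in> {0<..<s}" for t
    proof -
      have b: "x + of_real t * u \<in> ball x s" using that u by (simp add: dist_norm norm_mult)
      have "f (x + of_real t * u) - f x = of_real (t^n) * (u^n * g (x + of_real t * u))"
        using fac[OF b] by (simp add: power_mult_distrib)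
      then have "Im (f (x + of_real t * u) - f x) = t^n * Im (u^n * g (x + of_real t * u))"
        by (simp only: times_complex.sel Re_complex_of_real Im_complex_of_real)
      then show ?thesis using fx that b s(2) by auto
    qed
    show ?thesis
    proof (intro conjI impI)
      assume "0 < Im u"
      then have "\<forall>\<^sub>F t in at_right 0. 0 \<le> Im (u^n * g (x + of_real t * u))"
        using ev by (elim eventually_mono) (use eq up x in \<open>auto intro!: divide_nonneg_pos less_imp_le\<close>)
      then show "0 \<le> Im (u^n * g x)" using lim by (intro tendsto_lowerbound) auto
    next
      assume i: "Im u < 0"
      have "\<forall>\<^sub>F t in at_right 0. Im (u^n * g (x + of_real t * u)) \<le> 0"
        using ev
      proof eventually_elim
        case (elim t)
        then have "Im (f (x + of_real t * u)) < 0"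
          using eq[OF elim] i x by (intro lo) (auto simp: mult_less_0_iff)
        then show ?case using eq[OF elim] elim by (auto simp: divide_le_0_iff)
      qed
      then show "Im (u^n * g x) \<le> 0" using lim by (intro tendsto_upperbound) auto
    qed
  qed
  define P where "P = (\<lambda>\<phi>::real. Im (cis (of_nat n * \<phi>) * g x))"
  have P1: "0 \<le> P \<phi>" if "0 < \<phi>" "\<phi> < pi" for \<phi>
    using dir[of "cis \<phi>"] that by (simp add: P_def Complex.DeMoivre sin_gt_zero)
  have P2: "P \<phi> \<le> 0" if "- pi < \<phi>" "\<phi> < 0" for \<phi>
    using dir[of "cis \<phi>"] that sin_gt_zero[of "-\<phi>"] by (simp add: P_def Complex.DeMoivre)
  have Pl: "(P \<longlongrightarrow> P 0) (at_right 0)" "(P \<longlongrightarrow> P 0) (at_left 0)"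
  proof -
    have "P = (\<lambda>\<phi>. cos (real n * \<phi>) * Im (g x) + sin (real n * \<phi>) * Re (g x))"
      by (simp add: P_def fun_eq_iff)
    then have "isCont P 0" by (simp only:) (intro continuous_intros)
    then show "(P \<longlongrightarrow> P 0) (at_right 0)" "(P \<longlongrightarrow> P 0) (at_left 0)"
      by (auto simp: isCont_def filterlim_at_split)
  qed
  have "0 \<le> P 0"
    by (rule tendsto_lowerbound[OF Pl(1)])
       (use eventually_at_right_real[OF pi_gt_zero] in \<open>auto elim!: eventually_mono intro: P1\<close>)
  moreover have "P 0 \<le> 0"
    by (rule tendsto_upperbound[OF Pl(2)])
       (use eventually_at_left_real[of "-pi" 0] in \<open>auto elim!: eventually_mono intro: P2\<close>)
  ultimately have img: "Im (g x) = 0" by (simp add: P_def)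
  define \<gamma> where "\<gamma> = Re (g x)"
  have gx: "g x = of_real \<gamma>" using img by (simp add: \<gamma>_def complex_eq_iff)
  have g0: "\<gamma> \<noteq> 0" using gnz[of x] s gx by auto
  have Ps: "P \<phi> = \<gamma> * sin (of_nat n * \<phi>)" for \<phi> by (simp add: P_def gx)
  have "\<gamma> > 0"
  proof -
    have "0 < pi / (2 * real n)" "pi / (2 * real n) < pi" using n by (auto simp: field_simps)
    then have "0 \<le> \<gamma> * sin (real n * (pi / (2 * real n)))" using P1 Ps by metis
    moreover have "real n * (pi / (2 * real n)) = pi/2" using n by simp
    ultimately have "0 \<le> \<gamma> * sin (pi / 2)" by (simp only:)
    then show ?thesis using g0 by simp
  qed
  have "n = 1"
  proof (rule ccontr)
    assume "n \<noteq> 1"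
    then have n2: "n \<ge> 2" using n by auto
    have "3 * pi / (2 * real n) \<le> 3 * pi / (2 * 2)" using n2 by (intro divide_left_mono) auto
    then have "3 * pi / (2 * real n) < pi" by (rule order_le_less_trans) simp
    moreover have "0 < 3 * pi / (2 * real n)" using n by simp
    ultimately have "0 \<le> \<gamma> * sin (real n * (3 * pi / (2 * real n)))" using P1 Ps by metis
    moreover have "real n * (3 * pi / (2 * real n)) = 3/2 * pi" using n by simp
    ultimately have "0 \<le> \<gamma> * sin (3/2 * pi)" by (simp only:)
    moreover have "sin (3/2 * pi) = -1" using sin_3over2_pi by simp
    ultimately show False using \<open>\<gamma> > 0\<close> by simp
  qed
  have "((\<lambda>w. f x + (w - x) * g w) has_field_derivative g x) (at x)"
  proof -
    have "(g has_field_derivative deriv g x) (at x)" using g s by (intro holomorphic_derivI[where S="ball x s"]) auto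
    then show ?thesis by (auto intro!: derivative_eq_intros)
  qed
  then have "(f has_field_derivative g x) (at x)"
  proof (rule has_field_derivative_transform_within_open[where S = "ball x s"])
    fix w assume "w \<in> ball x s"
    from fac[OF this] \<open>n = 1\<close> have "f w - f x = (w - x) * g w" by simp
    then show "f x + (w - x) * g w = f w" by (metis add.commute diff_add_cancel)
  qed (use s in auto)
  then have "deriv f x = of_real \<gamma>" using gx DERIV_imp_deriv by metis
  then show ?thesis using \<open>\<gamma> > 0\<close> by blast
qed

text \<open>By the preceding lemma \<open>F\<close> is strictly increasing on each half of the real diameter, and it is real
only there. So it takes every real value at most twice, and \<open>0\<close> is no essential singularity by Picard's theorem. A
finite limit at \<open>0\<close> is again covered by the preceding lemma; if \<open>F\<close> tends to \<open>\<infinity>\<close>, that lemma is applied to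
\<open>- 1 / F\<close>, which preserves the half-planes as well.\<close>

lemma half_plane_map_isolated_singularity:
  assumes hol: "F holomorphic_on ball 0 1 - {0}"
    and up: "\<And>z. z \<in> ball 0 1 - {0} \<Longrightarrow> 0 < Im z \<Longrightarrow> 0 < Im (F z)"
    and lo: "\<And>z. z \<in> ball 0 1 - {0} \<Longrightarrow> Im z < 0 \<Longrightarrow> Im (F z) < 0"
    and re: "\<And>z. z \<in> ball 0 1 - {0} \<Longrightarrow> Im z = 0 \<Longrightarrow> Im (F z) = 0"
  shows "\<exists>a>0. (deriv F \<longlongrightarrow> of_real a) (at 0) \<or> ((\<lambda>z. z^2 * deriv F z) \<longlongrightarrow> of_real a) (at 0)"
proof -
  have opn: "open (ball 0 1 - {0::complex})" by auto
  have derivF: "(F has_field_derivative deriv F z) (at z)" if "z \<in> ball 0 1 - {0}" for z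
    using hol opn that by (rule holomorphic_derivI)
  have pos: "\<exists>a>0. deriv F (of_real t) = of_real a" if "t \<noteq> 0" "\<bar>t\<bar> < 1" for t
  proof -
    have sub: "ball (of_real t) (min \<bar>t\<bar> (1 - \<bar>t\<bar>)) \<subseteq> ball 0 1 - {0::complex}"
    proof
      fix z :: complex assume "z \<in> ball (of_real t) (min \<bar>t\<bar> (1 - \<bar>t\<bar>))"
      then have z: "norm (of_real t - z) < \<bar>t\<bar>" "norm (of_real t - z) < 1 - \<bar>t\<bar>" by (auto simp: dist_norm)
      have "norm z \<le> norm (of_real t - z) + norm (of_real t :: complex)"
        by (metis add.commute norm_minus_commute norm_triangle_sub)
      then show "z \<in> ball 0 1 - {0}" using z by auto
    qed
    show ?thesis
    proof (rule simple_zero_of_half_plane_map[where r = "min \<bar>t\<bar> (1 - \<bar>t\<bar>)"])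
      show "F holomorphic_on ball (of_real t) (min \<bar>t\<bar> (1 - \<bar>t\<bar>))" using hol sub by (rule holomorphic_on_subset)
      show "Im (F (of_real t)) = 0" using that by (intro re) auto
      show "0 < Im (F z)" if "z \<in> ball (of_real t) (min \<bar>t\<bar> (1 - \<bar>t\<bar>))" "0 < Im z" for z
        using that sub by (intro up) blast+
      show "Im (F z) < 0" if "z \<in> ball (of_real t) (min \<bar>t\<bar> (1 - \<bar>t\<bar>))" "Im z < 0" for z
        using that sub by (intro lo) blast+
    qed (use that in auto)
  qed
  define \<phi> where "\<phi> = (\<lambda>t. Re (F (of_real t)))"
  have dphi: "\<exists>y. (\<phi> has_real_derivative y) (at t) \<and> 0 < y" if t: "t \<noteq> 0" "\<bar>t\<bar> < 1" for t
  proof -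
    obtain a where a: "a > 0" "deriv F (of_real t) = of_real a" using pos[OF t] by blast
    have "(F has_field_derivative of_real a) (at (of_real t))" using derivF[of "of_real t"] a t by auto
    moreover have "(of_real has_vector_derivative (1::complex)) (at t)"
      unfolding has_vector_derivative_def scaleR_conv_of_real mult_1_right
      by (rule bounded_linear_imp_has_derivative[OF bounded_linear_of_real])
    ultimately have "((F \<circ> of_real) has_vector_derivative (1 * of_real a)) (at t)"
      by (intro field_vector_diff_chain_at)
    then have "((\<lambda>x. F (of_real x)) has_vector_derivative of_real a) (at t)" by (simp add: o_def)
    then have "((\<lambda>x. F (of_real x)) has_derivative (\<lambda>h. h *\<^sub>R of_real a)) (at t)"
      by (simp add: has_vector_derivative_def)
    then have "(\<phi> has_derivative (\<lambda>h. Re (h *\<^sub>R of_real a))) (at t)"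
      unfolding \<phi>_def by (rule has_derivative_Re)
    then have "(\<phi> has_real_derivative a) (at t)" by (simp add: has_field_derivative_def mult_commute_abs)
    then show ?thesis using a by blast
  qed
  have mono: "\<phi> s < \<phi> t" if "s < t" "\<bar>s\<bar> < 1" "\<bar>t\<bar> < 1" "0 < s \<or> t < 0" for s t
  proof (rule DERIV_pos_imp_increasing[OF that(1)])
    fix y assume "s \<le> y" "y \<le> t"
    then have "y \<noteq> 0" "\<bar>y\<bar> < 1" using that by auto
    then show "\<exists>z. (\<phi> has_real_derivative z) (at y) \<and> 0 < z" by (rule dphi)
  qed
  have fin: "finite {z. z \<in> ball 0 1 - {0} \<and> F z = of_real v}" for v
  proof -
    let ?A = "{t. 0 < t \<and> t < 1 \<and> \<phi> t = v}" and ?B = "{t. -1 < t \<and> t < 0 \<and> \<phi> t = v}"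
    have ne: "\<phi> s \<noteq> \<phi> t" if "s < t" "\<bar>s\<bar> < 1" "\<bar>t\<bar> < 1" "0 < s \<or> t < 0" for s t
      using mono[OF that] by simp
    have "inj_on \<phi> {t. 0 < t \<and> t < 1}" "inj_on \<phi> {t. -1 < t \<and> t < 0}"
      by (rule linorder_inj_onI'; rule ne; simp)+
    then have "finite (\<phi> -` {v} \<inter> {t. 0 < t \<and> t < 1})" "finite (\<phi> -` {v} \<inter> {t. -1 < t \<and> t < 0})"
      by (auto intro: finite_vimage_IntI)
    moreover have "?A = \<phi> -` {v} \<inter> {t. 0 < t \<and> t < 1}" "?B = \<phi> -` {v} \<inter> {t. -1 < t \<and> t < 0}" by auto
    ultimately have "finite ?A" "finite ?B" by simp_all
    moreover have "{z. z \<in> ball 0 1 - {0} \<and> F z = of_real v} \<subseteq> of_real ` (?A \<union> ?B)"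
    proof
      fix z assume "z \<in> {z. z \<in> ball 0 1 - {0} \<and> F z = of_real v}"
      then have z: "z \<in> ball 0 1 - {0}" "F z = of_real v" by auto
      have "Im z = 0" using up[OF z(1)] lo[OF z(1)] z(2) by (cases "Im z" "0::real" rule: linorder_cases) auto
      then have zr: "z = of_real (Re z)" by (simp add: complex_eq_iff)
      have "\<bar>Re z\<bar> < 1" using z(1) abs_Re_le_cmod[of z] by simp
      moreover have "Re z \<noteq> 0" using z(1) zr by auto
      moreover have "\<phi> (Re z) = v" using z(2) zr by (simp add: \<phi>_def)
      ultimately have "Re z \<in> ?A \<union> ?B" by auto
      then show "z \<in> of_real ` (?A \<union> ?B)" using zr by blast
    qed
    ultimately show ?thesis by (meson finite_UnI finite_imageI finite_subset)
  qed
  have "(\<exists>l. F \<midarrow>0\<rightarrow> l) \<or> (\<exists>l. (inverse \<circ> F) \<midarrow>0\<rightarrow> l)"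
  proof (rule ccontr)
    assume "\<not> ?thesis"
    then obtain a where a: "\<And>w. w \<noteq> a \<Longrightarrow> infinite {x. x \<in> ball 0 1 - {0} \<and> F x = w}"
      using great_Picard_infinite[of "ball 0 1" 0 F] hol by auto
    have "of_real (0::real) \<noteq> a \<or> of_real (1::real) \<noteq> a" by auto
    then show False using a fin by metis
  qed
  then have "(\<exists>l. F \<midarrow>0\<rightarrow> l) \<or> (inverse \<circ> F) \<midarrow>0\<rightarrow> 0"
  proof (elim disjE exE)
    fix l assume l: "(inverse \<circ> F) \<midarrow>0\<rightarrow> l"
    show ?thesis
    proof (cases "l = 0")
      case False
      have "(\<lambda>z. inverse ((inverse \<circ> F) z)) \<midarrow>0\<rightarrow> inverse l" using l False by (rule tendsto_inverse)
      then show ?thesis by (auto simp: o_def)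
    qed (use l in auto)
  qed auto
  then show ?thesis
  proof (elim disjE exE)
    fix l assume l: "F \<midarrow>0\<rightarrow> l"
    define G where "G = (\<lambda>z. if z = 0 then l else F z)"
    have G: "G holomorphic_on ball 0 1" unfolding G_def by (rule removable_singularity[OF hol _ l]) auto
    have Iml: "((\<lambda>t. Im (F (of_real t))) \<longlongrightarrow> Im l) (at 0)"
    proof -
      have "filterlim (\<lambda>t::real. of_real t :: complex) (at 0) (at 0)"
        by (auto simp: filterlim_at eventually_at_filter intro!: tendsto_eq_intros)
      then show ?thesis by (intro tendsto_Im filterlim_compose[OF l])
    qed
    have ev: "\<forall>\<^sub>F t in at (0::real). Im (F (of_real t)) = 0"
      unfolding eventually_at by (intro exI[of _ 1]) (auto intro!: re)
    have "Im l = 0"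
      using tendsto_unique[OF _ Iml tendsto_eventually[OF ev]] by simp
    have "\<exists>a>0. deriv G 0 = of_real a"
    proof (rule simple_zero_of_half_plane_map[of 1])
      show "0 < Im (G z)" if "z \<in> ball 0 1" "0 < Im z" for z
        using up[of z] that by (auto simp: G_def)
      show "Im (G z) < 0" if "z \<in> ball 0 1" "Im z < 0" for z
        using lo[of z] that by (auto simp: G_def)
    qed (use G \<open>Im l = 0\<close> in \<open>auto simp: G_def\<close>)
    then obtain a where a: "a > 0" "deriv G 0 = of_real a" by blast
    have "deriv G holomorphic_on ball 0 1" using G by (intro holomorphic_deriv) auto
    then have "isCont (deriv G) 0"
      using holomorphic_on_imp_continuous_on continuous_on_eq_continuous_at[of "ball 0 1" "deriv G"] by auto
    then have "deriv G \<midarrow>0\<rightarrow> of_real a" by (simp add: isCont_def a)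
    moreover have "\<forall>\<^sub>F z in at 0. deriv G z = deriv F z"
    proof -
      have "deriv G z = deriv F z" if "z \<noteq> 0" "dist z 0 < 1" for z
      proof (rule complex_derivative_transform_within_open[of _ "ball 0 1 - {0}"])
        show "G holomorphic_on ball 0 1 - {0}" using G holomorphic_on_subset by blast
      qed (use that hol in \<open>auto simp: G_def\<close>)
      then show ?thesis unfolding eventually_at by (intro exI[of _ 1]) auto
    qed
    ultimately have "deriv F \<midarrow>0\<rightarrow> of_real a" by (rule Lim_transform_eventually)
    then show ?thesis using a by (intro exI[of _ a]) simp
  next
    assume l: "(inverse \<circ> F) \<midarrow>0\<rightarrow> 0"
    \<comment> \<open>Since \<open>inverse 0 = 0\<close>, the limit alone does not exclude zeros of \<open>F\<close>; but there are only finitely many.\<close>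
    define Z where "Z = {z. z \<in> ball 0 1 - {0} \<and> F z = 0}"
    have "finite Z" using fin[of 0] by (simp add: Z_def)
    moreover have "0 \<notin> Z" by (simp add: Z_def)
    ultimately obtain s0 where s0: "s0 > 0" "\<And>z. z \<in> Z \<Longrightarrow> s0 \<le> dist 0 z"
      using finite_set_avoid[of Z 0] by (metis (full_types))
    define s where "s = min s0 1"
    have s: "0 < s" "s \<le> 1" using s0 by (auto simp: s_def)
    have sub: "ball 0 s - {0} \<subseteq> ball 0 1 - {0::complex}" using s by auto
    have Fnz: "F z \<noteq> 0" if "z \<in> ball 0 s - {0}" for z
      using s0(2)[of z] that s by (auto simp: Z_def s_def)
    define G where "G = (\<lambda>z. if z = 0 then 0 else - inverse (F z))"
    have "(\<lambda>z. - inverse (F z)) \<midarrow>0\<rightarrow> 0" using tendsto_minus[OF l] by (simp add: o_def)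
    moreover have "(\<lambda>z. - inverse (F z)) holomorphic_on ball 0 s - {0}"
      using holomorphic_on_subset[OF hol sub] Fnz by (intro holomorphic_intros) auto
    ultimately have G: "G holomorphic_on ball 0 s"
      unfolding G_def by (intro removable_singularity) auto
    have ImG: "Im (G z) = Im (F z) / (norm (F z))^2" if "z \<noteq> 0" for z
      using that by (simp add: G_def cmod_power2)
    have "\<exists>a>0. deriv G 0 = of_real a"
    proof (rule simple_zero_of_half_plane_map[of s])
      show "0 < Im (G z)" if "z \<in> ball 0 s" "0 < Im z" for z
      proof -
        have "z \<in> ball 0 s - {0}" using that by auto
        then show ?thesis using up[of z] Fnz[of z] that sub by (subst ImG) (auto intro!: divide_pos_pos)
      qed
      show "Im (G z) < 0" if "z \<in> ball 0 s" "Im z < 0" for z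
      proof -
        have "z \<in> ball 0 s - {0}" using that by auto
        then show ?thesis using lo[of z] Fnz[of z] that sub by (subst ImG) (auto intro!: divide_neg_pos)
      qed
    qed (use s G in \<open>auto simp: G_def\<close>)
    then obtain a where a: "a > 0" "deriv G 0 = of_real a" by blast
    have "(G has_field_derivative of_real a) (at 0)"
      using holomorphic_derivI[OF G, of 0] s a by auto
    then have G1: "(\<lambda>z. G z / z) \<midarrow>0\<rightarrow> of_real a"
      by (simp add: has_field_derivative_iff G_def)
    have "deriv G holomorphic_on ball 0 s" using G by (intro holomorphic_deriv) auto
    then have "isCont (deriv G) 0"
      using holomorphic_on_imp_continuous_on continuous_on_eq_continuous_at[of "ball 0 s" "deriv G"] s by auto
    then have G2: "deriv G \<midarrow>0\<rightarrow> of_real a" by (simp add: isCont_def a)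
    have lim: "(\<lambda>z. deriv G z / (G z / z)^2) \<midarrow>0\<rightarrow> of_real a / (of_real a)^2"
      using a by (intro tendsto_intros G1 G2) auto
    have "deriv G z / (G z / z)^2 = z^2 * deriv F z" if z: "z \<in> ball 0 s - {0}" for z
    proof -
      have z1: "z \<in> ball 0 1 - {0}" using z sub by blast
      have "((\<lambda>z. - inverse (F z)) has_field_derivative (deriv F z / (F z)^2)) (at z)"
        by (rule derivative_eq_intros derivF[OF z1] Fnz[OF z] refl)+ (simp add: power2_eq_square divide_inverse)
      then have "(G has_field_derivative (deriv F z / (F z)^2)) (at z)"
        by (rule has_field_derivative_transform_within_open[where S="ball 0 s - {0}"]) (use z in \<open>auto simp: G_def\<close>)
      then have e1: "deriv G z = deriv F z / (F z)^2" by (rule DERIV_imp_deriv)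
      have e2: "G z = - inverse (F z)" using z by (simp add: G_def)
      show ?thesis unfolding e1 e2 using Fnz[OF z] z by (simp add: power2_eq_square field_simps)
    qed
    then have "\<forall>\<^sub>F z in at 0. deriv G z / (G z / z)^2 = z^2 * deriv F z"
      unfolding eventually_at using s by (intro exI[of _ s]) auto
    then have "(\<lambda>z. z^2 * deriv F z) \<midarrow>0\<rightarrow> of_real a / (of_real a)^2"
      by (rule Lim_transform_eventually[OF lim])
    moreover have "of_real a / (of_real a)^2 = (of_real (1/a) :: complex)" using a by (simp add: power2_eq_square)
    ultimately have "(\<lambda>z. z^2 * deriv F z) \<midarrow>0\<rightarrow> of_real (1/a)" by (simp only:)
    moreover have "1/a > 0" using a by simp
    ultimately show ?thesis by (intro exI[of _ "1/a"]) simp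
  qed
qed

section \<open>The angle condition from a harmonic function with prescribed signs\<close>

lemma midpoint_le:
  fixes a b v :: real
  assumes "\<bar>v\<bar> \<le> (b - a) / 2"
  shows "a \<le> (a + b) / 2 + v" "(a + b) / 2 + v \<le> b"
  using assms by (simp_all add: abs_le_iff) argo+

lemma midpoint_less:
  fixes a b v :: real
  assumes "\<bar>v\<bar> < (b - a) / 2"
  shows "a < (a + b) / 2 + v" "(a + b) / 2 + v < b"
  using assms by (simp_all add: abs_less_iff) argo+

text \<open>The branch of \<open>\<zeta> = i * (z e\<^sup>-\<^sup>i\<^sup>\<mu>) powr \<rho>\<close> maps the sector onto the upper half-disc and its boundary rays to the
two halves of the real diameter. As \<open>Re h\<close> vanishes there, \<open>i * h\<close> extends by Schwarz reflection to a function \<open>F\<close> of \<open>\<zeta>\<close>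
on the whole punctured disc. The resulting formula for \<open>h\<close> then holds throughout the slit disc by
analytic continuation in the logarithmic coordinate \<open>w\<close>.\<close>

lemma sector_map_factorization:
  assumes \<alpha>: "- pi < \<alpha>1" "\<alpha>1 < \<alpha>2" "\<alpha>2 < pi"
    and h: "h holomorphic_on ball 0 1 - \<real>\<^sub>\<le>\<^sub>0"
    and pos: "\<And>z. z \<in> sector \<alpha>1 \<alpha>2 \<Longrightarrow> 0 < Re (h z)"
    and bd: "\<And>x. x < 0 \<Longrightarrow> Re (h (exp (Complex x \<alpha>1))) = 0" "\<And>x. x < 0 \<Longrightarrow> Re (h (exp (Complex x \<alpha>2))) = 0"
    and \<rho>: "\<rho> = pi / (\<alpha>2 - \<alpha>1)" and \<mu>: "\<mu> = (\<alpha>1 + \<alpha>2) / 2"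
  obtains F where "F holomorphic_on ball 0 1 - {0}"
    "\<And>z. z \<in> ball 0 1 - {0} \<Longrightarrow> 0 < Im z \<Longrightarrow> 0 < Im (F z)"
    "\<And>z. z \<in> ball 0 1 - {0} \<Longrightarrow> Im z < 0 \<Longrightarrow> Im (F z) < 0"
    "\<And>z. z \<in> ball 0 1 - {0} \<Longrightarrow> Im z = 0 \<Longrightarrow> Im (F z) = 0"
    "\<And>w. Re w < 0 \<Longrightarrow> \<bar>Im w\<bar> < pi \<Longrightarrow> h (exp w) = - \<i> * F (\<i> * exp (of_real \<rho> * (w - \<i> * of_real \<mu>)))"
proof -
  define S where "S = ball 0 1 - {0::complex}"
  have \<rho>0: "\<rho> > 0" using \<alpha> by (simp add: \<rho>)
  have pr: "pi / 2 / \<rho> = (\<alpha>2 - \<alpha>1) / 2" using \<alpha> by (simp add: \<rho>)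
  define \<psi> where "\<psi> = (\<lambda>\<omega>. \<i> * of_real \<mu> + Ln (- \<i> * \<omega>) / of_real \<rho>)"
  define F0 where "F0 = (\<lambda>\<omega>. \<i> * h (exp (\<psi> \<omega>)))"
  have Repsi: "Re (\<psi> \<omega>) < 0" if "\<omega> \<in> S" for \<omega>
  proof -
    have "- \<i> * \<omega> \<noteq> 0" using that by (auto simp: S_def)
    then have "Re (Ln (- \<i> * \<omega>)) = ln (norm \<omega>)" by (simp add: norm_mult)
    also have "\<dots> < 0" using that by (simp add: S_def)
    finally show ?thesis using \<rho>0 by (simp add: \<psi>_def divide_neg_pos)
  qed
  have Impsi: "Im (\<psi> \<omega>) = \<mu> + Im (Ln (- \<i> * \<omega>)) / \<rho>" for \<omega> by (simp add: \<psi>_def)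
  have psi_le: "\<alpha>1 \<le> Im (\<psi> \<omega>)" "Im (\<psi> \<omega>) \<le> \<alpha>2" if "\<omega> \<in> S" "0 \<le> Im \<omega>" for \<omega>
  proof -
    have "\<bar>Im (Ln (- \<i> * \<omega>))\<bar> \<le> pi / 2" using that Re_Ln_pos_le[of "- \<i> * \<omega>"] by (auto simp: S_def)
    then have "\<bar>Im (Ln (- \<i> * \<omega>))\<bar> / \<rho> \<le> pi / 2 / \<rho>" using \<rho>0 by (intro divide_right_mono) auto
    then have "\<bar>Im (Ln (- \<i> * \<omega>)) / \<rho>\<bar> \<le> (\<alpha>2 - \<alpha>1) / 2" unfolding pr using \<rho>0 by simp
    from midpoint_le[OF this] show "\<alpha>1 \<le> Im (\<psi> \<omega>)" "Im (\<psi> \<omega>) \<le> \<alpha>2" unfolding Impsi \<mu> by simp_all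
  qed
  have psi_lt: "\<alpha>1 < Im (\<psi> \<omega>)" "Im (\<psi> \<omega>) < \<alpha>2" if "\<omega> \<in> S" "0 < Im \<omega>" for \<omega>
  proof -
    have "\<bar>Im (Ln (- \<i> * \<omega>))\<bar> < pi / 2" using that Re_Ln_pos_lt[of "- \<i> * \<omega>"] by (auto simp: S_def)
    then have "\<bar>Im (Ln (- \<i> * \<omega>))\<bar> / \<rho> < pi / 2 / \<rho>" using \<rho>0 by (intro divide_strict_right_mono) auto
    then have "\<bar>Im (Ln (- \<i> * \<omega>)) / \<rho>\<bar> < (\<alpha>2 - \<alpha>1) / 2" unfolding pr using \<rho>0 by simp
    from midpoint_less[OF this] show "\<alpha>1 < Im (\<psi> \<omega>)" "Im (\<psi> \<omega>) < \<alpha>2" unfolding Impsi \<mu> by simp_all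
  qed
  have slit: "exp (\<psi> \<omega>) \<in> ball 0 1 - \<real>\<^sub>\<le>\<^sub>0" if "\<omega> \<in> S" "0 \<le> Im \<omega>" for \<omega>
    using exp_strip_in_slit_disc[OF Repsi[OF that(1)]] psi_le[OF that] \<alpha> by (auto simp: abs_less_iff)
  have "\<psi> holomorphic_on S \<inter> {z. 0 \<le> Im z}"
    unfolding \<psi>_def using \<rho>0 by (intro holomorphic_intros) (auto simp: S_def complex_nonpos_Reals_iff complex_eq_iff)
  then have "(\<lambda>\<omega>. exp (\<psi> \<omega>)) holomorphic_on S \<inter> {z. 0 \<le> Im z}" by (intro holomorphic_intros)
  then have "(\<lambda>\<omega>. h (exp (\<psi> \<omega>))) holomorphic_on S \<inter> {z. 0 \<le> Im z}"
    using holomorphic_on_compose_gen[OF _ h, unfolded o_def] slit by blast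
  then have F0: "F0 holomorphic_on S \<inter> {z. 0 \<le> Im z}" unfolding F0_def by (intro holomorphic_intros)
  have F0real: "Im (F0 z) = 0" if z: "z \<in> S" "Im z = 0" for z
  proof -
    define t where "t = Re z"
    have zt: "z = of_real t" using z by (simp add: t_def complex_eq_iff)
    have t0: "t \<noteq> 0" using z zt by (auto simp: S_def)
    define \<sigma> :: real where "\<sigma> = (if t > 0 then -1 else 1)"
    have "- \<i> * z = exp (Complex (ln \<bar>t\<bar>) (\<sigma> * (pi/2)))"
      using t0 by (auto simp: zt \<sigma>_def complex_eq_iff Re_exp Im_exp abs_if)
    then have "Ln (- \<i> * z) = Complex (ln \<bar>t\<bar>) (\<sigma> * (pi/2))"
      by (simp only:) (intro Ln_exp; simp add: \<sigma>_def)
    then have "Im (\<psi> z) = \<mu> + \<sigma> * (pi/2/\<rho>)" by (simp add: Impsi)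
    then have "Im (\<psi> z) = \<alpha>1 \<or> Im (\<psi> z) = \<alpha>2" unfolding pr \<mu> by (cases "t > 0") (simp_all add: \<sigma>_def field_simps)
    moreover have "\<psi> z = Complex (Re (\<psi> z)) (Im (\<psi> z))" by simp
    ultimately have "Re (h (exp (\<psi> z))) = 0" using bd Repsi[OF z(1)] by metis
    then show ?thesis by (simp add: F0_def)
  qed
  have F0pos: "0 < Im (F0 z)" if z: "z \<in> S" "0 < Im z" for z
  proof -
    have "exp (\<psi> z) \<in> sector \<alpha>1 \<alpha>2" by (rule sector_I[OF refl Repsi[OF z(1)] psi_lt[OF z]])
    then show ?thesis using pos by (simp add: F0_def)
  qed
  define F where "F = (\<lambda>z. if 0 \<le> Im z then F0 z else cnj (F0 (cnj z)))"
  have cS: "cnj z \<in> S" if "z \<in> S" for z using that by (simp add: S_def)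
  have Fhol: "F holomorphic_on S" unfolding F_def
  proof (rule Schwarz_reflection)
    show "open S" by (auto simp: S_def)
    show "cnj ` S \<subseteq> S" using cS by auto
    show "F0 holomorphic_on S \<inter> {z. 0 < Im z}" using F0 by (rule holomorphic_on_subset) auto
    show "continuous_on (S \<inter> {z. 0 \<le> Im z}) F0" using F0 by (rule holomorphic_on_imp_continuous_on)
    show "F0 z \<in> \<real>" if "z \<in> S" "z \<in> \<real>" for z
      using F0real[OF that(1)] that(2) by (simp add: complex_is_Real_iff)
  qed
  define \<Omega> where "\<Omega> = (\<lambda>w. \<i> * exp (of_real \<rho> * (w - \<i> * of_real \<mu>)))"
  have Om: "\<Omega> w \<in> S" if "Re w < 0" for w
    using that \<rho>0 by (simp add: \<Omega>_def S_def norm_mult norm_exp_eq_Re mult_pos_neg)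
  define \<Sigma> where "\<Sigma> = {w. Re w < 0 \<and> -pi < Im w \<and> Im w < pi}"
  define \<Sigma>0 where "\<Sigma>0 = {w. Re w < 0 \<and> \<alpha>1 < Im w \<and> Im w < \<alpha>2}"
  have FOm: "h (exp w) = - \<i> * F (\<Omega> w)" if w: "w \<in> \<Sigma>0" for w
  proof -
    define u where "u = of_real \<rho> * (w - \<i> * of_real \<mu>)"
    have Imu: "Im u = \<rho> * (Im w - \<mu>)" by (simp add: u_def)
    have "\<bar>Im w - \<mu>\<bar> < pi / 2 / \<rho>" unfolding pr \<mu> abs_less_iff using w by (simp add: \<Sigma>0_def field_simps)
    then have "\<rho> * \<bar>Im w - \<mu>\<bar> < pi / 2" using \<rho>0 by (simp add: field_simps)
    then have iu: "\<bar>Im u\<bar> < pi / 2" using \<rho>0 by (simp add: Imu abs_mult)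
    have "0 < cos (Im u)" using iu by (intro cos_gt_zero_pi) (auto simp: abs_less_iff)
    then have "0 \<le> Im (\<Omega> w)" by (simp add: \<Omega>_def u_def[symmetric] Re_exp)
    moreover have "- \<i> * \<Omega> w = exp u" by (simp add: \<Omega>_def u_def)
    moreover have "Ln (exp u) = u" by (rule Ln_exp) (use iu in \<open>auto simp: abs_less_iff\<close>)
    moreover have "\<i> * of_real \<mu> + u / of_real \<rho> = w" using \<rho>0 by (simp add: u_def)
    ultimately have "F (\<Omega> w) = \<i> * h (exp w)" by (simp only: F_def F0_def \<psi>_def if_True)
    then show ?thesis by simp
  qed
  have eq: "h (exp w) = - \<i> * F (\<Omega> w)" if w: "w \<in> \<Sigma>" for w
  proof (rule analytic_continuation_open[of \<Sigma>0 \<Sigma> "\<lambda>w. h (exp w)" "\<lambda>w. - \<i> * F (\<Omega> w)"])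
    show "open \<Sigma>0" "open \<Sigma>" unfolding \<Sigma>0_def \<Sigma>_def by (rule open_strip)+
    have "Complex (-1) \<mu> \<in> \<Sigma>0" using \<alpha> by (auto simp: \<Sigma>0_def \<mu>)
    then show "\<Sigma>0 \<noteq> {}" by auto
    have "\<Sigma> = {w. Re w < 0} \<inter> {w. -pi < Im w} \<inter> {w. Im w < pi}" by (auto simp: \<Sigma>_def)
    then have "convex \<Sigma>" 
      by (simp add: convex_Int convex_halfspace_Im_gt convex_halfspace_Im_lt convex_halfspace_Re_lt)
    then show "connected \<Sigma>" by (rule convex_connected)
    show "\<Sigma>0 \<subseteq> \<Sigma>" using \<alpha> by (auto simp: \<Sigma>0_def \<Sigma>_def)
    show "(\<lambda>w. h (exp w)) holomorphic_on \<Sigma>"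
    proof (rule holomorphic_on_compose_gen[OF _ h, unfolded o_def])
      show "exp ` \<Sigma> \<subseteq> ball 0 1 - \<real>\<^sub>\<le>\<^sub>0" using exp_strip_in_slit_disc by (auto simp: \<Sigma>_def abs_less_iff simp del: mem_ball_0)
    qed (intro holomorphic_intros)
    have "(\<lambda>w. F (\<Omega> w)) holomorphic_on \<Sigma>"
    proof (rule holomorphic_on_compose_gen[OF _ Fhol, unfolded o_def])
      show "\<Omega> holomorphic_on \<Sigma>" unfolding \<Omega>_def by (intro holomorphic_intros)
      show "\<Omega> ` \<Sigma> \<subseteq> S" using Om by (auto simp: \<Sigma>_def)
    qed
    then show "(\<lambda>w. - \<i> * F (\<Omega> w)) holomorphic_on \<Sigma>" by (intro holomorphic_intros)
  qed (use FOm w in auto)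
  show ?thesis
  proof (rule that[of F])
    show "F holomorphic_on ball 0 1 - {0}" using Fhol by (simp add: S_def)
    show "0 < Im (F z)" if "z \<in> ball 0 1 - {0}" "0 < Im z" for z
      using F0pos[of z] that by (simp add: F_def S_def)
    show "Im (F z) < 0" if "z \<in> ball 0 1 - {0}" "Im z < 0" for z
      using F0pos[of "cnj z"] that by (simp add: F_def S_def)
    show "Im (F z) = 0" if "z \<in> ball 0 1 - {0}" "Im z = 0" for z
      using F0real[of z] that by (simp add: F_def S_def)
    show "h (exp w) = - \<i> * F (\<i> * exp (of_real \<rho> * (w - \<i> * of_real \<mu>)))" if "Re w < 0" "\<bar>Im w\<bar> < pi" for w
      using eq[of w] that by (simp add: \<Sigma>_def \<Omega>_def abs_less_iff)
  qed
qed

lemma real_nonneg_limit: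
  fixes f :: "'a \<Rightarrow> complex"
  assumes "(f \<longlongrightarrow> l) G" "G \<noteq> bot" "\<forall>\<^sub>F x in G. Im (f x) = 0 \<and> 0 \<le> Re (f x)"
  shows "Im l = 0" "0 \<le> Re l"
proof -
  have "\<forall>\<^sub>F x in G. Im (f x) = 0" using assms(3) by eventually_elim simp
  from tendsto_unique[OF assms(2) tendsto_Im[OF assms(1)] tendsto_eventually[OF this]]
  show "Im l = 0" .
  show "0 \<le> Re l"
    by (rule tendsto_lowerbound[OF tendsto_Re[OF assms(1)]])
       (use assms in \<open>auto elim: eventually_mono\<close>)
qed

text \<open>By the preceding lemma, \<open>h\<close> behaves at the origin like a power of \<open>z\<close>, up to an additive constant. The sign of
\<open>Re h\<close> on both sides of the negative axis bounds the exponent, and the jump of \<open>h'\<close> across the axis, whose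
direction is prescribed, restricts the position of the axis. Here \<open>H1\<close> and \<open>H2\<close> are the continuations of \<open>h\<close> across the axis from above and from below.\<close>

lemma sector_angle_dichotomy:
  assumes \<alpha>: "- pi < \<alpha>1" "\<alpha>1 < \<alpha>2" "\<alpha>2 < pi"
    and h: "h holomorphic_on ball 0 1 - \<real>\<^sub>\<le>\<^sub>0"
    and pos: "\<And>z. z \<in> sector \<alpha>1 \<alpha>2 \<Longrightarrow> 0 < Re (h z)"
    and bd: "\<And>x. x < 0 \<Longrightarrow> Re (h (exp (Complex x \<alpha>1))) = 0" "\<And>x. x < 0 \<Longrightarrow> Re (h (exp (Complex x \<alpha>2))) = 0"
    and neg: "\<And>z. z \<in> sector (- pi) \<alpha>1 \<Longrightarrow> Re (h z) \<le> 0" "\<And>z. z \<in> sector \<alpha>2 pi \<Longrightarrow> Re (h z) \<le> 0"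
    and jump: "\<And>c d H1 H2. \<lbrakk>-1 < c; c < 0; 0 < d; ball (complex_of_real c) d \<subseteq> ball 0 1; H1 holomorphic_on ball (of_real c) d;
        H2 holomorphic_on ball (of_real c) d;
        \<And>z. z \<in> ball (of_real c) d \<Longrightarrow> 0 < Im z \<Longrightarrow> H1 z = h z;
        \<And>z. z \<in> ball (of_real c) d \<Longrightarrow> Im z < 0 \<Longrightarrow> H2 z = h z\<rbrakk>
        \<Longrightarrow> \<exists>t\<ge>0. deriv H2 (of_real c) - deriv H1 (of_real c) = \<i> * of_real t"
  shows "\<alpha>2 - \<alpha>1 = pi \<or> (\<alpha>1 + \<alpha>2 = 0 \<and> \<alpha>2 - \<alpha>1 > pi)"
proof -
  define \<rho> where "\<rho> = pi / (\<alpha>2 - \<alpha>1)"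
  define \<mu> where "\<mu> = (\<alpha>1 + \<alpha>2) / 2"
  obtain F where F: "F holomorphic_on ball 0 1 - {0}"
    and Fup: "\<And>z. z \<in> ball 0 1 - {0} \<Longrightarrow> 0 < Im z \<Longrightarrow> 0 < Im (F z)"
    and Flo: "\<And>z. z \<in> ball 0 1 - {0} \<Longrightarrow> Im z < 0 \<Longrightarrow> Im (F z) < 0"
    and Fre: "\<And>z. z \<in> ball 0 1 - {0} \<Longrightarrow> Im z = 0 \<Longrightarrow> Im (F z) = 0"
    and hF: "\<And>w. Re w < 0 \<Longrightarrow> \<bar>Im w\<bar> < pi \<Longrightarrow> h (exp w) = - \<i> * F (\<i> * exp (of_real \<rho> * (w - \<i> * of_real \<mu>)))"
    by (rule sector_map_factorization[OF \<alpha> h pos bd \<rho>_def \<mu>_def]) (assumption+, rule that)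
  have \<rho>0: "\<rho> > 0" using \<alpha> by (simp add: \<rho>_def)
  have \<rho>\<beta>: "\<rho> * (\<alpha>2 - \<alpha>1) = pi" using \<alpha> by (simp add: \<rho>_def)
  have \<rho>2: "\<rho> * (\<alpha>2 - \<mu>) = pi / 2" "\<rho> * (\<mu> - \<alpha>1) = pi / 2"
    using \<rho>\<beta> by (simp_all add: \<mu>_def field_simps)
  have Om: "\<i> * exp (of_real \<rho> * (w - \<i> * of_real \<mu>)) \<in> ball 0 1 - {0}" if "Re w < 0" for w
    using that \<rho>0 by (simp add: norm_mult norm_exp_eq_Re mult_pos_neg)

  \<comment> \<open>Just beyond the angles \<open>\<mu> \<plusminus> 3 \<pi> / (2 \<rho>)\<close> the coordinate of \<open>F\<close> enters the upper half-disc again, where \<open>Re h\<close> is positive.\<close>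
  have bound: "\<rho> * (pi - s * \<mu>) \<le> 3/2 * pi" if s: "s = 1 \<or> s = -1" for s
  proof (rule ccontr)
    assume "\<not> ?thesis"
    then have l: "3/2 * pi < \<rho> * (pi - s * \<mu>)" by simp
    define e where "e = min (pi/2) ((\<rho> * (pi - s * \<mu>) - 3/2 * pi) / 2)"
    have e: "0 < e" "e < pi" "3/2 * pi + e < \<rho> * (pi - s * \<mu>)" using l by (auto simp: e_def min_def field_simps)
    define Q where "Q = (3/2 * pi + e) / \<rho>"
    define \<theta> where "\<theta> = \<mu> + s * Q"
    have q: "Q < pi - s * \<mu>" using e(3) \<rho>0 by (simp add: Q_def divide_less_eq mult.commute)
    have "\<rho> * (\<alpha>2 - \<mu>) < 3/2 * pi + e" "\<rho> * (\<mu> - \<alpha>1) < 3/2 * pi + e" using e \<rho>2 by simp_all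
    then have q': "\<alpha>2 - \<mu> < Q" "\<mu> - \<alpha>1 < Q"
      using \<rho>0 by (simp_all add: Q_def less_divide_eq mult.commute)
    have \<theta>: "(\<alpha>2 < \<theta> \<and> \<theta> < pi) \<or> (- pi < \<theta> \<and> \<theta> < \<alpha>1)" using s
    proof
      assume "s = 1" then show ?thesis using q q' by (simp add: \<theta>_def)
    next
      assume "s = -1" then show ?thesis using q q' by (simp add: \<theta>_def)
    qed
    define w where "w = Complex (-1) \<theta>"
    have "of_real \<rho> * (w - \<i> * of_real \<mu>) = Complex (-\<rho>) (s * (3/2 * pi + e))"
      using \<rho>0 by (simp add: w_def \<theta>_def Q_def complex_eq_iff field_simps)
    then have "Im (\<i> * exp (of_real \<rho> * (w - \<i> * of_real \<mu>))) = exp (-\<rho>) * cos (s * (3/2 * pi + e))"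
      by (simp add: Re_exp)
    also have "cos (s * (3/2 * pi + e)) = cos (3/2 * pi + e)" using s by (elim disjE) (simp_all only: mult_1 mult_minus1 cos_minus)
    also have "cos (3/2 * pi + e) = sin e"
      using cos_3over2_pi sin_3over2_pi by (simp add: cos_add)
    finally have "0 < Im (\<i> * exp (of_real \<rho> * (w - \<i> * of_real \<mu>)))"
      using e by (simp add: sin_gt_zero)
    then have "0 < Im (F (\<i> * exp (of_real \<rho> * (w - \<i> * of_real \<mu>))))"
      by (intro Fup Om) (auto simp: w_def)
    moreover have "h (exp w) = - \<i> * F (\<i> * exp (of_real \<rho> * (w - \<i> * of_real \<mu>)))"
      using \<theta> \<alpha> by (intro hF) (auto simp: w_def)
    ultimately have "0 < Re (h (exp w))" by simp
    moreover have "exp w \<in> sector \<alpha>2 pi \<or> exp w \<in> sector (- pi) \<alpha>1"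
      using \<theta> by (elim disjE) (auto simp: w_def intro!: sector_I)
    ultimately show False using neg by fastforce
  qed

  \<comment> \<open>\<open>om s x\<close> is the coordinate of the point \<open>- e\<^sup>x\<close>, seen from above for \<open>s = 1\<close> and from below for \<open>s = -1\<close>; up to a
    constant factor, \<open>D s x\<close> is the one-sided derivative of \<open>h\<close> in the logarithmic coordinate.\<close>
  define E where "E = (\<lambda>s::real. \<i> * cis (\<rho> * (s * pi - \<mu>)))"
  define om where "om = (\<lambda>s x. of_real (exp (\<rho> * x)) * E s)"
  define D where "D = (\<lambda>s x. om s x * deriv F (om s x))"
  have E0: "E s \<noteq> 0" for s by (simp add: E_def)
  have nE: "norm (E s) = 1" for s by (simp add: E_def norm_mult)
  have om1: "om s x \<in> ball 0 1 - {0}" if "x < 0" for s x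
    using that \<rho>0 E0[of s] by (simp add: om_def norm_mult nE mult_pos_neg)
  have Dcone: "Im (D (-1) x - D 1 x) = 0 \<and> 0 \<le> Re (D (-1) x - D 1 x)" if x: "x < 0" for x
  proof -
    define c where "c = - exp x"
    have c: "-1 < c" "c < 0" using x by (auto simp: c_def)
    define d where "d = min (exp x) (1 - exp x)"
    have d: "0 < d" using x by (simp add: d_def)
    have dc: "d \<le> - c" "d \<le> 1 + c" by (auto simp: d_def c_def)
    have bre: "Re z < 0" "norm z < 1" if "z \<in> ball (of_real c) d" for z
    proof -
      have n: "norm (z - of_real c) < d" using that by (simp add: dist_norm norm_minus_commute)
      have "Re z - c \<le> norm (z - of_real c)" using complex_Re_le_cmod[of "z - of_real c"] by simp
      then show "Re z < 0" using n dc by linarith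
      have "norm z \<le> norm (z - of_real c) + norm (of_real c :: complex)" by (metis add.commute norm_triangle_sub)
      then show "norm z < 1" using n dc c by simp
    qed
    define W where "W = (\<lambda>s z. Ln (- z) + \<i> * of_real (s * pi))"
    define Q where "Q = (\<lambda>s z. \<i> * exp (of_real \<rho> * (W s z - \<i> * of_real \<mu>)))"
    define H where "H = (\<lambda>s z. - \<i> * F (Q s z))"
    have Wre: "Re (W s z) < 0" if "z \<in> ball (of_real c) d" for s z
    proof -
      have "- z \<noteq> 0" using bre(1)[OF that] by auto
      from Re_Ln[OF this] show ?thesis using bre[OF that] \<open>- z \<noteq> 0\<close> by (simp add: W_def)
    qed
    have Wd: "(W s has_field_derivative 1 / z) (at z)" if "z \<in> ball (of_real c) d" for s z
    proof -
      have "- z \<notin> \<real>\<^sub>\<le>\<^sub>0" using bre(1)[OF that] by (simp add: complex_nonpos_Reals_iff)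
      moreover have "z \<noteq> 0" using bre(1)[OF that] by auto
      ultimately show ?thesis unfolding W_def
        by (auto intro!: derivative_eq_intros simp: field_simps)
    qed
    have QS: "Q s z \<in> ball 0 1 - {0}" if "z \<in> ball (of_real c) d" for s z
      unfolding Q_def by (rule Om[OF Wre[OF that]])
    have Hd: "(H s has_field_derivative (- \<i> * (deriv F (Q s z) * (Q s z * (of_real \<rho> / z))))) (at z)"
      if z: "z \<in> ball (of_real c) d" for s z
    proof -
      have "(F has_field_derivative deriv F (Q s z)) (at (Q s z))"
        by (rule holomorphic_derivI[OF F _ QS[OF z]]) auto
      moreover have "(Q s has_field_derivative (Q s z * (of_real \<rho> / z))) (at z)"
        unfolding Q_def by (rule derivative_eq_intros Wd[OF z] refl)+ simp
      ultimately have "((\<lambda>z. F (Q s z)) has_field_derivative (deriv F (Q s z) * (Q s z * (of_real \<rho> / z)))) (at z)"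
        by (rule DERIV_chain2)
      then show ?thesis unfolding H_def by (rule DERIV_cmult)
    qed
    have Hhol: "H s holomorphic_on ball (of_real c) d" for s
      unfolding holomorphic_on_open[OF open_ball] by (intro ballI exI, rule Hd)
    have expW: "exp (W s z) = z" if "z \<in> ball (of_real c) d" "s = 1 \<or> s = -1" for s z
    proof -
      have "z \<noteq> 0" using bre(1)[OF that(1)] by auto
      moreover have "exp (\<i> * of_real (s * pi)) = -1" using that(2) exp_pi_i'
        by (auto simp: exp_minus)
      ultimately show ?thesis by (simp add: W_def exp_add)
    qed
    have Hh: "H s z = h z" if z: "z \<in> ball (of_real c) d" "s = 1 \<or> s = -1" "\<bar>Im (W s z)\<bar> < pi" for s z
      using hF[OF Wre[OF z(1)] z(3)] expW[OF z(1,2)] by (simp add: H_def Q_def)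
    have "\<exists>t\<ge>0. deriv (H (-1)) (of_real c) - deriv (H 1) (of_real c) = \<i> * of_real t"
    proof (rule jump[OF c d _ Hhol Hhol])
      show "ball (complex_of_real c) d \<subseteq> ball 0 1" using bre by auto
      show "H 1 z = h z" if "z \<in> ball (of_real c) d" "0 < Im z" for z
      proof (rule Hh)
        have "z \<noteq> 0" using that by auto
        then have "Im (Ln (-z)) < 0 \<and> - pi < Im (Ln (-z))"
          using Im_Ln_pos_le[of "-z"] mpi_less_Im_Ln[of "-z"] Im_Ln_le_pi[of "-z"] that by auto
        then show "\<bar>Im (W 1 z)\<bar> < pi" by (simp add: W_def)
      qed (use that in auto)
      show "H (-1) z = h z" if "z \<in> ball (of_real c) d" "Im z < 0" for z
      proof (rule Hh)
        have "z \<noteq> 0" using that by auto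
        then have "0 < Im (Ln (-z)) \<and> Im (Ln (-z)) < pi"
          using Im_Ln_pos_lt[of "-z"] that by auto
        then show "\<bar>Im (W (-1) z)\<bar> < pi" by (simp add: W_def)
      qed (use that in auto)
    qed
    then obtain t where t: "t \<ge> 0" "deriv (H (-1)) (of_real c) - deriv (H 1) (of_real c) = \<i> * of_real t" by blast
    have cin: "of_real c \<in> ball (of_real c :: complex) d" using d by simp
    have Qc: "Q s (of_real c) = om s x" for s
    proof -
      have "Ln (- of_real c) = of_real x" by (simp add: c_def flip: exp_of_real)
      then have "W s (of_real c) - \<i> * of_real \<mu> = of_real x + \<i> * of_real (s * pi - \<mu>)"
        by (simp add: W_def algebra_simps)
      then have "of_real \<rho> * (W s (of_real c) - \<i> * of_real \<mu>) = of_real (\<rho> * x) + \<i> * of_real (\<rho> * (s * pi - \<mu>))"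
        by (simp add: algebra_simps)
      then have "Q s (of_real c) = \<i> * (exp (of_real (\<rho> * x)) * cis (\<rho> * (s * pi - \<mu>)))"
        unfolding Q_def by (simp only: exp_add cis_conv_exp)
      then show ?thesis unfolding om_def E_def exp_of_real by simp
    qed
    have "deriv (H s) (of_real c) = - \<i> * (of_real (\<rho> / c) * D s x)" for s
      using DERIV_imp_deriv[OF Hd[OF cin]] by (simp add: Qc D_def mult_ac)
    then have "- \<i> * (of_real (\<rho> / c) * D (-1) x) - - \<i> * (of_real (\<rho> / c) * D 1 x) = \<i> * of_real t"
      using t(2) by simp
    then have "\<i> * (of_real (\<rho> / c) * (D (-1) x - D 1 x)) = \<i> * of_real (-t)"
      by (simp add: algebra_simps)
    then have "of_real (\<rho> / c) * (D (-1) x - D 1 x) = of_real (-t)" by (simp only: mult_left_cancel[OF complex_i_not_zero])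
    then have "D (-1) x - D 1 x = of_real (-t) / of_real (\<rho> / c)"
      using \<rho>0 c by (simp add: field_simps)
    also have "\<dots> = of_real (- t * c / \<rho>)" using \<rho>0 c by simp
    finally have "D (-1) x - D 1 x = of_real (- t * c / \<rho>)" .
    moreover have "0 \<le> - t * c / \<rho>" using t c \<rho>0 by (simp add: mult_nonneg_nonpos divide_nonpos_pos)
    ultimately show ?thesis by (simp only: Im_complex_of_real Re_complex_of_real)
  qed

  have oml: "filterlim (om s) (at 0) at_bot" for s
  proof -
    have "((\<lambda>x. exp (\<rho> * x)) \<longlongrightarrow> 0) at_bot"
      by (intro filterlim_compose[OF exp_at_bot] filterlim_tendsto_pos_mult_at_bot[OF tendsto_const \<rho>0] filterlim_ident)
    then have "((\<lambda>x. of_real (exp (\<rho> * x)) * E s) \<longlongrightarrow> of_real 0 * E s) at_bot" by (intro tendsto_intros)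
    then show ?thesis using E0[of s] by (auto simp: filterlim_at om_def)
  qed
  have evneg: "\<forall>\<^sub>F x in at_bot. x < (0::real)" unfolding eventually_at_bot_linorder by (intro exI[of _ "-1"]) simp
  have cone: "sin (\<rho> * pi) * sin (\<rho> * \<mu>) = 0 \<and> 0 \<le> sin (\<rho> * pi) * cos (\<rho> * \<mu>)"
  proof -
    obtain a where a: "a > 0" "(deriv F \<longlongrightarrow> of_real a) (at 0) \<or> ((\<lambda>z. z^2 * deriv F z) \<longlongrightarrow> of_real a) (at 0)"
      using half_plane_map_isolated_singularity[OF F Fup Flo Fre] by blast
    from a(2) show ?thesis
    proof
      assume l: "(deriv F \<longlongrightarrow> of_real a) (at 0)"
      have l1: "((\<lambda>x. E s * deriv F (om s x)) \<longlongrightarrow> E s * of_real a) at_bot" for s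
        by (intro tendsto_intros filterlim_compose[OF l oml])
      have l2: "((\<lambda>x. E (-1) * deriv F (om (-1) x) - E 1 * deriv F (om 1 x)) \<longlongrightarrow> E (-1) * of_real a - E 1 * of_real a) at_bot"
        by (intro tendsto_intros l1)
      have "E (-1) * deriv F (om (-1) x) - E 1 * deriv F (om 1 x) = of_real (exp (- \<rho> * x)) * (D (-1) x - D 1 x)" for x
      proof -
        have "of_real (exp (- \<rho> * x)) * D s x = E s * deriv F (om s x)" for s
          unfolding D_def om_def by (simp add: exp_minus)
        then show ?thesis by (simp add: right_diff_distrib)
      qed
      then have "Im (E (-1) * deriv F (om (-1) x) - E 1 * deriv F (om 1 x)) = 0 \<and> 0 \<le> Re (E (-1) * deriv F (om (-1) x) - E 1 * deriv F (om 1 x))" if "x < 0" for x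
        using Dcone[OF that] by (simp only: times_complex.sel Re_complex_of_real Im_complex_of_real) simp
      then have ev: "\<forall>\<^sub>F x in at_bot. Im (E (-1) * deriv F (om (-1) x) - E 1 * deriv F (om 1 x)) = 0 \<and> 0 \<le> Re (E (-1) * deriv F (om (-1) x) - E 1 * deriv F (om 1 x))"
        using evneg by (rule eventually_mono[rotated])
      have "E (-1) * of_real a - E 1 * of_real a = of_real (2 * a) * Complex (sin (\<rho> * pi) * cos (\<rho> * \<mu>)) (- (sin (\<rho> * pi) * sin (\<rho> * \<mu>)))"
        by (simp add: E_def complex_eq_iff right_diff_distrib cos_diff sin_diff cos_add sin_add algebra_simps)
      then show ?thesis using real_nonneg_limit[OF l2 trivial_limit_at_bot_linorder ev] a(1)
        by (simp add: zero_le_mult_iff)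
    next
      assume l: "((\<lambda>z. z^2 * deriv F z) \<longlongrightarrow> of_real a) (at 0)"
      have l1: "((\<lambda>x. inverse (E s) * ((om s x)^2 * deriv F (om s x))) \<longlongrightarrow> inverse (E s) * of_real a) at_bot" for s
        by (intro tendsto_intros filterlim_compose[OF l oml])
      define R where "R = (\<lambda>s x. inverse (E s) * ((om s x)^2 * deriv F (om s x)))"
      have l2: "((\<lambda>x. R (-1) x - R 1 x) \<longlongrightarrow> inverse (E (-1)) * of_real a - inverse (E 1) * of_real a) at_bot"
        unfolding R_def by (intro tendsto_intros l1)
      have "R (-1) x - R 1 x = of_real (exp (\<rho> * x)) * (D (-1) x - D 1 x)" for x
      proof -
        have "of_real (exp (\<rho> * x)) * D s x = R s x" for s
          unfolding D_def om_def R_def using E0[of s] by (simp add: power2_eq_square field_simps)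
        then show ?thesis by (simp add: right_diff_distrib)
      qed
      then have "Im (R (-1) x - R 1 x) = 0 \<and> 0 \<le> Re (R (-1) x - R 1 x)" if "x < 0" for x
        using Dcone[OF that] by (simp only: times_complex.sel Re_complex_of_real Im_complex_of_real) simp
      then have ev: "\<forall>\<^sub>F x in at_bot. Im (R (-1) x - R 1 x) = 0 \<and> 0 \<le> Re (R (-1) x - R 1 x)"
        using evneg by (rule eventually_mono[rotated])
      have iE: "inverse (E s) = - \<i> * cis (- (\<rho> * (s * pi - \<mu>)))" for s
        by (simp add: E_def cis_inverse)
      have "inverse (E (-1)) * of_real a - inverse (E 1) * of_real a = of_real (2 * a) * Complex (sin (\<rho> * pi) * cos (\<rho> * \<mu>)) (sin (\<rho> * pi) * sin (\<rho> * \<mu>))"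
        unfolding iE
        by (simp add: complex_eq_iff right_diff_distrib cos_diff sin_diff cos_add sin_add algebra_simps)
      then show ?thesis using real_nonneg_limit[OF l2 trivial_limit_at_bot_linorder ev] a(1)
        by (simp add: zero_le_mult_iff)
    qed
  qed

  define A where "A = \<rho> * pi"
  define B where "B = \<rho> * \<mu>"
  have A1: "A - B \<le> 3/2 * pi" "A + B \<le> 3/2 * pi" using bound[of 1] bound[of "-1"] by (auto simp: A_def B_def algebra_simps)
  have A2: "pi/2 < A - B" "pi/2 < A + B"
  proof -
    have "\<rho> * (\<alpha>2 - \<mu>) < \<rho> * (pi - \<mu>)" "\<rho> * (\<mu> - \<alpha>1) < \<rho> * (\<mu> - - pi)"
      using \<rho>0 \<alpha> by (intro mult_strict_left_mono; simp)+
    then show "pi/2 < A - B" "pi/2 < A + B" using \<rho>2 by (auto simp: A_def B_def algebra_simps)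
  qed
  have A3: "pi/2 < A" "A \<le> 3/2 * pi" "\<bar>B\<bar> < pi" using A1 A2 pi_gt_zero by linarith+
  show ?thesis
  proof (cases "sin A = 0")
    case True
    have "sin (A - pi) = 0" using True by simp
    moreover have "- pi < A - pi" "A - pi < pi" using A3 pi_gt_zero by linarith+
    ultimately have "A - pi = 0" by (metis sin_eq_0_pi)
    then have "\<rho> = 1" by (simp add: A_def)
    then have "\<alpha>2 - \<alpha>1 = pi" using \<rho>\<beta> by simp
    then show ?thesis ..
  next
    case False
    then have "sin B = 0" using cone by (simp add: A_def B_def)
    then have "B = 0" using A3(3) sin_eq_0_pi[of B] by (simp add: abs_less_iff)
    then have \<mu>0: "\<mu> = 0" using \<rho>0 by (simp add: B_def)
    then have "0 < sin A" using cone False by (simp add: A_def)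
    have "A < pi"
    proof (rule ccontr)
      assume "\<not> A < pi"
      then have "0 \<le> sin (A - pi)" using A3 pi_gt_zero by (intro sin_ge_zero) linarith+
      then show False using \<open>0 < sin A\<close> by simp
    qed
    then have "\<rho> < 1" by (simp add: A_def)
    then have "\<rho> * (\<alpha>2 - \<alpha>1) < 1 * (\<alpha>2 - \<alpha>1)" using \<alpha> by (intro mult_strict_right_mono) auto
    then have "\<alpha>2 - \<alpha>1 > pi" using \<rho>\<beta> by simp
    moreover have "\<alpha>1 + \<alpha>2 = 0" using \<mu>0 by (simp add: \<mu>_def)
    ultimately show ?thesis by simp
  qed
qed

section \<open>The jump of the logarithmic derivative across the ray of zeros\<close>

lemma log_derivative_of_exp:
  assumes S: "open S" and L: "L holomorphic_on S" and g: "\<And>w. w \<in> S \<Longrightarrow> g w = exp (L w)" and z: "z \<in> S"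
  shows "deriv g z / g z = deriv L z"
    and "deriv (\<lambda>w. exp (L w / c)) z / exp (L z / c) = deriv L z / c"
proof -
  have Ld: "(L has_field_derivative deriv L z) (at z)" using L S z by (rule holomorphic_derivI)
  have "((\<lambda>w. exp (L w)) has_field_derivative (exp (L z) * deriv L z)) (at z)"
    by (rule DERIV_chain2[OF DERIV_exp Ld])
  then have "(g has_field_derivative (exp (L z) * deriv L z)) (at z)"
    by (rule has_field_derivative_transform_within_open[where S=S]) (use z g S in auto)
  then have "deriv g z = exp (L z) * deriv L z" by (rule DERIV_imp_deriv)
  then show "deriv g z / g z = deriv L z" by (simp add: g[OF z])
  have "((\<lambda>w. exp (L w / c)) has_field_derivative (exp (L z / c) * (deriv L z / c))) (at z)"
    by (rule DERIV_chain2[OF DERIV_exp DERIV_cdivide[OF Ld]])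
  then show "deriv (\<lambda>w. exp (L w / c)) z / exp (L z / c) = deriv L z / c"
    by (simp add: DERIV_imp_deriv)
qed

text \<open>The factor \<open>(z - x0) / (3 d / 4)\<close> has modulus at least \<open>1\<close> on the large circle, so that the quotient keeps the bound
\<open>1\<close>, and modulus at most \<open>2/3\<close> at \<open>w\<close>, so that the quotient is larger than \<open>f\<close> there by the factor \<open>3/2\<close>.\<close>

lemma divide_by_zero_in_disc:
  fixes d D :: real and c x0 w :: complex
  assumes d: "0 < d" "d < D" and w: "w \<in> ball c (d/4)"
    and f: "f holomorphic_on ball c D" and le: "\<forall>z\<in>cball c d. norm (f z) \<le> 1"
    and x0: "x0 \<in> ball c (d/4)" "f x0 = 0"
  obtains f1 where "f1 holomorphic_on ball c D" "\<forall>z\<in>cball c d. norm (f1 z) \<le> 1"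
    "3/2 * norm (f w) \<le> norm (f1 w)"
    "\<And>z. f z = (z - x0) / of_real (3/4*d) * f1 z"
proof -
  define q where "q = (\<lambda>z. if z = x0 then deriv f x0 else (f z - f x0) / (z - x0))"
  have sub: "ball c (d/4) \<subseteq> ball c D" using d by auto
  have q: "q holomorphic_on ball c D" unfolding q_def
    by (rule pole_lemma[OF f]) (use x0 sub in \<open>auto simp: interior_open\<close>)
  define K where "K = (of_real (3/4*d) :: complex)"
  have K: "norm K = 3/4*d" "K \<noteq> 0"
  proof -
    show "norm K = 3/4*d" unfolding K_def norm_of_real using d by simp
    then show "K \<noteq> 0" using d by auto
  qed
  define f1 where "f1 = (\<lambda>z. K * q z)"
  have f1: "f1 holomorphic_on ball c D" unfolding f1_def by (intro holomorphic_intros q)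
  have fq: "f z = (z - x0) * q z" for z using x0 by (simp add: q_def)
  have ff1: "f z = (z - x0) / K * f1 z" for z using K by (simp add: f1_def fq)
  have cD: "cball c d \<subseteq> ball c D" using d by auto
  have b1: "norm (f1 z) \<le> 1" if "z \<in> cball c d" for z
  proof (rule maximum_modulus_frontier[of f1 "cball c d"])
    show "f1 holomorphic_on interior (cball c d)"
      using f1 cD interior_subset holomorphic_on_subset by (metis order_trans)
    show "continuous_on (closure (cball c d)) f1"
      using f1 cD holomorphic_on_imp_continuous_on holomorphic_on_subset by (metis closed_cball closure_closed)
    fix u assume "u \<in> frontier (cball c d)"
    then have u: "dist c u = d" using d by simp
    have "dist c u \<le> dist c x0 + dist x0 u" by (rule dist_triangle)
    then have n: "3/4*d \<le> norm (u - x0)" using u x0(1) by (simp add: dist_norm norm_minus_commute)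
    have "norm (u - x0) / (3/4*d) * norm (f1 u) \<le> 1"
      using le u ff1[of u] K(1) by (metis mem_cball norm_divide norm_mult order_refl)
    moreover have "1 * norm (f1 u) \<le> norm (u - x0) / (3/4*d) * norm (f1 u)"
      using n d by (intro mult_right_mono) (auto simp: field_simps)
    ultimately show "norm (f1 u) \<le> 1" by linarith
  qed (use that in auto)
  have "dist w x0 \<le> dist c w + dist c x0" by (rule dist_triangle3)
  then have "norm (w - x0) \<le> d/2" using w x0(1) by (simp add: dist_norm)
  then have "norm (w - x0) / (3/4*d) \<le> 2/3" using d by (simp add: field_simps)
  then have "norm (w - x0) / (3/4*d) * norm (f1 w) \<le> 2/3 * norm (f1 w)" by (rule mult_right_mono) simp
  moreover have "norm (f w) = norm (w - x0) / (3/4*d) * norm (f1 w)"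
    by (simp only: ff1[of w] norm_mult norm_divide K)
  ultimately have "3/2 * norm (f w) \<le> norm (f1 w)" by simp
  then show ?thesis using that[of f1] f1 b1 ff1 by (simp add: K_def)
qed

text \<open>Zeros are divided out one at a time. Every division multiplies the value at \<open>w\<close> by at least \<open>3/2\<close> while it stays
bounded by \<open>1\<close>, so the process stops after at most \<open>m\<close> steps.\<close>

lemma factor_out_real_zeros:
  fixes c d D :: real
  assumes d: "0 < d" "d < D" and w: "w \<in> ball (of_real c) (d/4)"
  shows "\<lbrakk>f holomorphic_on ball (of_real c) D; \<forall>z\<in>cball (of_real c) d. norm (f z) \<le> 1; (2/3)^m \<le> norm (f w);
      \<forall>z\<in>ball (of_real c) (d/4). f z = 0 \<longrightarrow> Im z = 0\<rbrakk> \<Longrightarrow>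
    \<exists>G xs. G holomorphic_on ball (of_real c) D \<and> (\<forall>z\<in>cball (of_real c) d. norm (G z) \<le> 1) \<and>
      norm (f w) \<le> norm (G w) \<and> (\<forall>z\<in>ball (of_real c) (d/4). G z \<noteq> 0) \<and>
      (\<forall>z\<in>ball (of_real c) (d/4). f z \<noteq> 0 \<longrightarrow>
         deriv f z / f z = deriv G z / G z + (\<Sum>x\<leftarrow>xs. 1 / (z - of_real x)))"
    (is "_ \<Longrightarrow> _ \<Longrightarrow> _ \<Longrightarrow> _ \<Longrightarrow> ?P f")
proof (induction m arbitrary: f)
  case (0 f)
  have nz: "f z \<noteq> 0" if z: "z \<in> ball (of_real c) (d/4)" for z
  proof
    assume "f z = 0"
    obtain f1 where "f1 holomorphic_on ball (of_real c) D" "\<forall>z\<in>cball (of_real c) d. norm (f1 z) \<le> 1"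
      "3/2 * norm (f w) \<le> norm (f1 w)" "\<And>z'. f z' = (z' - z) / of_real (3/4*d) * f1 z'"
      by (rule divide_by_zero_in_disc[OF d w 0(1,2) z \<open>f z = 0\<close>]) (rule that)
    moreover have "w \<in> cball (of_real c) d" using w d by auto
    ultimately show False using 0(3) by fastforce
  qed
  show ?case by (rule exI[of _ f], rule exI[of _ "[]"]) (use 0 nz in simp)
next
  case (Suc m f)
  show ?case
  proof (cases "\<forall>z\<in>ball (of_real c) (d/4). f z \<noteq> 0")
    case True
    show ?thesis by (rule exI[of _ f], rule exI[of _ "[]"]) (use Suc.prems True in simp)
  next
    case False
    then obtain x0 where x0: "x0 \<in> ball (of_real c) (d/4)" "f x0 = 0" by blast
    then have "Im x0 = 0" using Suc.prems by blast
    then obtain x where x: "x0 = of_real x" by (metis complex_is_Real_iff Reals_cases)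
    obtain f1 where f1: "f1 holomorphic_on ball (of_real c) D" "\<forall>z\<in>cball (of_real c) d. norm (f1 z) \<le> 1"
      "3/2 * norm (f w) \<le> norm (f1 w)" and ff1: "\<And>z. f z = (z - x0) / of_real (3/4*d) * f1 z"
      by (rule divide_by_zero_in_disc[OF d w Suc.prems(1,2) x0]) (rule that)
    define K where "K = (of_real (3/4*d) :: complex)"
    have K: "K \<noteq> 0" unfolding K_def of_real_eq_0_iff using d by simp
    have "?P f1"
    proof (rule Suc.IH[OF f1(1,2)])
      show "(2/3)^m \<le> norm (f1 w)" using f1(3) Suc.prems(3) by simp
      show "\<forall>z\<in>ball (of_real c) (d/4). f1 z = 0 \<longrightarrow> Im z = 0"
        using Suc.prems(4) ff1 by simp
    qed
    then obtain G xs where G: "G holomorphic_on ball (of_real c) D" "\<forall>z\<in>cball (of_real c) d. norm (G z) \<le> 1"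
      "norm (f1 w) \<le> norm (G w)" "\<forall>z\<in>ball (of_real c) (d/4). G z \<noteq> 0"
      and Gd: "\<forall>z\<in>ball (of_real c) (d/4). f1 z \<noteq> 0 \<longrightarrow>
         deriv f1 z / f1 z = deriv G z / G z + (\<Sum>x\<leftarrow>xs. 1 / (z - of_real x))" by blast
    show ?thesis
    proof (rule exI[of _ G], rule exI[of _ "x # xs"], intro conjI ballI impI)
      show "norm (f w) \<le> norm (G w)" using G(3) f1(3) norm_ge_zero[of "f w"] by linarith
      fix z assume z: "z \<in> ball (of_real c) (d/4)" and fz: "f z \<noteq> 0"
      have zD: "z \<in> ball (of_real c) D" using z d by auto
      have nz: "z \<noteq> x0" "f1 z \<noteq> 0" using fz ff1[of z] by auto
      have "(f1 has_field_derivative deriv f1 z) (at z)"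
        using f1(1) zD by (intro holomorphic_derivI[where S="ball (of_real c) D"]) auto
      then have "((\<lambda>z. (z - x0) / K * f1 z) has_field_derivative (f1 z / K + (z - x0) / K * deriv f1 z)) (at z)"
        using K by (auto intro!: derivative_eq_intros simp: field_simps)
      moreover have "f = (\<lambda>z. (z - x0) / K * f1 z)" using ff1 by (auto simp: K_def)
      ultimately have df: "deriv f z = f1 z / K + (z - x0) / K * deriv f1 z"
        using DERIV_imp_deriv by metis
      have "deriv f z / f z = 1 / (z - x0) + deriv f1 z / f1 z"
        unfolding df ff1[of z] K_def[symmetric] using K nz by (simp add: field_simps)
      also have "deriv f1 z / f1 z = deriv G z / G z + (\<Sum>x\<leftarrow>xs. 1 / (z - of_real x))"
        using Gd z nz by blast
      finally show "deriv f z / f z = deriv G z / G z + (\<Sum>x\<leftarrow>x # xs. 1 / (z - of_real x))"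
        by (simp add: x)
    qed (use G in auto)
  qed
qed

text \<open>The contribution of real zeros to a logarithmic derivative is a Nevanlinna function up to sign.\<close>

lemma nevanlinna_sum:
  fixes xs :: "real list"
  shows "(\<Sum>x\<leftarrow>xs. 1 / (cnj z - of_real x)) = cnj (\<Sum>x\<leftarrow>xs. 1 / (z - of_real x))"
    and "0 < Im z \<Longrightarrow> Im (\<Sum>x\<leftarrow>xs. 1 / (z - of_real x)) \<le> 0"
proof -
  show "(\<Sum>x\<leftarrow>xs. 1 / (cnj z - of_real x)) = cnj (\<Sum>x\<leftarrow>xs. 1 / (z - of_real x))"
    by (induction xs) auto
  assume z: "0 < Im z"
  have "Im (1 / (z - of_real x)) \<le> 0" for x :: real
    using z by (simp add: Im_divide divide_nonpos_nonneg)
  then show "Im (\<Sum>x\<leftarrow>xs. 1 / (z - of_real x)) \<le> 0"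
    by (induction xs) (auto intro: add_nonpos_nonpos)
qed

text \<open>Write \<open>g k\<close> as a product over its zeros near \<open>c\<close> and a zero-free function \<open>G k\<close>. The roots of \<open>G k\<close> of order
\<open>n k\<close> are bounded by \<open>1\<close> and by \<open>\<epsilon>\<close> from below at \<open>w\<close>, so a subsequence converges near \<open>c\<close> to a zero-free function, and its
logarithmic derivative \<open>\<kappa>\<close> is holomorphic across the real line. What remains, \<open>q - \<kappa>\<close>, is a limit of sums
over real zeros, hence symmetric with nonpositive imaginary part in the upper half-plane; its jump
across the real line is therefore a nonnegative multiple of \<open>\<i>\<close>.\<close>

lemma log_derivative_jump:
  fixes c d D \<epsilon> :: real and g :: "nat \<Rightarrow> complex \<Rightarrow> complex" and n :: "nat \<Rightarrow> nat"
  assumes d: "0 < d" "d < D"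
    and hol: "\<And>k. g k holomorphic_on ball (of_real c) D"
    and nz: "\<And>k z. z \<in> ball (of_real c) D \<Longrightarrow> Im z \<noteq> 0 \<Longrightarrow> g k z \<noteq> 0"
    and le: "\<And>k z. z \<in> cball (of_real c) d \<Longrightarrow> norm (g k z) \<le> 1"
    and n: "\<And>k. 0 < n k"
    and w: "w \<in> ball (of_real c) (d/4)" and \<epsilon>: "0 < \<epsilon>" "\<And>k. \<epsilon> ^ n k \<le> norm (g k w)"
    and conv: "\<And>z. z \<in> ball (of_real c) (d/4) \<Longrightarrow> Im z \<noteq> 0 \<Longrightarrow>
        (\<lambda>k. deriv (g k) z / g k z / of_nat (n k)) \<longlonglongrightarrow> q z"
    and K: "isCont K1 (of_real c)" "isCont K2 (of_real c)"
    and K1: "\<And>z. z \<in> ball (of_real c) (d/4) \<Longrightarrow> 0 < Im z \<Longrightarrow> K1 z = q z"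
    and K2: "\<And>z. z \<in> ball (of_real c) (d/4) \<Longrightarrow> Im z < 0 \<Longrightarrow> K2 z = q z"
  shows "\<exists>t\<ge>0. K2 (of_real c) - K1 (of_real c) = \<i> * of_real t"
proof -
  let ?B = "ball (of_real c :: complex) (d/4)"
  have Bsub: "?B \<subseteq> ball (of_real c) D" "?B \<subseteq> cball (of_real c) d" using d by auto
  define P where "P = (\<lambda>k (G :: complex \<Rightarrow> complex) (xs :: real list). G holomorphic_on ball (of_real c) D \<and>
      (\<forall>z\<in>cball (of_real c) d. norm (G z) \<le> 1) \<and>
      norm (g k w) \<le> norm (G w) \<and> (\<forall>z\<in>?B. G z \<noteq> 0) \<and>
      (\<forall>z\<in>?B. g k z \<noteq> 0 \<longrightarrow>
         deriv (g k) z / g k z = deriv G z / G z + (\<Sum>x\<leftarrow>xs. 1 / (z - of_real x))))"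
  have "\<exists>G xs. P k G xs" for k
  proof -
    have "0 < norm (g k w)" using \<epsilon>(2)[of k] zero_less_power[OF \<epsilon>(1), of "n k"] by linarith
    then obtain m where m: "(2/3)^m < norm (g k w)" using real_arch_pow_inv[of "norm (g k w)" "2/3"] by auto
    show ?thesis unfolding P_def
    proof (rule factor_out_real_zeros[OF d w hol, where m=m])
      show "\<forall>z\<in>cball (of_real c) d. norm (g k z) \<le> 1" using le by blast
      show "(2/3)^m \<le> norm (g k w)" using m by simp
      show "\<forall>z\<in>?B. g k z = 0 \<longrightarrow> Im z = 0" using nz Bsub(1) by blast
    qed
  qed
  then obtain G xs where GP: "\<And>k. P k (G k) (xs k)" by metis
  have G: "\<And>k. G k holomorphic_on ball (of_real c) D"
      "\<And>k z. z\<in>cball (of_real c) d \<Longrightarrow> norm (G k z) \<le> 1"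
      "\<And>k. norm (g k w) \<le> norm (G k w)" "\<And>k z. z\<in>?B \<Longrightarrow> G k z \<noteq> 0"
    and Gd: "\<And>k z. z\<in>?B \<Longrightarrow> g k z \<noteq> 0 \<Longrightarrow>
         deriv (g k) z / g k z = deriv (G k) z / G k z + (\<Sum>x\<leftarrow>xs k. 1 / (z - of_real x))"
    using GP unfolding P_def by blast+
  have "\<exists>L. L holomorphic_on ?B \<and> (\<forall>z\<in>?B. G k z = exp (L z))" for k
    using contractible_imp_holomorphic_log[OF holomorphic_on_subset[OF G(1) Bsub(1)] convex_imp_contractible[OF convex_ball] G(4)]
    by metis
  then obtain L where L: "\<And>k. L k holomorphic_on ?B" "\<And>k z. z \<in> ?B \<Longrightarrow> G k z = exp (L k z)" by metis
  define M where "M = (\<lambda>k z. exp (L k z / of_nat (n k)))"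
  have M: "M k holomorphic_on ?B" for k unfolding M_def by (intro holomorphic_intros L) (use n[of k] in simp)
  have Mn: "M k z ^ n k = G k z" if "z \<in> ?B" for k z
    using L(2)[OF that] n[of k] by (simp add: M_def flip: exp_of_nat_mult)
  have Mle: "norm (M k z) \<le> 1" if "z \<in> ?B" for k z
  proof -
    have "norm (M k z) ^ n k \<le> 1" using Mn[OF that, of k] G(2)[of z k] that Bsub by (metis norm_power subsetD)
    then show ?thesis using n[of k] by (simp add: power_le_one_iff)
  qed
  have Mw: "\<epsilon> \<le> norm (M k w)" for k
  proof -
    have "\<epsilon> ^ n k \<le> norm (M k w) ^ n k" using Mn[OF w, of k] \<epsilon>(2)[of k] G(3)[of k] by (metis norm_power order_trans)
    then show ?thesis using n[of k] by (simp add: power_mono_iff \<epsilon>(1) less_imp_le)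
  qed
  have Md: "deriv (M k) z / M k z = deriv (G k) z / G k z / of_nat (n k)" if z: "z \<in> ?B" for k z
    using log_derivative_of_exp(1)[OF open_ball L(1) L(2) z, of k] log_derivative_of_exp(2)[OF open_ball L(1) L(2) z, of k "of_nat (n k)"]
    by (simp only: M_def)
  obtain Mi r where Mi: "Mi holomorphic_on ?B" and r: "strict_mono (r :: nat \<Rightarrow> nat)"
      and lim: "\<And>x. x \<in> ?B \<Longrightarrow> ((\<lambda>n. M (r n) x) \<longlongrightarrow> Mi x) sequentially"
      and ul: "\<And>K. \<lbrakk>compact K; K \<subseteq> ?B\<rbrakk> \<Longrightarrow> uniform_limit K (M \<circ> r) Mi sequentially"
  proof (rule Montel[OF open_ball, of "range M" "of_real c" "d/4" M])
    show "h holomorphic_on ?B" if "h \<in> range M" for h using that M by auto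
    show "\<exists>B. \<forall>h\<in>range M. \<forall>z\<in>K. norm (h z) \<le> B" if "compact K" "K \<subseteq> ?B" for K
      using that Mle by (intro exI[of _ 1]) auto
  qed auto
  have lucM: "loc_unif_limit ?B (\<lambda>k. M (r k)) Mi" unfolding loc_unif_limit_def using ul by (simp add: o_def)
  have Minz: "Mi z \<noteq> 0" if "z \<in> ?B" for z
  proof -
    have "(\<forall>z\<in>?B. Mi z \<noteq> 0) \<or> (\<forall>z\<in>?B. Mi z = 0)"
      by (rule loc_unif_limit_nonvanishing_limit[OF open_ball connected_ball _ lucM]) (use M in \<open>auto simp: M_def\<close>)
    moreover have "\<epsilon> \<le> norm (Mi w)"
      by (rule tendsto_lowerbound[OF tendsto_norm[OF lim[OF w]]]) (use Mw in auto)
    ultimately show ?thesis using w \<epsilon>(1) that by (metis norm_zero not_less)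
  qed
  define \<kappa> where "\<kappa> = (\<lambda>z. deriv Mi z / Mi z)"
  have kap: "isCont \<kappa> (of_real c)"
  proof -
    have "\<kappa> holomorphic_on ?B" unfolding \<kappa>_def
      by (intro holomorphic_intros holomorphic_deriv Mi open_ball) (use Minz in auto)
    from holomorphic_on_imp_continuous_on[OF this] show ?thesis
      using d by (simp add: continuous_on_eq_continuous_at)
  qed
  define N where "N = (\<lambda>k (z::complex). (\<Sum>x\<leftarrow>xs (r k). 1 / (z - of_real x)) / of_nat (n (r k)))"
  have Nlim: "(\<lambda>k. N k z) \<longlonglongrightarrow> q z - \<kappa> z" if z: "z \<in> ?B" "Im z \<noteq> 0" for z
  proof -
    have "(\<lambda>k. deriv (g (r k)) z / g (r k) z / of_nat (n (r k))) \<longlonglongrightarrow> q z"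
      using LIMSEQ_subseq_LIMSEQ[OF conv[OF z] r] by (simp add: o_def)
    moreover have "(\<lambda>k. deriv (M (r k)) z / M (r k) z) \<longlonglongrightarrow> \<kappa> z"
      unfolding \<kappa>_def by (intro tendsto_divide loc_unif_limit_deriv_tendsto[OF open_ball _ lucM] M z lim Minz)
    ultimately have "(\<lambda>k. deriv (g (r k)) z / g (r k) z / of_nat (n (r k)) - deriv (M (r k)) z / M (r k) z) \<longlonglongrightarrow> q z - \<kappa> z"
      by (rule tendsto_diff)
    moreover have "deriv (g (r k)) z / g (r k) z / of_nat (n (r k)) - deriv (M (r k)) z / M (r k) z = N k z" for k
    proof -
      have "g (r k) z \<noteq> 0" using nz z Bsub by blast
      then show ?thesis unfolding N_def Gd[OF z(1) \<open>g (r k) z \<noteq> 0\<close>] Md[OF z(1)]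
        by (simp add: add_divide_distrib)
    qed
    ultimately show ?thesis by simp
  qed
  define \<nu> where "\<nu> = (\<lambda>z. q z - \<kappa> z)"
  have cB: "cnj z \<in> ?B" if "z \<in> ?B" for z
  proof -
    have "dist (of_real c) (cnj z) = norm (cnj (of_real c - z))" by (simp add: dist_norm)
    then have "dist (of_real c) (cnj z) = dist (of_real c) z" unfolding complex_mod_cnj dist_norm .
    then show ?thesis using that by simp
  qed
  have nucnj: "\<nu> (cnj z) = cnj (\<nu> z)" if z: "z \<in> ?B" "Im z \<noteq> 0" for z
  proof -
    have "(\<lambda>k. N k (cnj z)) \<longlonglongrightarrow> \<nu> (cnj z)" unfolding \<nu>_def by (rule Nlim[OF cB]) (use z in auto)
    moreover have "N k (cnj z) = cnj (N k z)" for k unfolding N_def nevanlinna_sum(1) by simp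
    moreover have "(\<lambda>k. cnj (N k z)) \<longlonglongrightarrow> cnj (\<nu> z)" unfolding \<nu>_def by (intro tendsto_intros Nlim z)
    ultimately show ?thesis using LIMSEQ_unique by simp
  qed
  have nuim: "Im (\<nu> z) \<le> 0" if z: "z \<in> ?B" "0 < Im z" for z
  proof (rule tendsto_upperbound[OF tendsto_Im[of "\<lambda>k. N k z"]])
    show "(\<lambda>k. N k z) \<longlonglongrightarrow> \<nu> z" unfolding \<nu>_def by (rule Nlim) (use z in auto)
    show "\<forall>\<^sub>F k in sequentially. Im (N k z) \<le> 0"
      using nevanlinna_sum(2)[OF z(2)] by (auto simp: N_def divide_nonpos_nonneg)
  qed auto
  define p where "p = (\<lambda>t::real. of_real c + \<i> * of_real t)"
  have p0: "(p \<longlongrightarrow> of_real c) (at_right 0)"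
  proof -
    have "(p \<longlongrightarrow> of_real c + \<i> * of_real 0) (at_right 0)" unfolding p_def by (intro tendsto_intros)
    then show ?thesis by simp
  qed
  have p0c: "((\<lambda>t. cnj (p t)) \<longlongrightarrow> of_real c) (at_right 0)"
    using tendsto_cnj[OF p0] by simp
  have evp: "\<forall>\<^sub>F t in at_right 0. p t \<in> ?B \<and> 0 < Im (p t)"
  proof -
    have "\<forall>\<^sub>F t in at_right (0::real). t \<in> {0<..<d/4}" by (rule eventually_at_right_real) (use d in simp)
    then show ?thesis by (rule eventually_mono) (auto simp: p_def dist_norm norm_mult)
  qed
  have l1: "((\<lambda>t. \<nu> (p t)) \<longlongrightarrow> K1 (of_real c) - \<kappa> (of_real c)) (at_right 0)"
  proof (rule Lim_transform_eventually)
    show "((\<lambda>t. K1 (p t) - \<kappa> (p t)) \<longlongrightarrow> K1 (of_real c) - \<kappa> (of_real c)) (at_right 0)"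
      by (intro tendsto_diff isCont_tendsto_compose[OF K(1) p0] isCont_tendsto_compose[OF kap p0])
    show "\<forall>\<^sub>F t in at_right 0. K1 (p t) - \<kappa> (p t) = \<nu> (p t)"
      using evp by eventually_elim (simp add: \<nu>_def K1)
  qed
  have l2: "((\<lambda>t. cnj (\<nu> (p t))) \<longlongrightarrow> K2 (of_real c) - \<kappa> (of_real c)) (at_right 0)"
  proof (rule Lim_transform_eventually)
    show "((\<lambda>t. K2 (cnj (p t)) - \<kappa> (cnj (p t))) \<longlongrightarrow> K2 (of_real c) - \<kappa> (of_real c)) (at_right 0)"
      by (intro tendsto_diff isCont_tendsto_compose[OF K(2) p0c] isCont_tendsto_compose[OF kap p0c])
    show "\<forall>\<^sub>F t in at_right 0. K2 (cnj (p t)) - \<kappa> (cnj (p t)) = cnj (\<nu> (p t))"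
      using evp
    proof eventually_elim
      case (elim t)
      have "K2 (cnj (p t)) = q (cnj (p t))" by (rule K2[OF cB]) (use elim in auto)
      moreover have "\<nu> (cnj (p t)) = cnj (\<nu> (p t))" by (rule nucnj) (use elim in auto)
      ultimately show ?case by (simp add: \<nu>_def)
    qed
  qed
  have eq: "K2 (of_real c) - \<kappa> (of_real c) = cnj (K1 (of_real c) - \<kappa> (of_real c))"
    by (rule tendsto_unique[OF _ l2 tendsto_cnj[OF l1]]) simp
  have im: "Im (K1 (of_real c) - \<kappa> (of_real c)) \<le> 0"
    by (rule tendsto_upperbound[OF tendsto_Im[OF l1]]) (use evp nuim in \<open>auto elim: eventually_mono\<close>)
  show ?thesis
  proof (intro exI[of _ "- 2 * Im (K1 (of_real c) - \<kappa> (of_real c))"] conjI)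
    have "K2 (of_real c) - K1 (of_real c) = cnj (K1 (of_real c) - \<kappa> (of_real c)) - (K1 (of_real c) - \<kappa> (of_real c))"
      unfolding eq[symmetric] by simp
    then show "K2 (of_real c) - K1 (of_real c) = \<i> * of_real (- 2 * Im (K1 (of_real c) - \<kappa> (of_real c)))"
      by (simp add: complex_eq_iff)
  qed (use im in simp)
qed

section \<open>Opposite limits on the sectors\<close>

text \<open>The proof normalizes \<open>g k\<close> by roots \<open>E k\<close> of order \<open>n k\<close>, chosen such that \<open>|E k p|\<close> lies between \<open>e\<close> and \<open>e\<^sup>2\<close> at a
point \<open>p\<close> of the middle sector for large \<open>k\<close>. The roots omit \<open>0\<close> and \<open>1\<close> on the sectors together with \<open>g k\<close>, so they are
subject to the same convergence theorems; now all limits are finite, and the limit \<open>Ei\<close> is a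
zero-free function on the slit disc.\<close>

lemma opposite_limits_force_angles:
  fixes g :: "nat \<Rightarrow> complex \<Rightarrow> complex"
  assumes \<alpha>: "- pi < \<alpha>1" "\<alpha>1 < \<alpha>2" "\<alpha>2 < pi"
    and hol: "\<And>k. g k holomorphic_on ball 0 1 - \<real>\<^sub>\<le>\<^sub>0"
    and nz: "\<And>k z. z \<in> ball 0 1 - \<real>\<^sub>\<le>\<^sub>0 \<Longrightarrow> g k z \<noteq> 0"
    and one: "\<And>k z. z \<in> sector (- pi) \<alpha>1 \<union> sector \<alpha>1 \<alpha>2 \<union> sector \<alpha>2 pi \<Longrightarrow> g k z \<noteq> 1"
    and up: "loc_unif_limit (sector \<alpha>1 \<alpha>2) (\<lambda>k z. inverse (g k z)) (\<lambda>z. 0)"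
    and lo: "loc_unif_limit (sector (- pi) \<alpha>1) g (\<lambda>z. 0)" "loc_unif_limit (sector \<alpha>2 pi) g (\<lambda>z. 0)"
    and near: "\<And>c. -1 < c \<Longrightarrow> c < 0 \<Longrightarrow> \<exists>d>0. ball (complex_of_real c) d \<subseteq> ball 0 1 \<and>
        (\<forall>\<^sub>F k in sequentially. g k holomorphic_on ball (of_real c) d \<and> (\<forall>z\<in>ball (of_real c) d. norm (g k z) \<le> 1))"
  shows "\<alpha>2 - \<alpha>1 = pi \<or> (\<alpha>1 + \<alpha>2 = 0 \<and> \<alpha>2 - \<alpha>1 > pi)"
proof -
  define \<Omega> :: "complex set" where "\<Omega> = ball 0 1 - \<real>\<^sub>\<le>\<^sub>0"
  define T where "T = sector \<alpha>1 \<alpha>2"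
  define S1 where "S1 = sector (- pi) \<alpha>1"
  define S2 where "S2 = sector \<alpha>2 pi"
  have Om: "open \<Omega>" "connected \<Omega>" "contractible \<Omega>"
    unfolding \<Omega>_def using starlike_slit_disc open_slit_disc
    by (auto simp: starlike_imp_contractible starlike_imp_connected)
  have sub: "T \<subseteq> \<Omega>" "S1 \<subseteq> \<Omega>" "S2 \<subseteq> \<Omega>"
    unfolding T_def S1_def S2_def \<Omega>_def using \<alpha> by (intro sector_subset_slit_disc; simp)+
  have opn: "open T" "open S1" "open S2" and conn: "connected T" "connected S1" "connected S2"
    unfolding T_def S1_def S2_def by (simp_all add: open_sector connected_sector)
  have "T \<noteq> {}" "S1 \<noteq> {}" "S2 \<noteq> {}" unfolding T_def S1_def S2_def using \<alpha> by (simp_all add: sector_nonempty)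
  then obtain p p1 p2 where p: "p \<in> T" "p1 \<in> S1" "p2 \<in> S2" by blast
  define n where "n = (\<lambda>k. max 1 (nat \<lfloor>ln (norm (g k p))\<rfloor>))"
  have n1: "1 \<le> n k" for k by (simp add: n_def)
  have "\<exists>L. L holomorphic_on \<Omega> \<and> (\<forall>z\<in>\<Omega>. g k z = exp (L z))" for k
    using contractible_imp_holomorphic_log[OF hol[folded \<Omega>_def] Om(3) nz[folded \<Omega>_def]] by metis
  then obtain L where L: "\<And>k. L k holomorphic_on \<Omega>" "\<And>k z. z \<in> \<Omega> \<Longrightarrow> g k z = exp (L k z)" by metis
  define E where "E = (\<lambda>k z. exp (L k z / of_nat (n k)))"
  have n0: "of_nat (n k) \<noteq> (0::complex)" for k using n1[of k] by simp
  have E: "E k holomorphic_on \<Omega>" for k unfolding E_def by (intro holomorphic_intros L n0)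
  have En: "E k z ^ n k = g k z" if "z \<in> \<Omega>" for k z
    using L(2)[OF that] n0[of k] by (simp add: E_def flip: exp_of_nat_mult)
  have E0: "E k z \<noteq> 0" for k z by (simp add: E_def)
  have E1: "E k z \<noteq> 1" if "z \<in> T \<union> S1 \<union> S2" for k z
  proof
    assume "E k z = 1"
    then have "g k z = 1" using En[of z k] that sub by auto
    then show False using one[of z k] that by (auto simp: T_def S1_def S2_def)
  qed
  have Eabs: "norm (E k z) ^ n k = norm (g k z)" if "z \<in> \<Omega>" for k z
    using En[OF that, of k] by (metis norm_power)
  have Ele: "norm (E k z) \<le> 1" if "z \<in> \<Omega>" "norm (g k z) \<le> 1" for k z
    using Eabs[OF that(1), of k] that(2) n1[of k] by (metis norm_ge_zero not_one_le_zero power_le_one_iff)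
  have Ege: "1 \<le> norm (E k z)" if "z \<in> \<Omega>" "1 \<le> norm (g k z)" for k z
  proof (rule ccontr)
    assume "\<not> 1 \<le> norm (E k z)"
    then have "norm (E k z) < 1" by simp
    moreover from this have "norm (E k z) ^ n k \<le> norm (E k z) ^ 1"
      using n1[of k] by (intro power_decreasing) auto
    ultimately show False using Eabs[OF that(1), of k] that(2) by simp
  qed
  have Ep_le: "norm (E k p) \<le> exp 2" for k
  proof -
    have gp: "0 < norm (g k p)" using nz p sub by (auto simp: \<Omega>_def)
    have "ln (norm (g k p)) \<le> real (n k) + 1" unfolding n_def by linarith
    also have "\<dots> \<le> 2 * real (n k)" using n1[of k] by simp
    finally have "exp (ln (norm (g k p))) \<le> exp (real (n k) * 2)" by simp
    then have "norm (g k p) \<le> exp (real (n k) * 2)" by (simp only: exp_ln[OF gp])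
    moreover have "p \<in> \<Omega>" using p sub by blast
    ultimately have "norm (E k p) ^ n k \<le> exp 2 ^ n k"
      using Eabs[of p k] by (simp only: exp_of_nat_mult)
    then show ?thesis using n1[of k] by (simp add: power_mono_iff)
  qed
  have gup: "\<forall>\<^sub>F k in sequentially. C \<le> norm (g k z)" if "z \<in> T" "C > 0" for z C
  proof -
    have "(\<lambda>k. norm (inverse (g k z))) \<longlonglongrightarrow> norm (0::complex)"
      using loc_unif_limit_tendsto[OF up that(1)[unfolded T_def]] by (rule tendsto_norm)
    then have "\<forall>\<^sub>F k in sequentially. norm (inverse (g k z)) < inverse C"
      by (rule order_tendstoD(2)) (use that in simp)
    then show ?thesis
    proof eventually_elim
      case (elim k)
      have "g k z \<noteq> 0" using nz that sub by (auto simp: \<Omega>_def)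
      then have "0 < norm (g k z)" by simp
      moreover have "inverse (norm (g k z)) < inverse C" using elim by (simp only: norm_inverse)
      ultimately have "C < norm (g k z)" by (rule inverse_less_imp_less[rotated])
      then show ?case by simp
    qed
  qed
  have glo: "\<forall>\<^sub>F k in sequentially. norm (g k z) \<le> 1" if "z \<in> S1 \<union> S2" for z
  proof -
    have "(\<lambda>k. g k z) \<longlonglongrightarrow> 0" using that loc_unif_limit_tendsto[OF lo(1)] loc_unif_limit_tendsto[OF lo(2)] by (auto simp: S1_def S2_def)
    then have "(\<lambda>k. norm (g k z)) \<longlonglongrightarrow> 0" by (rule tendsto_norm_zero)
    then have "\<forall>\<^sub>F k in sequentially. norm (g k z) < 1" by (rule order_tendstoD(2)) simp
    then show ?thesis by eventually_elim simp
  qed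
  have Ep_ge: "\<forall>\<^sub>F k in sequentially. exp 1 \<le> norm (E k p)"
    using gup[OF p(1) exp_gt_zero[of 1]]
  proof eventually_elim
    case (elim k)
    have "exp 1 \<le> norm (g k p)" using elim by simp
    then have gp: "0 < norm (g k p)" "1 \<le> ln (norm (g k p))"
      by (smt (verit) exp_gt_zero, metis exp_gt_zero ln_exp ln_mono)
    have "real (n k) \<le> ln (norm (g k p))" using gp(2) unfolding n_def by linarith
    then have "exp (real (n k)) \<le> norm (g k p)" using gp(1) by (metis exp_le_cancel_iff exp_ln)
    moreover have "p \<in> \<Omega>" using p sub by blast
    ultimately have "exp (real (n k) * 1) \<le> norm (E k p) ^ n k" using Eabs[of p k] by simp
    then have "exp 1 ^ n k \<le> norm (E k p) ^ n k" by (simp only: exp_of_nat_mult)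
    then show ?case using n1[of k] by (simp add: power_mono_iff)
  qed

  obtain r1 e1 where r1: "strict_mono r1" and l1: "loc_unif_limit T (\<lambda>k. E (r1 k)) e1"
  proof -
    have "\<exists>r g. strict_mono r \<and> loc_unif_limit T (\<lambda>k. E (r k)) g"
      by (rule Montel_omitting_finite[OF opn(1) conn(1) p(1), where B = "exp 2"])
         (use holomorphic_on_subset[OF E sub(1)] E0 E1 Ep_le in auto)
    then show ?thesis using that by metis
  qed
  obtain r2 e2 where r2: "strict_mono r2" and l2: "loc_unif_limit S1 (\<lambda>k. E (r1 (r2 k))) e2"
  proof -
    have "\<exists>r g. strict_mono r \<and> loc_unif_limit S1 (\<lambda>k. E (r1 (r k))) g"
    proof (rule Montel_omitting_finite[OF opn(2) conn(2) p(2), where B = 1])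
      show "E (r1 k) holomorphic_on S1" for k using E sub(2) by (rule holomorphic_on_subset)
      show "E (r1 k) z \<noteq> 0 \<and> E (r1 k) z \<noteq> 1" if "z \<in> S1" for k z using E0 E1 that by simp
      have "\<forall>\<^sub>F k in sequentially. norm (g k p1) \<le> 1" using glo p(2) by simp
      then have "\<forall>\<^sub>F k in sequentially. norm (E k p1) \<le> 1"
        by (rule eventually_mono) (use Ele p(2) sub(2) in blast)
      then show "\<forall>\<^sub>F k in sequentially. norm (E (r1 k) p1) \<le> 1" by (rule eventually_subseq[OF r1])
    qed
    then show ?thesis using that by metis
  qed
  obtain r3 e3 where r3: "strict_mono r3" and l3: "loc_unif_limit S2 (\<lambda>k. E (r1 (r2 (r3 k)))) e3"
  proof -
    have "\<exists>r g. strict_mono r \<and> loc_unif_limit S2 (\<lambda>k. E (r1 (r2 (r k)))) g"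
    proof (rule Montel_omitting_finite[OF opn(3) conn(3) p(3), where B = 1])
      show "E (r1 (r2 k)) holomorphic_on S2" for k using E sub(3) by (rule holomorphic_on_subset)
      show "E (r1 (r2 k)) z \<noteq> 0 \<and> E (r1 (r2 k)) z \<noteq> 1" if "z \<in> S2" for k z using E0 E1 that by simp
      have "\<forall>\<^sub>F k in sequentially. norm (g k p2) \<le> 1" using glo p(3) by simp
      then have "\<forall>\<^sub>F k in sequentially. norm (E k p2) \<le> 1"
        by (rule eventually_mono) (use Ele p(3) sub(3) in blast)
      then show "\<forall>\<^sub>F k in sequentially. norm (E (r1 (r2 k)) p2) \<le> 1"
        by (rule eventually_subseq[OF r2, OF eventually_subseq[OF r1]])
    qed
    then show ?thesis using that by metis
  qed
  \<comment> \<open>Along a common subsequence the roots converge on all three sectors, and hence across the two rays between them.\<close>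
  define R where "R = (\<lambda>k. r1 (r2 (r3 k)))"
  have R: "strict_mono R" using strict_mono_o[OF r1 strict_mono_o[OF r2 r3]] by (simp add: R_def o_def)
  define E' where "E' = (\<lambda>k. E (R k))"
  have E': "E' k holomorphic_on \<Omega>" for k unfolding E'_def by (rule E)
  have lT: "loc_unif_limit T E' e1"
    using loc_unif_limit_subseq[OF loc_unif_limit_subseq[OF l1 r2] r3] by (simp add: E'_def R_def)
  have lS1: "loc_unif_limit S1 E' e2" using loc_unif_limit_subseq[OF l2 r3] by (simp add: E'_def R_def)
  have lS2: "loc_unif_limit S2 E' e3" using l3 by (simp add: E'_def R_def)
  have cross: "\<exists>d l. 0 < d \<and> uniform_limit (ball (exp (Complex x \<alpha>)) d) E' l sequentially"
    if x: "x < 0" and a: "a < \<alpha>" "\<alpha> < b" "- pi \<le> a" "b \<le> pi"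
      and la: "loc_unif_limit (sector a \<alpha>) E' ea" and lb: "loc_unif_limit (sector \<alpha> b) E' eb"
      and om: "\<And>k z. z \<in> sector a \<alpha> \<union> sector \<alpha> b \<Longrightarrow> E' k z \<noteq> 1" for x \<alpha> a b ea eb
  proof -
    define \<eta> where "\<eta> = min (\<alpha> - a) (b - \<alpha>)"
    have \<eta>: "0 < \<eta>" using a by (simp add: \<eta>_def)
    have s1: "sector \<alpha> (\<alpha> + \<eta>) \<subseteq> sector \<alpha> b" and s2: "sector (\<alpha> - \<eta>) \<alpha> \<subseteq> sector a \<alpha>"
      by (rule sector_mono; simp add: \<eta>_def min_def)+
    have s3: "sector (\<alpha> - \<eta>) (\<alpha> + \<eta>) \<subseteq> \<Omega>"
      unfolding \<Omega>_def using a by (intro sector_subset_slit_disc) (auto simp: \<eta>_def)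
    have "\<exists>d l. 0 < d \<and> ball (exp (Complex x \<alpha>)) d \<subseteq> sector (\<alpha> - \<eta>) (\<alpha> + \<eta>) \<and> l holomorphic_on ball (exp (Complex x \<alpha>)) d \<and>
       uniform_limit (ball (exp (Complex x \<alpha>)) d) E' l sequentially"
    proof (rule ray_crossing[OF x \<eta> refl])
      show "E' k holomorphic_on sector (\<alpha> - \<eta>) (\<alpha> + \<eta>)" for k using E' s3 by (rule holomorphic_on_subset)
      show "E' k z \<noteq> 0 \<and> E' k z \<noteq> 1" if "z \<in> sector (\<alpha> - \<eta>) \<alpha> \<union> sector \<alpha> (\<alpha> + \<eta>)" for k z
        using om[of z k] that s1 s2 by (auto simp: E'_def E0)
      show "loc_unif_limit (sector \<alpha> (\<alpha> + \<eta>)) E' eb" using lb s1 by (rule loc_unif_limit_subset)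
      show "loc_unif_limit (sector (\<alpha> - \<eta>) \<alpha>) E' ea" using la s2 by (rule loc_unif_limit_subset)
    qed
    then show ?thesis by metis
  qed
  have E'1: "E' k z \<noteq> 1" if "z \<in> T \<union> S1 \<union> S2" for k z using E1[OF that] by (simp add: E'_def)
  define Ei where "Ei = (\<lambda>z. lim (\<lambda>k. E' k z))"
  have lE: "loc_unif_limit \<Omega> E' Ei" unfolding Ei_def
  proof (rule loc_unif_limit_of_local_limits)
    fix z assume "z \<in> \<Omega>"
    then obtain x \<theta> where z: "x < 0" "- pi < \<theta>" "\<theta> < pi" "z = exp (Complex x \<theta>)"
      unfolding \<Omega>_def by (rule slit_disc_polar)
    consider "\<theta> < \<alpha>1" | "\<theta> = \<alpha>1" | "\<alpha>1 < \<theta>" "\<theta> < \<alpha>2" | "\<theta> = \<alpha>2" | "\<alpha>2 < \<theta>" by linarith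
    then show "\<exists>d l. 0 < d \<and> uniform_limit (ball z d) E' l sequentially"
    proof cases
      case 1
      then have "z \<in> S1" unfolding S1_def using z by (intro sector_I[OF z(4)]) auto
      then show ?thesis using loc_unif_limit_local[OF lS1 opn(2)] by metis
    next
      case 2
      show ?thesis unfolding z(4) 2
        by (rule cross[of x "- pi" \<alpha>1 \<alpha>2]) (use z \<alpha> lT lS1 E'1 in \<open>auto simp: T_def S1_def\<close>)
    next
      case 3
      then have "z \<in> T" unfolding T_def using z by (intro sector_I[OF z(4)]) auto
      then show ?thesis using loc_unif_limit_local[OF lT opn(1)] by metis
    next
      case 4
      show ?thesis unfolding z(4) 4
        by (rule cross[of x \<alpha>1 \<alpha>2 pi]) (use z \<alpha> lT lS2 E'1 in \<open>auto simp: T_def S2_def\<close>)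
    next
      case 5
      then have "z \<in> S2" unfolding S2_def using z by (intro sector_I[OF z(4)]) auto
      then show ?thesis using loc_unif_limit_local[OF lS2 opn(3)] by metis
    qed
  qed
  have Ei: "Ei holomorphic_on \<Omega>" by (rule loc_unif_limit_holomorphic[OF Om(1) E' lE])
  have Eilim: "(\<lambda>k. norm (E' k z)) \<longlonglongrightarrow> norm (Ei z)" if "z \<in> \<Omega>" for z
    using loc_unif_limit_tendsto[OF lE that] by (rule tendsto_norm)
  have Eip: "exp 1 \<le> norm (Ei p)"
  proof (rule tendsto_lowerbound[OF Eilim])
    show "\<forall>\<^sub>F k in sequentially. exp 1 \<le> norm (E' k p)" unfolding E'_def using R Ep_ge by (rule eventually_subseq)
  qed (use p sub in auto)
  have Einz: "Ei z \<noteq> 0" if "z \<in> \<Omega>" for z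
  proof -
    have "(\<forall>z\<in>\<Omega>. Ei z \<noteq> 0) \<or> (\<forall>z\<in>\<Omega>. Ei z = 0)"
      by (rule loc_unif_limit_nonvanishing_limit[OF Om(1,2) E' lE]) (simp add: E'_def E0)
    moreover have "Ei p \<noteq> 0" using Eip by (metis exp_gt_zero norm_zero not_less)
    ultimately show ?thesis using p sub that by blast
  qed
  have EiT: "1 \<le> norm (Ei z)" if "z \<in> T" for z
  proof (rule tendsto_lowerbound[OF Eilim])
    have "\<forall>\<^sub>F k in sequentially. 1 \<le> norm (E k z)"
      using gup[OF that zero_less_one] by (rule eventually_mono) (use Ege that sub in blast)
    then show "\<forall>\<^sub>F k in sequentially. 1 \<le> norm (E' k z)" unfolding E'_def by (rule eventually_subseq[OF R])
  qed (use that sub in auto)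
  have EiS: "norm (Ei z) \<le> 1" if "z \<in> S1 \<union> S2" for z
  proof (rule tendsto_upperbound[OF Eilim])
    have "\<forall>\<^sub>F k in sequentially. norm (E k z) \<le> 1"
      using glo[OF that] by (rule eventually_mono) (use Ele that sub in blast)
    then show "\<forall>\<^sub>F k in sequentially. norm (E' k z) \<le> 1" unfolding E'_def by (rule eventually_subseq[OF R])
  qed (use that sub in auto)
  obtain h where h: "h holomorphic_on \<Omega>" "\<And>z. z \<in> \<Omega> \<Longrightarrow> Ei z = exp (h z)"
    using contractible_imp_holomorphic_log[OF Ei Om(3) Einz] by metis
  have Eih: "norm (Ei z) = exp (Re (h z))" if "z \<in> \<Omega>" for z using h(2)[OF that] by simp
  \<comment> \<open>On the middle sector \<open>|Ei| \<ge> 1\<close>; equality is impossible by the maximum principle for \<open>1 / Ei\<close>, as \<open>|Ei p| \<ge> e\<close>.\<close>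
  have hpos: "0 < Re (h z)" if z: "z \<in> T" for z
  proof (rule ccontr)
    assume "\<not> 0 < Re (h z)"
    then have "norm (Ei z) \<le> 1" using Eih[of z] z sub by auto
    then have Ez: "norm (Ei z) = 1" using EiT[OF z] by simp
    have "(\<lambda>z. inverse (Ei z)) constant_on T"
    proof (rule maximum_modulus_principle[OF _ opn(1) conn(1) opn(1) order_refl z])
      show "(\<lambda>z. inverse (Ei z)) holomorphic_on T"
        using holomorphic_on_subset[OF Ei sub(1)] Einz sub by (intro holomorphic_intros) auto
      show "norm (inverse (Ei w)) \<le> norm (inverse (Ei z))" if "w \<in> T" for w
        using EiT[OF that] Ez by (simp add: norm_inverse inverse_le_1_iff)
    qed
    then have "inverse (Ei p) = inverse (Ei z)" unfolding constant_on_def using p(1) z by metis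
    then have "norm (Ei p) = 1" using Ez by simp
    then show False using Eip by (smt (verit) exp_ge_add_one_self)
  qed
  have hneg: "Re (h z) \<le> 0" if "z \<in> S1 \<union> S2" for z
  proof -
    have "exp (Re (h z)) \<le> 1" using EiS[OF that] Eih[of z] that sub by auto
    then show ?thesis by simp
  qed
  have hcont: "isCont h z" if "z \<in> \<Omega>" for z
    using holomorphic_on_imp_continuous_on[OF h(1)] Om(1) that by (simp add: continuous_on_eq_continuous_at)
  have bOm: "exp (Complex x \<theta>) \<in> \<Omega>" if "x < 0" "- pi < \<theta>" "\<theta> < pi" for x \<theta>
    unfolding \<Omega>_def using that by (intro exp_strip_in_slit_disc) auto
  have evr: "\<forall>\<^sub>F t in at_right (0::real). t \<in> {0<..<s}" if "0 < s" for s
    by (rule eventually_at_right_real[OF that])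
  have lim_ge: "0 \<le> Re (h z)" if z: "z \<in> \<Omega>" and q: "(q \<longlongrightarrow> z) (at_right (0::real))" and s: "0 < s"
      and qT: "\<And>t. t \<in> {0<..<s} \<Longrightarrow> q t \<in> T" for z q s
  proof (rule tendsto_lowerbound[OF tendsto_Re[OF isCont_tendsto_compose[OF hcont[OF z] q]]])
    show "\<forall>\<^sub>F t in at_right 0. 0 \<le> Re (h (q t))"
      using evr[OF s] by (rule eventually_mono) (use qT hpos in \<open>auto intro: less_imp_le\<close>)
  qed simp
  have lim_le: "Re (h z) \<le> 0" if z: "z \<in> \<Omega>" and q: "(q \<longlongrightarrow> z) (at_right (0::real))" and s: "0 < s"
      and qT: "\<And>t. t \<in> {0<..<s} \<Longrightarrow> q t \<in> S1 \<union> S2" for z q s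
  proof (rule tendsto_upperbound[OF tendsto_Re[OF isCont_tendsto_compose[OF hcont[OF z] q]]])
    show "\<forall>\<^sub>F t in at_right 0. Re (h (q t)) \<le> 0"
      using evr[OF s] by (rule eventually_mono) (use qT hneg in blast)
  qed simp
  have bd1: "Re (h (exp (Complex x \<alpha>1))) = 0" if x: "x < 0" for x
  proof (rule antisym)
    have z: "exp (Complex x \<alpha>1) \<in> \<Omega>" using x \<alpha> by (intro bOm) auto
    show "0 \<le> Re (h (exp (Complex x \<alpha>1)))"
      by (rule lim_ge[OF z exp_rotate_tendsto(1), of "\<alpha>2 - \<alpha>1"])
         (use x \<alpha> in \<open>auto simp: T_def intro!: sector_I\<close>)
    show "Re (h (exp (Complex x \<alpha>1))) \<le> 0"
      by (rule lim_le[OF z exp_rotate_tendsto(2), of "\<alpha>1 + pi"])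
         (use x \<alpha> in \<open>auto simp: S1_def intro!: sector_I\<close>)
  qed
  have bd2: "Re (h (exp (Complex x \<alpha>2))) = 0" if x: "x < 0" for x
  proof (rule antisym)
    have z: "exp (Complex x \<alpha>2) \<in> \<Omega>" using x \<alpha> by (intro bOm) auto
    show "0 \<le> Re (h (exp (Complex x \<alpha>2)))"
      by (rule lim_ge[OF z exp_rotate_tendsto(2), of "\<alpha>2 - \<alpha>1"])
         (use x \<alpha> in \<open>auto simp: T_def intro!: sector_I\<close>)
    show "Re (h (exp (Complex x \<alpha>2))) \<le> 0"
      by (rule lim_le[OF z exp_rotate_tendsto(1), of "pi - \<alpha>2"])
         (use x \<alpha> in \<open>auto simp: S2_def intro!: sector_I\<close>)
  qed
  have ld: "(\<lambda>k. deriv (g (R k)) z / g (R k) z / of_nat (n (R k))) \<longlonglongrightarrow> deriv h z" if z: "z \<in> \<Omega>" for z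
  proof -
    have "(\<lambda>k. deriv (E' k) z / E' k z) \<longlonglongrightarrow> deriv Ei z / Ei z"
      by (intro tendsto_divide loc_unif_limit_deriv_tendsto[OF Om(1) E' lE z] loc_unif_limit_tendsto[OF lE z] Einz z)
    moreover have "deriv (E k) z / E k z = deriv (g k) z / g k z / of_nat (n k)" for k
      using log_derivative_of_exp(1)[OF Om(1) L(1) L(2) z, of k] log_derivative_of_exp(2)[OF Om(1) L(1) L(2) z, of k "of_nat (n k)"]
      by (simp only: E_def)
    moreover have "deriv Ei z / Ei z = deriv h z" by (rule log_derivative_of_exp(1)[OF Om(1) h z])
    ultimately show ?thesis by (simp add: E'_def)
  qed
  show ?thesis
  proof (rule sector_angle_dichotomy[OF \<alpha> h(1)[unfolded \<Omega>_def]])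
    show "0 < Re (h z)" if "z \<in> sector \<alpha>1 \<alpha>2" for z using hpos that by (simp add: T_def)
    show "Re (h z) \<le> 0" if "z \<in> sector (- pi) \<alpha>1" for z using hneg that by (simp add: S1_def)
    show "Re (h z) \<le> 0" if "z \<in> sector \<alpha>2 pi" for z using hneg that by (simp add: S2_def)
    show "Re (h (exp (Complex x \<alpha>1))) = 0" if "x < 0" for x using bd1 that .
    show "Re (h (exp (Complex x \<alpha>2))) = 0" if "x < 0" for x using bd2 that .
    fix c d :: real and H1 H2
    assume c: "-1 < c" "c < 0" and d: "0 < d" and sub1: "ball (complex_of_real c) d \<subseteq> ball 0 1"
      and H1: "H1 holomorphic_on ball (of_real c) d" and H2: "H2 holomorphic_on ball (of_real c) d"
      and H1h: "\<And>z. z \<in> ball (of_real c) d \<Longrightarrow> 0 < Im z \<Longrightarrow> H1 z = h z"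
      and H2h: "\<And>z. z \<in> ball (of_real c) d \<Longrightarrow> Im z < 0 \<Longrightarrow> H2 z = h z"
    obtain d0 where d0: "d0 > 0" "\<forall>\<^sub>F k in sequentially. g k holomorphic_on ball (of_real c) d0 \<and> (\<forall>z\<in>ball (of_real c) d0. norm (g k z) \<le> 1)"
      using near[OF c] by blast
    define D where "D = min d0 d"
    have D: "0 < D" "D \<le> d0" "D \<le> d" using d d0 by (auto simp: D_def)
    define d1 where "d1 = D/2"
    have d1: "0 < d1" "d1 < D" using D by (auto simp: d1_def)
    have inOm: "z \<in> \<Omega>" if "z \<in> ball (of_real c) D" "Im z \<noteq> 0" for z
      using that sub1 D by (auto simp: \<Omega>_def complex_nonpos_Reals_iff subset_iff)
    define w where "w = of_real c + \<i> * of_real (d1/8)"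
    have w: "w \<in> ball (of_real c) (d1/4)" using d1 by (simp add: w_def dist_norm norm_mult)
    have wOm: "w \<in> \<Omega>" by (rule inOm) (use w d1 in \<open>auto simp: w_def dist_norm norm_mult\<close>)
    define \<epsilon> where "\<epsilon> = norm (Ei w) / 2"
    have \<epsilon>: "0 < \<epsilon>" "\<epsilon> < norm (Ei w)" using Einz[OF wOm] by (auto simp: \<epsilon>_def)
    have "\<forall>\<^sub>F k in sequentially. \<epsilon> < norm (E' k w)" using Eilim[OF wOm] \<epsilon>(2) by (rule order_tendstoD(1))
    moreover have "\<forall>\<^sub>F k in sequentially. g (R k) holomorphic_on ball (of_real c) d0 \<and> (\<forall>z\<in>ball (of_real c) d0. norm (g (R k) z) \<le> 1)"
      using R d0(2) by (rule eventually_subseq)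
    ultimately have "\<forall>\<^sub>F k in sequentially. \<epsilon> < norm (E' k w) \<and> g (R k) holomorphic_on ball (of_real c) d0 \<and> (\<forall>z\<in>ball (of_real c) d0. norm (g (R k) z) \<le> 1)"
      by eventually_elim simp
    then obtain k0 where k0: "\<And>k. k \<ge> k0 \<Longrightarrow> \<epsilon> < norm (E' k w) \<and> g (R k) holomorphic_on ball (of_real c) d0 \<and> (\<forall>z\<in>ball (of_real c) d0. norm (g (R k) z) \<le> 1)"
      unfolding eventually_sequentially by blast
    have Hcont: "isCont (deriv H) (of_real c)" if "H holomorphic_on ball (of_real c) d" for H
    proof -
      have "deriv H holomorphic_on ball (of_real c) d" using that by (intro holomorphic_deriv) auto
      from holomorphic_on_imp_continuous_on[OF this] show ?thesis using d by (simp add: continuous_on_eq_continuous_at)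
    qed
    have Heq: "deriv H z = deriv h z" if H: "H holomorphic_on ball (of_real c) d" and U: "open U" "z \<in> U" "U \<subseteq> ball (of_real c) d" "U \<subseteq> \<Omega>"
        and eq: "\<And>z. z \<in> U \<Longrightarrow> H z = h z" for H z U
      by (rule complex_derivative_transform_within_open[OF holomorphic_on_subset[OF H U(3)] holomorphic_on_subset[OF h(1) U(4)] U(1,2) eq])
    show "\<exists>t\<ge>0. deriv H2 (of_real c) - deriv H1 (of_real c) = \<i> * of_real t"
    proof (rule log_derivative_jump[OF d1, where g = "\<lambda>k. g (R (k + k0))" and n = "\<lambda>k. n (R (k + k0))" and w = w and \<epsilon> = \<epsilon> and q = "deriv h"])
      show "g (R (k + k0)) holomorphic_on ball (of_real c) D" for k
        using k0[of "k+k0"] D by (auto intro: holomorphic_on_subset)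
      show "g (R (k + k0)) z \<noteq> 0" if "z \<in> ball (of_real c) D" "Im z \<noteq> 0" for k z
        using nz inOm[OF that] by (simp add: \<Omega>_def)
      show "norm (g (R (k + k0)) z) \<le> 1" if "z \<in> cball (of_real c) d1" for k z
        using k0[of "k+k0"] that d1 D by auto
      show "0 < n (R (k + k0))" for k using n1[of "R (k + k0)"] by simp
      show "w \<in> ball (of_real c) (d1/4)" by (rule w)
      show "0 < \<epsilon>" by (rule \<epsilon>(1))
      show "\<epsilon> ^ n (R (k + k0)) \<le> norm (g (R (k + k0)) w)" for k
      proof -
        have "\<epsilon> ^ n (R (k + k0)) \<le> norm (E (R (k + k0)) w) ^ n (R (k + k0))"
          using k0[of "k+k0"] \<epsilon>(1) by (intro power_mono) (auto simp: E'_def)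
        then show ?thesis using Eabs[OF wOm] by simp
      qed
      show "(\<lambda>k. deriv (g (R (k + k0))) z / g (R (k + k0)) z / of_nat (n (R (k + k0)))) \<longlonglongrightarrow> deriv h z"
        if "z \<in> ball (of_real c) (d1/4)" "Im z \<noteq> 0" for z
      proof -
        have "z \<in> ball (of_real c) D" using that d1 by auto
        then show ?thesis using LIMSEQ_ignore_initial_segment[OF ld[OF inOm]] that by auto
      qed
      show "isCont (deriv H1) (of_real c)" "isCont (deriv H2) (of_real c)" using Hcont H1 H2 by auto
      show "deriv H1 z = deriv h z" if "z \<in> ball (of_real c) (d1/4)" "0 < Im z" for z
      proof (rule Heq[OF H1, of "ball (of_real c) D \<inter> {z. 0 < Im z}"])
        show "open (ball (of_real c) D \<inter> {z. 0 < Im z})" by (intro open_Int open_ball open_halfspace_Im_gt)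
      qed (use that d1 D H1h inOm in auto)
      show "deriv H2 z = deriv h z" if "z \<in> ball (of_real c) (d1/4)" "Im z < 0" for z
      proof (rule Heq[OF H2, of "ball (of_real c) D \<inter> {z. Im z < 0}"])
        show "open (ball (of_real c) D \<inter> {z. Im z < 0})" by (intro open_Int open_ball open_halfspace_Im_lt)
      qed (use that d1 D H2h inOm in auto)
    qed
  qed
qed

text \<open>The combinatorics of going once round the origin. For the sectors \<open>S1\<close>, \<open>T\<close>, \<open>S2\<close> the letters \<open>f\<close>, \<open>i\<close>, \<open>z\<close>, \<open>o\<close>
stand for a limit which is finite, infinite, zero and one, respectively, \<open>c0\<close>, \<open>c1\<close>, \<open>c2\<close> for convergence at the
points of the three rays, and \<open>b\<close> for uniform convergence to \<open>\<infinity>\<close> near the ray of zeros.\<close>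

lemma only_opposite_limits_diverge:
  fixes f1 fT f2 i1 iT i2 z1 zT z2 o1 o2 c0 c1 c2 b :: bool
  assumes "(f1 \<and> fT \<and> (z1 \<longleftrightarrow> zT) \<and> c1) \<or> (i1 \<and> iT \<and> c1) \<or> (z1 \<and> iT) \<or> (i1 \<and> zT)"
    and "(fT \<and> f2 \<and> (zT \<longleftrightarrow> z2) \<and> c2) \<or> (iT \<and> i2 \<and> c2) \<or> (zT \<and> i2) \<or> (iT \<and> z2)"
    and "(f2 \<and> f1 \<and> c0) \<or> (i2 \<and> i1 \<and> c0 \<and> b) \<or> (o2 \<and> i1) \<or> (i2 \<and> o1)"
    and "\<not> (f1 \<and> i1)" "\<not> (fT \<and> iT)" "\<not> (f2 \<and> i2)" "\<not> (z1 \<and> i1)" "\<not> (zT \<and> iT)" "\<not> (z2 \<and> i2)"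
    and "\<not> (o1 \<and> i1)" "\<not> (o2 \<and> i2)" "\<not> (z1 \<and> o1)" "\<not> (z2 \<and> o2)"
    and "\<not> (iT \<and> z1 \<and> z2)" "\<not> (zT \<and> i1 \<and> i2 \<and> b)"
  shows "c0 \<and> c1 \<and> c2"
  using assms by (elim disjE conjE) simp_all

lemma normalized_convergent_subsequence:
  fixes f :: "nat \<Rightarrow> complex \<Rightarrow> complex"
  assumes \<alpha>: "- pi < \<alpha>1" "\<alpha>1 < \<alpha>2" "\<alpha>2 < pi"
    and angles: "\<not> (\<alpha>2 - \<alpha>1 = pi \<or> (\<alpha>1 + \<alpha>2 = 0 \<and> \<alpha>2 - \<alpha>1 > pi))"
    and hol: "\<And>k. f k holomorphic_on ball 0 1"
    and zeros: "\<And>k z. z \<in> ball 0 1 \<Longrightarrow> f k z = 0 \<Longrightarrow> z \<in> \<real>\<^sub>\<le>\<^sub>0"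
    and ones: "\<And>k z. z \<in> ball 0 1 - {0} \<Longrightarrow> f k z = 1 \<Longrightarrow> \<exists>x. z = exp (Complex x \<alpha>1) \<or> z = exp (Complex x \<alpha>2)"
  shows "\<exists>r. strict_mono r \<and> (\<forall>z\<in>ball 0 1 - {0}. locally_convergent_at (\<lambda>k. f (r k)) z)"
proof -
  let ?S1 = "sector (- pi) \<alpha>1" and ?T = "sector \<alpha>1 \<alpha>2" and ?S2 = "sector \<alpha>2 pi"
  have shift: "sector pi (\<alpha>1 + 2 * pi) = ?S1" using sector_shift[of "- pi" \<alpha>1] by (simp add: mult.commute)
  have holS: "f k holomorphic_on sector a b" for k a b
    using hol sector_subset by (rule holomorphic_on_subset[OF _ order_trans[OF _ Diff_subset]])
  have nz: "f k z \<noteq> 0" if "z \<in> ball 0 1 - \<real>\<^sub>\<le>\<^sub>0" for k z using zeros[of z k] that by auto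
  have nzS: "f k z \<noteq> 0" if "z \<in> sector a b" "- pi \<le> a" "b \<le> pi" for k z a b
    using nz sector_subset_slit_disc[OF that(2,3)] that(1) by blast
  have om: "f k z \<noteq> 1"
    if "z \<in> sector a b" "(\<alpha>1 \<le> a \<and> b \<le> \<alpha>1 + 2 * pi) \<or> (\<alpha>1 - 2 * pi \<le> a \<and> b \<le> \<alpha>1)"
      "(\<alpha>2 \<le> a \<and> b \<le> \<alpha>2 + 2 * pi) \<or> (\<alpha>2 - 2 * pi \<le> a \<and> b \<le> \<alpha>2)" for k z a b
    using ones[of z k] sector_subset[of a b] sector_avoids_ray[OF that(2)] sector_avoids_ray[OF that(3)] that(1) by blast
  have om1: "f k z \<noteq> 1" if "z \<in> ?S1" for k z by (rule om[OF that]) (use \<alpha> in auto)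
  have omT: "f k z \<noteq> 1" if "z \<in> ?T" for k z by (rule om[OF that]) (use \<alpha> in auto)
  have om2: "f k z \<noteq> 1" if "z \<in> ?S2" for k z by (rule om[OF that]) (use \<alpha> in auto)
  have om0: "f k z \<noteq> 1" if "z \<in> sector \<alpha>2 (\<alpha>1 + 2 * pi)" for k z by (rule om[OF that]) (use \<alpha> in auto)
  have nz1: "f k z \<noteq> 0" if "z \<in> ?S1" for k z by (rule nzS[OF that]) (use \<alpha> in auto)
  have nzT: "f k z \<noteq> 0" if "z \<in> ?T" for k z by (rule nzS[OF that]) (use \<alpha> in auto)
  have nz2: "f k z \<noteq> 0" if "z \<in> ?S2" for k z by (rule nzS[OF that]) (use \<alpha> in auto)
  obtain r1 where r1: "strict_mono r1" and A1: "(\<exists>g. loc_unif_limit ?S1 (\<lambda>k. f (r1 k)) g) \<or> loc_unif_infty ?S1 (\<lambda>k. f (r1 k))"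
    using Montel_sector[OF \<alpha>(1), of f] holS nz1 om1 by (simp, metis)
  obtain r2 where r2: "strict_mono r2" and A2: "(\<exists>g. loc_unif_limit ?T (\<lambda>k. f (r1 (r2 k))) g) \<or> loc_unif_infty ?T (\<lambda>k. f (r1 (r2 k)))"
    using Montel_sector[OF \<alpha>(2), of "\<lambda>k. f (r1 k)"] holS nzT omT by (simp, metis)
  obtain r3 where r3: "strict_mono r3" and A3: "(\<exists>g. loc_unif_limit ?S2 (\<lambda>k. f (r1 (r2 (r3 k)))) g) \<or> loc_unif_infty ?S2 (\<lambda>k. f (r1 (r2 (r3 k))))"
    using Montel_sector[OF \<alpha>(3), of "\<lambda>k. f (r1 (r2 k))"] holS nz2 om2 by (simp, metis)
  define R where "R = (\<lambda>k. r1 (r2 (r3 k)))"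
  have R: "strict_mono R" using strict_mono_o[OF r1 strict_mono_o[OF r2 r3]] by (simp add: R_def o_def)
  define F where "F = (\<lambda>k. f (R k))"
  have alt1: "(\<exists>g. loc_unif_limit ?S1 F g) \<or> loc_unif_infty ?S1 F"
    using alternatives_subseq[OF alternatives_subseq[OF A1 r2] r3] by (simp add: F_def R_def)
  have altT: "(\<exists>g. loc_unif_limit ?T F g) \<or> loc_unif_infty ?T F"
    using alternatives_subseq[OF A2 r3] by (simp add: F_def R_def)
  have alt2: "(\<exists>g. loc_unif_limit ?S2 F g) \<or> loc_unif_infty ?S2 F" using A3 by (simp add: F_def R_def)
  have FS: "F k holomorphic_on sector a b" for k a b unfolding F_def by (rule holS)
  have FOm: "F k holomorphic_on ball 0 1 - \<real>\<^sub>\<le>\<^sub>0" for k unfolding F_def using hol holomorphic_on_subset by blast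
  have Fnz: "F k z \<noteq> 0" if "z \<in> ball 0 1 - \<real>\<^sub>\<le>\<^sub>0" for k z unfolding F_def by (rule nz[OF that])

  have X1: "((\<exists>g. loc_unif_limit ?S1 F g) \<and> (\<exists>g. loc_unif_limit ?T F g) \<and> (loc_unif_limit ?S1 F (\<lambda>z. 0) \<longleftrightarrow> loc_unif_limit ?T F (\<lambda>z. 0)) \<and>
           (\<forall>x<0. locally_convergent_at F (exp (Complex x \<alpha>1)))) \<or>
         (loc_unif_infty ?S1 F \<and> loc_unif_infty ?T F \<and> (\<forall>x<0. locally_convergent_at F (exp (Complex x \<alpha>1)))) \<or>
         (loc_unif_limit ?S1 F (\<lambda>z. 0) \<and> loc_unif_infty ?T F) \<or> (loc_unif_infty ?S1 F \<and> loc_unif_limit ?T F (\<lambda>z. 0))"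
  proof -
    have "F k z \<noteq> 0" if "z \<in> sector (- pi) \<alpha>2" for k z
      unfolding F_def by (rule nzS[OF that]) (use \<alpha> in auto)
    moreover have "F k z \<noteq> 1" if "z \<in> ?S1 \<union> ?T" for k z unfolding F_def using om1 omT that by blast
    ultimately show ?thesis
      using zero_free_ray_alternatives[OF \<alpha>(1,2) FS _ _ alt1 altT] unfolding locally_convergent_at_def by blast
  qed
  have X2: "((\<exists>g. loc_unif_limit ?T F g) \<and> (\<exists>g. loc_unif_limit ?S2 F g) \<and> (loc_unif_limit ?T F (\<lambda>z. 0) \<longleftrightarrow> loc_unif_limit ?S2 F (\<lambda>z. 0)) \<and>
           (\<forall>x<0. locally_convergent_at F (exp (Complex x \<alpha>2)))) \<or>
         (loc_unif_infty ?T F \<and> loc_unif_infty ?S2 F \<and> (\<forall>x<0. locally_convergent_at F (exp (Complex x \<alpha>2)))) \<or>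
         (loc_unif_limit ?T F (\<lambda>z. 0) \<and> loc_unif_infty ?S2 F) \<or> (loc_unif_infty ?T F \<and> loc_unif_limit ?S2 F (\<lambda>z. 0))"
  proof -
    have "F k z \<noteq> 0" if "z \<in> sector \<alpha>1 pi" for k z
      unfolding F_def by (rule nzS[OF that]) (use \<alpha> in auto)
    moreover have "F k z \<noteq> 1" if "z \<in> ?T \<union> ?S2" for k z unfolding F_def using omT om2 that by blast
    ultimately show ?thesis
      using zero_free_ray_alternatives[OF \<alpha>(2,3) FS _ _ altT alt2] unfolding locally_convergent_at_def by blast
  qed
  \<comment> \<open>Across the negative axis the roles of \<open>0\<close> and \<open>1\<close> are exchanged.\<close>
  define G where "G = (\<lambda>k z. 1 - F k z)"
  have GF: "(\<lambda>k z. 1 - G k z) = F" by (simp add: G_def fun_eq_iff)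
  have Gl: "loc_unif_limit S G (\<lambda>z. 1 - g z)" if "loc_unif_limit S F g" for S g unfolding G_def using that by (rule loc_unif_limit_one_minus)
  have Gi: "loc_unif_infty S G" if "loc_unif_infty S F" for S unfolding G_def using that by (rule loc_unif_infty_one_minus)
  have Fl: "\<exists>g. loc_unif_limit S F g" if "loc_unif_limit S G g" for S g using loc_unif_limit_one_minus[OF that] unfolding GF by blast
  have Fl1: "loc_unif_limit S F (\<lambda>z. 1)" if "loc_unif_limit S G (\<lambda>z. 0)" for S using loc_unif_limit_one_minus[OF that] unfolding GF by simp
  have Fi: "loc_unif_infty S F" if "loc_unif_infty S G" for S using loc_unif_infty_one_minus[OF that] unfolding GF .
  have LF: "locally_convergent_at F z" if "locally_convergent_at G z" for z
    using that unfolding G_def by (rule locally_convergent_at_one_minus)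
  have altG: "(\<exists>g. loc_unif_limit S G g) \<or> loc_unif_infty S G" if "(\<exists>g. loc_unif_limit S F g) \<or> loc_unif_infty S F" for S
    using that Gl Gi by blast
  have X0: "((\<exists>g. loc_unif_limit ?S2 F g) \<and> (\<exists>g. loc_unif_limit ?S1 F g) \<and> (\<forall>x<0. locally_convergent_at F (exp (Complex x pi)))) \<or>
         (loc_unif_infty ?S2 F \<and> loc_unif_infty ?S1 F \<and> (\<forall>x<0. locally_convergent_at F (exp (Complex x pi))) \<and>
           (\<forall>x<0. \<exists>d>0. ball (exp (Complex x pi)) d \<subseteq> ball 0 1 \<and>
               (\<forall>M. \<forall>\<^sub>F k in sequentially. \<forall>z\<in>ball (exp (Complex x pi)) d. M \<le> norm (G k z)))) \<or>
         (loc_unif_limit ?S2 F (\<lambda>z. 1) \<and> loc_unif_infty ?S1 F) \<or> (loc_unif_infty ?S2 F \<and> loc_unif_limit ?S1 F (\<lambda>z. 1))"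
  proof -
    have ab: "\<alpha>2 < pi" "pi < \<alpha>1 + 2 * pi" using \<alpha> by auto
    have Gh: "G k holomorphic_on sector a b" for k a b unfolding G_def by (intro holomorphic_intros FS)
    have g0: "G k z \<noteq> 0" if "z \<in> sector \<alpha>2 (\<alpha>1 + 2 * pi)" for k z
      unfolding G_def F_def using om0[OF that] by simp
    have g1: "G k z \<noteq> 1" if "z \<in> ?S2 \<union> sector pi (\<alpha>1 + 2 * pi)" for k z
      unfolding G_def F_def using nz1 nz2 that shift by auto
    have C': "(\<exists>g. loc_unif_limit (sector pi (\<alpha>1 + 2 * pi)) G g) \<or> loc_unif_infty (sector pi (\<alpha>1 + 2 * pi)) G"
      unfolding shift by (rule altG[OF alt1])
    have alts: "((\<exists>g. loc_unif_limit ?S2 G g) \<and> (\<exists>g. loc_unif_limit ?S1 G g) \<and>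
           (loc_unif_limit ?S2 G (\<lambda>z. 0) \<longleftrightarrow> loc_unif_limit ?S1 G (\<lambda>z. 0)) \<and>
           (\<forall>x<0. locally_convergent_at G (exp (Complex x pi)))) \<or>
         (loc_unif_infty ?S2 G \<and> loc_unif_infty ?S1 G \<and>
           (\<forall>x<0. \<exists>d>0. ball (exp (Complex x pi)) d \<subseteq> sector \<alpha>2 (\<alpha>1 + 2 * pi) \<and>
               (\<forall>M. \<forall>\<^sub>F k in sequentially. \<forall>z\<in>ball (exp (Complex x pi)) d. M \<le> norm (G k z)))) \<or>
         (loc_unif_limit ?S2 G (\<lambda>z. 0) \<and> loc_unif_infty ?S1 G) \<or>
         (loc_unif_infty ?S2 G \<and> loc_unif_limit ?S1 G (\<lambda>z. 0))"
      using zero_free_ray_alternatives[OF ab Gh g0 g1 altG[OF alt2] C'] unfolding shift .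
    have sub: "sector \<alpha>2 (\<alpha>1 + 2 * pi) \<subseteq> ball 0 1" using sector_subset by blast
    from alts show ?thesis
    proof (elim disjE conjE)
      assume "\<exists>g. loc_unif_limit ?S2 G g" "\<exists>g. loc_unif_limit ?S1 G g" "\<forall>x<0. locally_convergent_at G (exp (Complex x pi))"
      then show ?thesis using Fl LF by blast
    next
      assume i: "loc_unif_infty ?S2 G" "loc_unif_infty ?S1 G" and b: "\<forall>x<0. \<exists>d>0. ball (exp (Complex x pi)) d \<subseteq> sector \<alpha>2 (\<alpha>1 + 2 * pi) \<and>
               (\<forall>M. \<forall>\<^sub>F k in sequentially. \<forall>z\<in>ball (exp (Complex x pi)) d. M \<le> norm (G k z))"
      have "locally_convergent_at F (exp (Complex x pi))" if "x < 0" for x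
        by (rule LF) (use b that in \<open>unfold locally_convergent_at_def, blast\<close>)
      moreover have "\<forall>x<0. \<exists>d>0. ball (exp (Complex x pi)) d \<subseteq> ball 0 1 \<and>
               (\<forall>M. \<forall>\<^sub>F k in sequentially. \<forall>z\<in>ball (exp (Complex x pi)) d. M \<le> norm (G k z))"
        using b sub by (meson order_trans)
      ultimately show ?thesis using Fi[OF i(1)] Fi[OF i(2)] by simp
    next
      assume "loc_unif_limit ?S2 G (\<lambda>z. 0)" "loc_unif_infty ?S1 G"
      then show ?thesis using Fl1 Fi by blast
    next
      assume "loc_unif_infty ?S2 G" "loc_unif_limit ?S1 G (\<lambda>z. 0)"
      then show ?thesis using Fl1 Fi by blast
    qed
  qed
  have ne: "?S1 \<noteq> {}" "?T \<noteq> {}" "?S2 \<noteq> {}" using \<alpha> by (simp_all add: sector_nonempty)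
  have x1: "\<not> (loc_unif_limit ?S1 F g \<and> loc_unif_infty ?S1 F)" for g using loc_unif_limit_infty_contradiction ne(1) by blast
  have xT: "\<not> (loc_unif_limit ?T F g \<and> loc_unif_infty ?T F)" for g using loc_unif_limit_infty_contradiction ne(2) by blast
  have x2: "\<not> (loc_unif_limit ?S2 F g \<and> loc_unif_infty ?S2 F)" for g using loc_unif_limit_infty_contradiction ne(3) by blast
  have y1: "\<not> (loc_unif_limit ?S1 F (\<lambda>z. 0) \<and> loc_unif_limit ?S1 F (\<lambda>z. 1))"
  proof
    assume a: "loc_unif_limit ?S1 F (\<lambda>z. 0) \<and> loc_unif_limit ?S1 F (\<lambda>z. 1)"
    obtain z where "z \<in> ?S1" using ne(1) by blast
    from loc_unif_limit_unique[OF conjunct1[OF a] conjunct2[OF a] this] show False by simp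
  qed
  have y2: "\<not> (loc_unif_limit ?S2 F (\<lambda>z. 0) \<and> loc_unif_limit ?S2 F (\<lambda>z. 1))"
  proof
    assume a: "loc_unif_limit ?S2 F (\<lambda>z. 0) \<and> loc_unif_limit ?S2 F (\<lambda>z. 1)"
    obtain z where "z \<in> ?S2" using ne(3) by blast
    from loc_unif_limit_unique[OF conjunct1[OF a] conjunct2[OF a] this] show False by simp
  qed
  have negray: "\<exists>x<0. of_real c = exp (Complex x pi)" if "-1 < c" "c < 0" for c
  proof (intro exI[of _ "ln (-c)"] conjI)
    show "ln (-c) < 0" using that by simp
    show "of_real c = exp (Complex (ln (-c)) pi)" using that by (simp add: complex_eq_iff Re_exp Im_exp)
  qed
  have coreA: False if t: "loc_unif_infty ?T F" and s1: "loc_unif_limit ?S1 F (\<lambda>z. 0)" and s2: "loc_unif_limit ?S2 F (\<lambda>z. 0)"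
  proof -
    have "\<alpha>2 - \<alpha>1 = pi \<or> (\<alpha>1 + \<alpha>2 = 0 \<and> \<alpha>2 - \<alpha>1 > pi)"
    proof (rule opposite_limits_force_angles[OF \<alpha> FOm Fnz _ _ s1 s2])
      show "F k z \<noteq> 1" if "z \<in> ?S1 \<union> ?T \<union> ?S2" for k z unfolding F_def using om1 omT om2 that by blast
      show "loc_unif_limit ?T (\<lambda>k z. inverse (F k z)) (\<lambda>z. 0)"
        using t loc_unif_infty_iff_inverse[of ?T F] nzT unfolding F_def by blast
      fix c :: real assume c: "-1 < c" "c < 0"
      obtain x where x: "x < 0" "of_real c = exp (Complex x pi)" using negray[OF c] by blast
      define \<eta> where "\<eta> = min (pi - \<alpha>2) (\<alpha>1 + pi)"
      have \<eta>: "0 < \<eta>" using \<alpha> by (simp add: \<eta>_def)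
      have sa: "sector pi (pi + \<eta>) \<subseteq> ?S1" unfolding shift[symmetric] by (rule sector_mono; simp add: \<eta>_def min_def)
      have sb: "sector (pi - \<eta>) pi \<subseteq> ?S2" by (rule sector_mono; simp add: \<eta>_def min_def)
      have "\<exists>d>0. ball (exp (Complex x pi)) d \<subseteq> sector (pi - \<eta>) (pi + \<eta>) \<and> uniform_limit (ball (exp (Complex x pi)) d) F (\<lambda>z. 0) sequentially"
      proof (rule ray_crossing_const[OF x(1) \<eta> refl FS])
        show "F k z \<noteq> 0 \<and> F k z \<noteq> 1" if "z \<in> sector (pi - \<eta>) pi \<union> sector pi (pi + \<eta>)" for k z
          unfolding F_def using nz1 nz2 om1 om2 that sa sb by blast
      qed (use loc_unif_limit_subset[OF s1 sa] loc_unif_limit_subset[OF s2 sb] in auto)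
      then obtain d where d: "d > 0" "ball (of_real c) d \<subseteq> sector (pi - \<eta>) (pi + \<eta>)" "uniform_limit (ball (of_real c) d) F (\<lambda>z. 0) sequentially"
        unfolding x(2) by blast
      have sub: "ball (of_real c) d \<subseteq> ball (0::complex) 1" using d(2) sector_subset by blast
      have "\<forall>\<^sub>F k in sequentially. \<forall>z\<in>ball (of_real c) d. dist (F k z) 0 < 1"
        using d(3) by (rule uniform_limitD) simp
      then have "\<forall>\<^sub>F k in sequentially. F k holomorphic_on ball (of_real c) d \<and> (\<forall>z\<in>ball (of_real c) d. norm (F k z) \<le> 1)"
        by (rule eventually_mono) (use holomorphic_on_subset[OF FS d(2)] in \<open>auto intro: less_imp_le\<close>)
      then show "\<exists>d>0. ball (complex_of_real c) d \<subseteq> ball 0 1 \<and>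
        (\<forall>\<^sub>F k in sequentially. F k holomorphic_on ball (of_real c) d \<and> (\<forall>z\<in>ball (of_real c) d. norm (F k z) \<le> 1))"
        using d(1) sub by blast
    qed
    then show False using angles by blast
  qed
  have coreB: False if t: "loc_unif_limit ?T F (\<lambda>z. 0)" and s1: "loc_unif_infty ?S1 F" and s2: "loc_unif_infty ?S2 F"
    and b: "\<forall>x<0. \<exists>d>0. ball (exp (Complex x pi)) d \<subseteq> ball 0 1 \<and>
               (\<forall>M. \<forall>\<^sub>F k in sequentially. \<forall>z\<in>ball (exp (Complex x pi)) d. M \<le> norm (G k z))"
  proof -
    have "\<alpha>2 - \<alpha>1 = pi \<or> (\<alpha>1 + \<alpha>2 = 0 \<and> \<alpha>2 - \<alpha>1 > pi)"
    proof (rule opposite_limits_force_angles[OF \<alpha>, of "\<lambda>k z. inverse (F k z)"])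
      show "(\<lambda>z. inverse (F k z)) holomorphic_on ball 0 1 - \<real>\<^sub>\<le>\<^sub>0" for k
        by (intro holomorphic_intros FOm Fnz)
      show "inverse (F k z) \<noteq> 0" if "z \<in> ball 0 1 - \<real>\<^sub>\<le>\<^sub>0" for k z using Fnz[OF that] by simp
      show "inverse (F k z) \<noteq> 1" if "z \<in> ?S1 \<union> ?T \<union> ?S2" for k z
        unfolding F_def inverse_eq_1_iff using om1 omT om2 that by blast
      show "loc_unif_limit ?T (\<lambda>k z. inverse (inverse (F k z))) (\<lambda>z. 0)" using t by simp
      show "loc_unif_limit ?S1 (\<lambda>k z. inverse (F k z)) (\<lambda>z. 0)"
        using s1 loc_unif_infty_iff_inverse[of ?S1 F] nz1 unfolding F_def by blast
      show "loc_unif_limit ?S2 (\<lambda>k z. inverse (F k z)) (\<lambda>z. 0)"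
        using s2 loc_unif_infty_iff_inverse[of ?S2 F] nz2 unfolding F_def by blast
      fix c :: real assume c: "-1 < c" "c < 0"
      obtain x where x: "x < 0" "of_real c = exp (Complex x pi)" using negray[OF c] by blast
      obtain d where d: "d > 0" "ball (of_real c) d \<subseteq> ball (0::complex) 1"
        "\<forall>M. \<forall>\<^sub>F k in sequentially. \<forall>z\<in>ball (of_real c) d. M \<le> norm (G k z)"
        using mp[OF spec[OF b, of x] x(1)] unfolding x(2)[symmetric] by (elim exE conjE)
      have "\<forall>\<^sub>F k in sequentially. \<forall>z\<in>ball (of_real c) d. 2 \<le> norm (G k z)" using d(3) by blast
      then have "\<forall>\<^sub>F k in sequentially. (\<lambda>z. inverse (F k z)) holomorphic_on ball (of_real c) d \<and> (\<forall>z\<in>ball (of_real c) d. norm (inverse (F k z)) \<le> 1)"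
      proof eventually_elim
        case (elim k)
        have F1: "1 \<le> norm (F k z)" if "z \<in> ball (of_real c) d" for z
        proof -
          have "2 \<le> norm (1 - F k z)" using elim that by (simp add: G_def)
          then show ?thesis using norm_triangle_ineq4[of 1 "F k z"] by simp
        qed
        have Fn: "F k z \<noteq> 0" if "z \<in> ball (of_real c) d" for z using F1[OF that] by auto
        have "F k holomorphic_on ball (of_real c) d" unfolding F_def using hol d(2) by (rule holomorphic_on_subset)
        then have "(\<lambda>z. inverse (F k z)) holomorphic_on ball (of_real c) d" using Fn by (intro holomorphic_intros)
        moreover have "norm (inverse (F k z)) \<le> 1" if "z \<in> ball (of_real c) d" for z
          using F1[OF that] by (simp add: norm_inverse inverse_le_1_iff)
        ultimately show ?case by blast
      qed
      then show "\<exists>d>0. ball (complex_of_real c) d \<subseteq> ball 0 1 \<and>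
        (\<forall>\<^sub>F k in sequentially. (\<lambda>z. inverse (F k z)) holomorphic_on ball (of_real c) d \<and> (\<forall>z\<in>ball (of_real c) d. norm (inverse (F k z)) \<le> 1))"
        using d(1,2) by blast
    qed
    then show False using angles by blast
  qed
  have "(\<forall>x<0. locally_convergent_at F (exp (Complex x pi))) \<and> (\<forall>x<0. locally_convergent_at F (exp (Complex x \<alpha>1))) \<and>
      (\<forall>x<0. locally_convergent_at F (exp (Complex x \<alpha>2)))"
  proof (rule only_opposite_limits_diverge[OF X1 X2 X0])
    show "\<not> ((\<exists>g. loc_unif_limit ?S1 F g) \<and> loc_unif_infty ?S1 F)" "\<not> ((\<exists>g. loc_unif_limit ?T F g) \<and> loc_unif_infty ?T F)"
      "\<not> ((\<exists>g. loc_unif_limit ?S2 F g) \<and> loc_unif_infty ?S2 F)" using x1 xT x2 by blast+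
    show "\<not> (loc_unif_limit ?S1 F (\<lambda>z. 0) \<and> loc_unif_infty ?S1 F)" "\<not> (loc_unif_limit ?S1 F (\<lambda>z. 1) \<and> loc_unif_infty ?S1 F)" by (rule x1)+
    show "\<not> (loc_unif_limit ?T F (\<lambda>z. 0) \<and> loc_unif_infty ?T F)" by (rule xT)
    show "\<not> (loc_unif_limit ?S2 F (\<lambda>z. 0) \<and> loc_unif_infty ?S2 F)" "\<not> (loc_unif_limit ?S2 F (\<lambda>z. 1) \<and> loc_unif_infty ?S2 F)" by (rule x2)+
    show "\<not> (loc_unif_limit ?S1 F (\<lambda>z. 0) \<and> loc_unif_limit ?S1 F (\<lambda>z. 1))" by (rule y1)
    show "\<not> (loc_unif_limit ?S2 F (\<lambda>z. 0) \<and> loc_unif_limit ?S2 F (\<lambda>z. 1))" by (rule y2)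
    show "\<not> (loc_unif_infty ?T F \<and> loc_unif_limit ?S1 F (\<lambda>z. 0) \<and> loc_unif_limit ?S2 F (\<lambda>z. 0))"
      by (rule notI, elim conjE, rule coreA)
    show "\<not> (loc_unif_limit ?T F (\<lambda>z. 0) \<and> loc_unif_infty ?S1 F \<and> loc_unif_infty ?S2 F \<and>
        (\<forall>x<0. \<exists>d>0. ball (exp (Complex x pi)) d \<subseteq> ball 0 1 \<and>
               (\<forall>M. \<forall>\<^sub>F k in sequentially. \<forall>z\<in>ball (exp (Complex x pi)) d. M \<le> norm (G k z))))"
      by (rule notI, elim conjE, rule coreB)
  qed
  then have L0: "\<forall>x<0. locally_convergent_at F (exp (Complex x pi))"
    and L1: "\<forall>x<0. locally_convergent_at F (exp (Complex x \<alpha>1))"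
    and L2: "\<forall>x<0. locally_convergent_at F (exp (Complex x \<alpha>2))" by simp_all
  have inner: "locally_convergent_at F z" if "z \<in> S" "open S" "(\<exists>g. loc_unif_limit S F g) \<or> loc_unif_infty S F" for z S
    using that loc_unif_limit_imp_locally_convergent_at loc_unif_infty_imp_locally_convergent_at by metis
  have "locally_convergent_at F z" if z: "z \<in> ball 0 1 - {0}" for z
  proof -
    define x \<theta> where "x = Re (Ln z)" and "\<theta> = Im (Ln z)"
    have "z \<noteq> 0" using z by simp
    then have zx: "z = exp (Complex x \<theta>)" unfolding x_def \<theta>_def by (metis complex.collapse exp_Ln)
    have x: "x < 0" using z by (simp add: x_def)
    have \<theta>: "- pi < \<theta>" "\<theta> \<le> pi" using z by (auto simp: \<theta>_def mpi_less_Im_Ln Im_Ln_le_pi)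
    consider "\<theta> < \<alpha>1" | "\<theta> = \<alpha>1" | "\<alpha>1 < \<theta>" "\<theta> < \<alpha>2" | "\<theta> = \<alpha>2" | "\<alpha>2 < \<theta>" "\<theta> < pi" | "\<theta> = pi"
      using \<theta> by linarith
    then show ?thesis
    proof cases
      case 1
      then have "z \<in> ?S1" using x \<theta> by (intro sector_I[OF zx]) auto
      then show ?thesis by (rule inner[OF _ open_sector alt1])
    next
      case 2 then show ?thesis using L1 x zx by simp
    next
      case 3
      then have "z \<in> ?T" using x \<theta> by (intro sector_I[OF zx]) auto
      then show ?thesis by (rule inner[OF _ open_sector altT])
    next
      case 4 then show ?thesis using L2 x zx by simp
    next
      case 5
      then have "z \<in> ?S2" using x \<theta> by (intro sector_I[OF zx]) auto
      then show ?thesis by (rule inner[OF _ open_sector alt2])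
    next
      case 6 then show ?thesis using L0 x zx by simp
    qed
  qed
  then show ?thesis using R unfolding F_def by blast
qed

section \<open>Convergence in the spherical metric\<close>

lemma sph_dist_le_pi: "0 \<le> sph_dist p q" "sph_dist p q \<le> pi"
proof -
  have "\<bar>inner (to_sphere p) (to_sphere q)\<bar> \<le> 1"
    using Cauchy_Schwarz_ineq2[of "to_sphere p" "to_sphere q"] by simp
  then show "0 \<le> sph_dist p q" "sph_dist p q \<le> pi"
    by (auto simp: sph_dist_def vangle_def abs_le_iff intro!: arccos_lbound arccos_ubound)
qed

text \<open>The topology of the great-circle distance is that of the chordal distance.\<close>

lemma sph_dist_less:
  assumes "0 < e"
  obtains \<delta> where "0 < \<delta>" "\<And>p q. dist (to_sphere p) (to_sphere q) < \<delta> \<Longrightarrow> sph_dist p q < e"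
proof -
  define e' where "e' = min e pi"
  have e': "0 < e'" "e' \<le> pi" "e' \<le> e" using assms by (auto simp: e'_def)
  have "cos e' < 1" using cos_monotone_0_pi[of 0 e'] e' by simp
  then have \<delta>: "0 < sqrt (2 * (1 - cos e'))" by simp
  show ?thesis
  proof (rule that[OF \<delta>])
    fix p q assume d: "dist (to_sphere p) (to_sphere q) < sqrt (2 * (1 - cos e'))"
    show "sph_dist p q < e"
    proof (rule ccontr)
      assume "\<not> sph_dist p q < e"
      then have "e' \<le> sph_dist p q" using e' by simp
      then have "cos (sph_dist p q) \<le> cos e'" using sph_dist_le_pi[of p q] e' by (intro cos_monotone_0_pi_le) auto
      then have "2 * (1 - cos e') \<le> (dist (to_sphere p) (to_sphere q))\<^sup>2" using cos_sph_dist[of p q] by simp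
      then have "sqrt (2 * (1 - cos e')) \<le> dist (to_sphere p) (to_sphere q)" by (simp add: real_le_lsqrt)
      then show False using d by simp
    qed
  qed
qed

lemma dist_to_sphere_square: "(dist (to_sphere p) (to_sphere q))\<^sup>2 = 2 - 2 * inner (to_sphere p) (to_sphere q)"
  using dot_norm_neg[of "to_sphere p" "to_sphere q"] by (simp add: dist_norm)

text \<open>The chordal distance of \<open>a\<close> and \<open>b\<close> is \<open>2 |a - b| / sqrt ((1 + |a|\<^sup>2) (1 + |b|\<^sup>2))\<close>.\<close>

lemma dist_to_sphere_Fin: "dist (to_sphere (Fin a)) (to_sphere (Fin b)) \<le> 2 * norm (a - b)"
proof -
  define A B p where "A = (norm a)\<^sup>2" and "B = (norm b)\<^sup>2" and "p = inner a b"
  have A: "0 \<le> A" "0 \<le> B" by (auto simp: A_def B_def)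
  have ab: "(norm (a - b))\<^sup>2 = A + B - 2 * p" using dot_norm_neg[of a b] by (simp add: A_def B_def p_def)
  have nz: "(A + 1) * (B + 1) \<ge> 1" using A by (simp add: algebra_simps)
  have "inner (to_sphere (Fin a)) (to_sphere (Fin b)) = (4 * p + (A - 1) * (B - 1)) / ((A + 1) * (B + 1))"
    by (simp add: A_def B_def p_def add_divide_distrib)
  then have "(dist (to_sphere (Fin a)) (to_sphere (Fin b)))\<^sup>2 = 2 - 2 * ((4 * p + (A - 1) * (B - 1)) / ((A + 1) * (B + 1)))"
    by (simp only: dist_to_sphere_square)
  also have "\<dots> = 4 * (A + B - 2 * p) / ((A + 1) * (B + 1))"
  proof -
    have "(A + 1) * (B + 1) \<noteq> 0" using nz by auto
    then have "2 - 2 * ((4 * p + (A - 1) * (B - 1)) / ((A + 1) * (B + 1))) = (2 * ((A + 1) * (B + 1)) - 2 * (4 * p + (A - 1) * (B - 1))) / ((A + 1) * (B + 1))"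
      by (simp add: diff_divide_distrib)
    also have "2 * ((A + 1) * (B + 1)) - 2 * (4 * p + (A - 1) * (B - 1)) = 4 * (A + B - 2 * p)" by (simp add: algebra_simps)
    finally show ?thesis .
  qed
  also have "\<dots> \<le> 4 * (A + B - 2 * p) / 1"
    using nz ab zero_le_power2[of "norm (a - b)"] by (intro divide_left_mono) auto
  also have "\<dots> = (2 * norm (a - b))\<^sup>2" using ab by (simp add: power_mult_distrib)
  finally show ?thesis by (rule power2_le_imp_le) simp
qed

text \<open>The chordal distance of \<open>a\<close> and \<open>\<infinity>\<close> is \<open>2 / sqrt (1 + |a|\<^sup>2)\<close>.\<close>

lemma dist_to_sphere_Infty:
  assumes "0 < M" "2 / M \<le> norm a" shows "dist (to_sphere (Fin a)) (to_sphere Infty) < M"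
proof -
  define A where "A = (norm a)\<^sup>2"
  have A: "0 \<le> A" by (simp add: A_def)
  have "inner (to_sphere (Fin a)) (to_sphere Infty) = (A - 1) / (A + 1)" by (simp add: A_def)
  then have "(dist (to_sphere (Fin a)) (to_sphere Infty))\<^sup>2 = 2 - 2 * ((A - 1) / (A + 1))"
    by (simp only: dist_to_sphere_square)
  also have "\<dots> = 4 / (A + 1)" using A by (simp add: field_simps)
  also have "\<dots> < M\<^sup>2"
  proof -
    have "(2 / M)\<^sup>2 \<le> A" unfolding A_def using assms by (intro power_mono) auto
    then have "4 \<le> A * M\<^sup>2" using assms(1) by (simp add: power_divide field_simps)
    moreover have "A * M\<^sup>2 < (A + 1) * M\<^sup>2" using assms(1) by (simp add: algebra_simps)
    ultimately have "4 < M\<^sup>2 * (A + 1)" by (simp only: mult.commute)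
    then show ?thesis using A by (simp add: divide_less_eq)
  qed
  finally show ?thesis using assms(1) by (simp add: power2_less_imp_less)
qed

lemma locally_convergent_imp_sph_limit:
  assumes "\<And>z. z \<in> S \<Longrightarrow> locally_convergent_at f z"
  shows "\<exists>g. sph_locally_uniform_limit S (\<lambda>n z. Fin (f n z)) g"
proof -
  define g where "g = (\<lambda>z. if convergent (\<lambda>k. f k z) then Fin (lim (\<lambda>k. f k z)) else Infty)"
  have "\<exists>d>0. \<forall>e>0. \<forall>\<^sub>F n in sequentially. \<forall>w\<in>ball z d \<inter> S. sph_dist (Fin (f n w)) (g w) < e" if zS: "z \<in> S" for z
  proof -
    obtain d where d: "d > 0" and alt: "(\<exists>l. uniform_limit (ball z d) f l sequentially) \<or>
     (\<forall>M. \<forall>\<^sub>F k in sequentially. \<forall>w\<in>ball z d. M \<le> norm (f k w))"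
      using assms[OF zS] unfolding locally_convergent_at_def by blast
    have "\<forall>\<^sub>F n in sequentially. \<forall>w\<in>ball z d \<inter> S. sph_dist (Fin (f n w)) (g w) < e" if "e > 0" for e
    proof -
      obtain \<delta> where \<delta>: "0 < \<delta>" "\<And>p q. dist (to_sphere p) (to_sphere q) < \<delta> \<Longrightarrow> sph_dist p q < e"
        using sph_dist_less[OF \<open>e > 0\<close>] by blast
      from alt show ?thesis
      proof (elim disjE exE)
        fix l assume l: "uniform_limit (ball z d) f l sequentially"
        have g: "g w = Fin (l w)" if "w \<in> ball z d" for w
          using tendsto_uniform_limitI[OF l that] by (auto simp: g_def convergent_def limI)
        have "\<forall>\<^sub>F n in sequentially. \<forall>w\<in>ball z d. dist (f n w) (l w) < \<delta> / 2"
          using l by (rule uniform_limitD) (use \<delta> in simp)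
        then show ?thesis
        proof (rule eventually_mono, intro ballI)
          fix n w assume n: "\<forall>w\<in>ball z d. dist (f n w) (l w) < \<delta> / 2" and w: "w \<in> ball z d \<inter> S"
          have "norm (f n w - l w) < \<delta> / 2" using n w by (simp add: dist_norm)
          then have "dist (to_sphere (Fin (f n w))) (to_sphere (Fin (l w))) < \<delta>"
            using dist_to_sphere_Fin[of "f n w" "l w"] by linarith
          then show "sph_dist (Fin (f n w)) (g w) < e" using \<delta>(2) g w by simp
        qed
      next
        assume inf: "\<forall>M. \<forall>\<^sub>F k in sequentially. \<forall>w\<in>ball z d. M \<le> norm (f k w)"
        have g: "g w = Infty" if w: "w \<in> ball z d" for w
        proof -
          have "\<not> convergent (\<lambda>k. f k w)"
          proof
            assume "convergent (\<lambda>k. f k w)"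
            then obtain B where B: "\<And>k. norm (f k w) \<le> B" using convergent_imp_Bseq BseqE by metis
            have "\<forall>\<^sub>F k in sequentially. \<forall>w\<in>ball z d. B + 1 \<le> norm (f k w)" using inf by blast
            then obtain k where "\<forall>w\<in>ball z d. B + 1 \<le> norm (f k w)" by (auto simp: eventually_sequentially)
            then show False using B[of k] w by fastforce
          qed
          then show ?thesis by (simp add: g_def)
        qed
        have "\<forall>\<^sub>F k in sequentially. \<forall>w\<in>ball z d. 2 / \<delta> \<le> norm (f k w)" using inf by blast
        then show ?thesis
        proof (rule eventually_mono, intro ballI)
          fix n w assume n: "\<forall>w\<in>ball z d. 2 / \<delta> \<le> norm (f n w)" and w: "w \<in> ball z d \<inter> S"
          have "dist (to_sphere (Fin (f n w))) (to_sphere Infty) < \<delta>"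
            by (rule dist_to_sphere_Infty[OF \<delta>(1)]) (use n w in blast)
          then show "sph_dist (Fin (f n w)) (g w) < e" using \<delta>(2) g w by simp
        qed
      qed
    qed
    then show ?thesis using d by blast
  qed
  then show ?thesis unfolding sph_locally_uniform_limit_def by (intro exI[of _ g]) blast
qed

section \<open>Rotation to the normalized configuration\<close>

lemma vangle_cis:
  assumes "0 < s" "0 < t"
  shows "vangle (of_real s * cis a) (of_real t * cis b) = arccos (cos (a - b))"
proof -
  have "inner (of_real s * cis a) (of_real t * cis b) = s * t * cos (a - b)"
    by (simp add: inner_complex_def cos_diff algebra_simps)
  then show ?thesis using assms by (simp add: vangle_def norm_mult)
qed

lemma mem_ray_rotated:
  assumes "0 < s"
  shows "cis l * z \<in> ray (of_real s * cis (l + a)) \<longleftrightarrow> (\<exists>t\<ge>0. z = of_real t * cis a)"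
proof -
  have c: "cis (l + a) = cis l * cis a" by (simp add: cis_mult)
  have *: "cis l * z = t *\<^sub>R (of_real s * cis (l + a)) \<longleftrightarrow> z = of_real (t * s) * cis a" for t
  proof -
    have "t *\<^sub>R (of_real s * cis (l + a)) = cis l * (of_real (t * s) * cis a)"
      unfolding c scaleR_conv_of_real of_real_mult by (simp only: mult_ac)
    then show ?thesis by (simp only: mult_left_cancel[OF cis_neq_zero])
  qed
  show ?thesis unfolding ray_def mem_Collect_eq *
  proof
    assume "\<exists>t. z = of_real (t * s) * cis a \<and> 0 \<le> t"
    then obtain t where "z = of_real (t * s) * cis a" "0 \<le> t" by blast
    then show "\<exists>t\<ge>0. z = of_real t * cis a" using assms by (intro exI[of _ "t * s"]) simp
  next
    assume "\<exists>t\<ge>0. z = of_real t * cis a"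
    then obtain t where "t \<ge> 0" "z = of_real t * cis a" by blast
    then show "\<exists>t. z = of_real (t * s) * cis a \<and> 0 \<le> t" using assms by (intro exI[of _ "t / s"]) simp
  qed
qed

lemma ray_scale:
  assumes "0 < s" "0 < t"
  shows "ray (of_real s * cis (l + a)) = ray (of_real t * cis (l + a))"
proof (rule set_eqI)
  fix z
  have "z = cis l * (z / cis l)" using cis_neq_zero[of l] by simp
  then show "z \<in> ray (of_real s * cis (l + a)) \<longleftrightarrow> z \<in> ray (of_real t * cis (l + a))"
    using mem_ray_rotated[OF assms(1), of l "z / cis l" a] mem_ray_rotated[OF assms(2), of l "z / cis l" a] by metis
qed

lemma polar_form_of_quotient: "u \<noteq> 0 \<Longrightarrow> u = of_real (norm u) * cis (l + Arg (u / cis l))"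
proof -
  assume u: "u \<noteq> 0"
  have "u / cis l = of_real (norm (u / cis l)) * cis (Arg (u / cis l))" by (simp add: rcis_cmod_Arg flip: rcis_def)
  then have "u = cis l * (of_real (norm u) * cis (Arg (u / cis l)))" by (simp add: norm_divide field_simps)
  then show ?thesis by (simp add: cis_mult[symmetric] mult_ac)
qed

theorem theorem1p1:
  fixes L\<^sub>0 L\<^sub>1 L\<^sub>m :: "complex set" and \<F> :: "(complex \<Rightarrow> complex) set"
  assumes "is_ray L\<^sub>0" "is_ray L\<^sub>1" "is_ray L\<^sub>m"
    and "L\<^sub>0 \<noteq> L\<^sub>1" "L\<^sub>0 \<noteq> L\<^sub>m" "L\<^sub>1 \<noteq> L\<^sub>m"
    and "\<F> = {f. f holomorphic_on ball 0 1 \<and>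
                 (\<forall>z\<in>ball 0 1. f z = 0 \<longrightarrow> z \<in> L\<^sub>0) \<and>
                 (\<forall>z\<in>ball 0 1. f z = 1 \<longrightarrow> z \<in> L\<^sub>1 \<union> L\<^sub>m)}"
    and "ray_angle L\<^sub>m L\<^sub>1 \<noteq> pi"
    and "\<not> (ray_angle L\<^sub>0 L\<^sub>1 = ray_angle L\<^sub>0 L\<^sub>m \<and> ray_angle L\<^sub>0 L\<^sub>m < pi / 2)"
  shows "normal_on \<F> (ball 0 1 - {0})"
proof -
  obtain u\<^sub>0 u\<^sub>1 u\<^sub>m where u: "u\<^sub>0 \<noteq> 0" "u\<^sub>1 \<noteq> 0" "u\<^sub>m \<noteq> 0" and L: "L\<^sub>0 = ray u\<^sub>0" "L\<^sub>1 = ray u\<^sub>1" "L\<^sub>m = ray u\<^sub>m"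
    using assms(1-3) unfolding is_ray_def by blast
  define l where "l = Arg (- u\<^sub>0)"
  define a1 where "a1 = Arg (u\<^sub>1 / cis l)"
  define am where "am = Arg (u\<^sub>m / cis l)"
  have n: "0 < norm u\<^sub>0" "0 < norm u\<^sub>1" "0 < norm u\<^sub>m" using u by auto
  have u0: "u\<^sub>0 = of_real (norm u\<^sub>0) * cis (l + pi)"
  proof -
    have "- u\<^sub>0 = of_real (norm (- u\<^sub>0)) * cis l" unfolding l_def by (simp add: rcis_cmod_Arg flip: rcis_def del: norm_minus_cancel)
    then show ?thesis by (simp add: cis_mult[symmetric] minus_equation_iff[of u\<^sub>0])
  qed
  have u1: "u\<^sub>1 = of_real (norm u\<^sub>1) * cis (l + a1)" unfolding a1_def by (rule polar_form_of_quotient[OF u(2)])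
  have um: "u\<^sub>m = of_real (norm u\<^sub>m) * cis (l + am)" unfolding am_def by (rule polar_form_of_quotient[OF u(3)])
  have mem0: "cis l * z \<in> L\<^sub>0 \<longleftrightarrow> (\<exists>t\<ge>0. z = of_real t * cis pi)" for z
    unfolding L by (subst u0) (rule mem_ray_rotated[OF n(1)])
  have mem1: "cis l * z \<in> L\<^sub>1 \<longleftrightarrow> (\<exists>t\<ge>0. z = of_real t * cis a1)" for z
    unfolding L by (subst u1) (rule mem_ray_rotated[OF n(2)])
  have memm: "cis l * z \<in> L\<^sub>m \<longleftrightarrow> (\<exists>t\<ge>0. z = of_real t * cis am)" for z
    unfolding L by (subst um) (rule mem_ray_rotated[OF n(3)])
  have ab: "- pi < a1" "a1 \<le> pi" "- pi < am" "am \<le> pi"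
    unfolding a1_def am_def by (simp_all add: mpi_less_Arg Arg_le_pi)
  have ne: "a1 \<noteq> pi" "am \<noteq> pi" "a1 \<noteq> am"
    using assms(4-6) ray_scale[OF n(1,2)] ray_scale[OF n(1,3)] ray_scale[OF n(2,3)] u0 u1 um unfolding L by metis+
  have va: "ray_angle (ray u\<^sub>0) (ray u\<^sub>1) = arccos (cos (pi - a1))"
    "ray_angle (ray u\<^sub>0) (ray u\<^sub>m) = arccos (cos (pi - am))"
    "ray_angle (ray u\<^sub>m) (ray u\<^sub>1) = arccos (cos (am - a1))"
  proof -
    show "ray_angle (ray u\<^sub>0) (ray u\<^sub>1) = arccos (cos (pi - a1))"
      using vangle_cis[OF n(1,2), of "l + pi" "l + a1", folded u0 u1] unfolding ray_angle_ray[OF u(1,2)] add_diff_cancel_left .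
    show "ray_angle (ray u\<^sub>0) (ray u\<^sub>m) = arccos (cos (pi - am))"
      using vangle_cis[OF n(1,3), of "l + pi" "l + am", folded u0 um] unfolding ray_angle_ray[OF u(1,3)] add_diff_cancel_left .
    show "ray_angle (ray u\<^sub>m) (ray u\<^sub>1) = arccos (cos (am - a1))"
      using vangle_cis[OF n(3,2), of "l + am" "l + a1", folded um u1] unfolding ray_angle_ray[OF u(3,2)] add_diff_cancel_left .
  qed
  define b1 b2 where "b1 = min a1 am" and "b2 = max a1 am"
  have b: "- pi < b1" "b1 < b2" "b2 < pi" using ab ne by (auto simp: b1_def b2_def)
  have bset: "(b1 = a1 \<and> b2 = am) \<or> (b1 = am \<and> b2 = a1)" by (auto simp: b1_def b2_def)
  have angles: "\<not> (b2 - b1 = pi \<or> (b1 + b2 = 0 \<and> b2 - b1 > pi))"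
  proof
    assume "b2 - b1 = pi \<or> (b1 + b2 = 0 \<and> b2 - b1 > pi)"
    then show False
    proof (elim disjE conjE)
      assume "b2 - b1 = pi"
      then have "am - a1 = pi \<or> am - a1 = - pi" using bset by auto
      then have "cos (am - a1) = -1" by auto
      then show False using assms(8) va(3) unfolding L by simp
    next
      assume s: "b1 + b2 = 0" "b2 - b1 > pi"
      then have a: "a1 = - am" using bset by auto
      have "\<bar>am\<bar> > pi / 2" "\<bar>am\<bar> < pi" using s bset b a by auto
      then have "0 < sin (\<bar>am\<bar> - pi / 2)" by (intro sin_gt_zero) auto
      then have "0 < - cos \<bar>am\<bar>" by (simp add: sin_diff)
      then have "0 < cos (pi - am)" by (simp add: cos_diff)
      then have "arccos (cos (pi - am)) < pi / 2" using arccos_less_arccos[of 0 "cos (pi - am)"] by simp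
      moreover have "cos (pi - a1) = cos (pi - am)" by (simp add: cos_diff a)
      ultimately show False using assms(9) va unfolding L by simp
    qed
  qed
  show ?thesis unfolding normal_on_def
  proof (intro allI impI)
    fix f :: "nat \<Rightarrow> complex \<Rightarrow> complex" assume "range f \<subseteq> \<F>"
    then have "f k \<in> \<F>" for k by auto
    then have f: "f k holomorphic_on ball 0 1" "\<And>z. z \<in> ball 0 1 \<Longrightarrow> f k z = 0 \<Longrightarrow> z \<in> L\<^sub>0"
      "\<And>z. z \<in> ball 0 1 \<Longrightarrow> f k z = 1 \<Longrightarrow> z \<in> L\<^sub>1 \<union> L\<^sub>m" for k
      unfolding assms(7) by blast+
    have rot: "cis l * z \<in> ball 0 1" if "z \<in> ball 0 1" for z using that by (simp add: norm_mult)
    have "\<exists>r. strict_mono r \<and> (\<forall>z\<in>ball 0 1 - {0}. locally_convergent_at (\<lambda>k z. f (r k) (cis l * z)) z)"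
    proof (rule normalized_convergent_subsequence[OF b angles, of "\<lambda>k z. f k (cis l * z)"])
      show "(\<lambda>z. f k (cis l * z)) holomorphic_on ball 0 1" for k
        by (rule holomorphic_on_compose_gen[OF _ f(1), unfolded o_def]) (use rot in \<open>auto intro!: holomorphic_intros\<close>)
      show "z \<in> \<real>\<^sub>\<le>\<^sub>0" if "z \<in> ball 0 1" "f k (cis l * z) = 0" for k z
        using f(2)[OF rot[OF that(1)] that(2)] unfolding mem0 by (auto simp: complex_nonpos_Reals_iff)
      show "\<exists>x. z = exp (Complex x b1) \<or> z = exp (Complex x b2)" if z: "z \<in> ball 0 1 - {0}" "f k (cis l * z) = 1" for k z
      proof -
        have "cis l * z \<in> L\<^sub>1 \<union> L\<^sub>m" using f(3)[OF rot z(2)] z(1) by blast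
        then obtain t a where t: "t \<ge> 0" "z = of_real t * cis a" "a = a1 \<or> a = am"
          using mem1[of z] memm[of z] by blast
        then have "t > 0" using z(1) by (cases "t = 0") auto
        then have "z = exp (Complex (ln t) a)" using t(2) by (simp add: complex_eq_iff Re_exp Im_exp)
        then show ?thesis using t(3) bset by auto
      qed
    qed
    then obtain r where r: "strict_mono r"
      and lc: "\<And>z. z \<in> ball 0 1 - {0} \<Longrightarrow> locally_convergent_at (\<lambda>k z. f (r k) (cis l * z)) z" by blast
    have "locally_convergent_at (\<lambda>k. f (r k)) z" if z: "z \<in> ball 0 1 - {0}" for z
    proof -
      have "z / cis l \<in> ball 0 1 - {0}" using z by (simp add: norm_divide)
      from locally_convergent_at_rotate[OF lc[OF this]] show ?thesis by simp
    qed
    then have "\<exists>g. sph_locally_uniform_limit (ball 0 1 - {0}) (\<lambda>n z. Fin (f (r n) z)) g"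
      by (rule locally_convergent_imp_sph_limit)
    then show "\<exists>r g. strict_mono r \<and> sph_locally_uniform_limit (ball 0 1 - {0}) (\<lambda>n z. Fin (f (r n) z)) g"
      using r by blast
  qed
qed

end
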